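(* Let $(C_{\varphi_t})_{t\ge0}$ be an immediately compact semigroup of composition operators on $H^2(\mathbb{D})$ or $\mathcal{D}$, such that in the semiflow model the boundary $\partial\Omega$ is locally connected. Then the following conditions are equivalent: 1. There exists a $t_0>0$ such that $\|\varphi_{t_0}\|_\infty<1$; 2. For all $t>0$ one has $\|\varphi_t\|_\infty<1$. Therefore, if there exists a $t_0>0$ such that $\|\varphi_{t_0}\|_\infty<1$, then $(C_{\varphi_t})_{t\ge0}$ is immediately trace-class.
   Context: $\mathbb{D}$ is the open unit disc. $H^2(\mathbb{D})$ is the Hilbert space of analytic $f(z)=\sum_{n\ge0}c_nz^n$ on $\mathbb{D}$ with $\|f\|^2=\sum_{n\ge 0}|c_n|^2<\infty$; $\mathcal{D}$ is the Dirichlet space, with $\|f\|^2=|c_0|^2+\sum_{n\ge1}n|c_n|^2<\infty$. $\|\varphi\|_\infty=\sup_{z\in\mathbb{D}}|\varphi(z)|$, and $C_\varphi f=f\circ\varphi$. A semiflow $(\varphi_t)_{t\ge0}$ is a family of analytic maps $\varphi_t:\mathbb{D}\to\mathbb{D}$ with $\varphi_0=\mathrm{id}$, $\varphi_{s+t}=\varphi_s\circ\varphi_t$ and $(t,z)\mapsto\varphi_t(z)$ jointly continuous. The semigroup $(C_{\varphi_t})_{t\ge0}$ is a $C_0$-semigroup (i.e. strongly continuous at $0$) associated with a semiflow. It is immediately compact (respectively immediately trace-class) if $C_{\varphi_t}$ is compact (respectively trace-class) for all $t>0$. Semiflow model: for an immediately compact semigroup the common Denjoy–Wolff point $\alpha$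 of the maps $\varphi_t$ lies in $\mathbb{D}$. Replacing $\varphi_t$ by $b_\alpha\circ\varphi_t\circ b_\alpha$, where $b_\alpha(z)=\frac{\alpha-z}{1-\overline{\alpha}z}$, one may take the Denjoy–Wolff point to be $0$, and then $$\varphi_t(z)=h^{-1}(e^{-ct}h(z)),$$ where $c\in\mathbb{C}$ with $\operatorname{Re}c\ge0$ and $h:\mathbb{D}\to\Omega$ is a conformal bijection onto a domain $\Omega\subset\mathbb{C}$ with $h(0)=0$ and $e^{-ct}w\in\Omega$ for all $w\in\Omega$, $t\ge0$. The domain $\Omega$ in the statement is the one from this model. A topological space is locally connected if every point has a neighbourhood base of connected open sets. *)

theory Defs
  imports "HOL-Complex_Analysis.Complex_Analysis"
begin

abbreviation unit_disc :: "complex set" where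
  "unit_disc \<equiv> ball 0 1"

definition taylor_coeff :: "(complex \<Rightarrow> complex) \<Rightarrow> nat \<Rightarrow> complex" where
  "taylor_coeff f n = (deriv ^^ n) f 0 / fact n"

text \<open>
  The Hardy space and the Dirichlet space are the weighted spaces below for the weights
  \<open>1, 1, 1, \<dots>\<close> and \<open>1, 1, 2, 3, \<dots>\<close>.
  Elements vanish outside the disc by convention, so that two elements are equal in HOL exactly
  if they agree on the disc, and the pointwise operations are the vector space operations.
\<close>

definition hardy_weight :: "nat \<Rightarrow> real" where
  "hardy_weight n = 1"

definition dirichlet_weight :: "nat \<Rightarrow> real" where
  "dirichlet_weight n = (if n = 0 then 1 else real n)"

definition wspace :: "(nat \<Rightarrow> real) \<Rightarrow> (complex \<Rightarrow> complex) set" where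
  "wspace \<omega> = {f. f holomorphic_on unit_disc \<and> (\<forall>z. z \<notin> unit_disc \<longrightarrow> f z = 0) \<and>
     summable (\<lambda>n. \<omega> n * (cmod (taylor_coeff f n))\<^sup>2)}"

definition wnorm :: "(nat \<Rightarrow> real) \<Rightarrow> (complex \<Rightarrow> complex) \<Rightarrow> real" where
  "wnorm \<omega> f = sqrt (\<Sum>n. \<omega> n * (cmod (taylor_coeff f n))\<^sup>2)"

definition winner :: "(nat \<Rightarrow> real) \<Rightarrow> (complex \<Rightarrow> complex) \<Rightarrow> (complex \<Rightarrow> complex) \<Rightarrow> complex" where
  "winner \<omega> f g = (\<Sum>n. of_real (\<omega> n) * taylor_coeff f n * cnj (taylor_coeff g n))"

type_synonym fun_op = "(complex \<Rightarrow> complex) \<Rightarrow> (complex \<Rightarrow> complex)"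

definition bounded_op :: "(nat \<Rightarrow> real) \<Rightarrow> fun_op \<Rightarrow> bool" where
  "bounded_op \<omega> T \<longleftrightarrow>
     (\<forall>f\<in>wspace \<omega>. T f \<in> wspace \<omega>) \<and>
     (\<forall>f\<in>wspace \<omega>. \<forall>g\<in>wspace \<omega>. \<forall>a b.
        T (\<lambda>z. a * f z + b * g z) = (\<lambda>z. a * T f z + b * T g z)) \<and>
     (\<exists>K. \<forall>f\<in>wspace \<omega>. wnorm \<omega> (T f) \<le> K * wnorm \<omega> f)"

definition compact_op :: "(nat \<Rightarrow> real) \<Rightarrow> fun_op \<Rightarrow> bool" where
  "compact_op \<omega> T \<longleftrightarrow> bounded_op \<omega> T \<and>
     (\<forall>F :: nat \<Rightarrow> complex \<Rightarrow> complex.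
        (\<forall>n. F n \<in> wspace \<omega>) \<and> (\<exists>B. \<forall>n. wnorm \<omega> (F n) \<le> B) \<longrightarrow>
        (\<exists>r g. strict_mono r \<and> g \<in> wspace \<omega> \<and>
           (\<lambda>n. wnorm \<omega> (\<lambda>z. T (F (r n)) z - g z)) \<longlonglongrightarrow> 0))"

definition is_adjoint :: "(nat \<Rightarrow> real) \<Rightarrow> fun_op \<Rightarrow> fun_op \<Rightarrow> bool" where
  "is_adjoint \<omega> T T' \<longleftrightarrow> bounded_op \<omega> T' \<and>
     (\<forall>f\<in>wspace \<omega>. \<forall>g\<in>wspace \<omega>. winner \<omega> (T f) g = winner \<omega> f (T' g))"

definition positive_op :: "(nat \<Rightarrow> real) \<Rightarrow> fun_op \<Rightarrow> bool" where
  "positive_op \<omega> S \<longleftrightarrow> bounded_op \<omega> S \<and>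
     (\<forall>f\<in>wspace \<omega>. winner \<omega> (S f) f \<in> \<real> \<and> 0 \<le> Re (winner \<omega> (S f) f))"

text \<open>\<open>S\<close> is the modulus of \<open>T\<close>, i.e. the positive square root of \<open>T\<^sup>* T\<close>.\<close>

definition is_modulus :: "(nat \<Rightarrow> real) \<Rightarrow> fun_op \<Rightarrow> fun_op \<Rightarrow> bool" where
  "is_modulus \<omega> T S \<longleftrightarrow> positive_op \<omega> S \<and>
     (\<exists>T'. is_adjoint \<omega> T T' \<and> (\<forall>f\<in>wspace \<omega>. S (S f) = T' (T f)))"

definition orthonormal_basis :: "(nat \<Rightarrow> real) \<Rightarrow> (nat \<Rightarrow> complex \<Rightarrow> complex) \<Rightarrow> bool" where
  "orthonormal_basis \<omega> e \<longleftrightarrow>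
     (\<forall>n. e n \<in> wspace \<omega>) \<and>
     (\<forall>m n. winner \<omega> (e m) (e n) = (if m = n then 1 else 0)) \<and>
     (\<forall>f\<in>wspace \<omega>. (\<forall>n. winner \<omega> f (e n) = 0) \<longrightarrow> f = (\<lambda>z. 0))"

text \<open>The trace of the positive operator \<open>S\<close> does not depend on the orthonormal basis.\<close>

definition trace_class_op :: "(nat \<Rightarrow> real) \<Rightarrow> fun_op \<Rightarrow> bool" where
  "trace_class_op \<omega> T \<longleftrightarrow> bounded_op \<omega> T \<and>
     (\<exists>S e. is_modulus \<omega> T S \<and> orthonormal_basis \<omega> e \<and>
        summable (\<lambda>n. Re (winner \<omega> (S (e n)) (e n))))"

definition C0_semigroup :: "(nat \<Rightarrow> real) \<Rightarrow> (real \<Rightarrow> fun_op) \<Rightarrow> bool" where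
  "C0_semigroup \<omega> T \<longleftrightarrow>
     (\<forall>t\<ge>0. bounded_op \<omega> (T t)) \<and>
     (\<forall>f\<in>wspace \<omega>. T 0 f = f) \<and>
     (\<forall>s\<ge>0. \<forall>t\<ge>0. \<forall>f\<in>wspace \<omega>. T (s + t) f = T s (T t f)) \<and>
     (\<forall>f\<in>wspace \<omega>. ((\<lambda>t. wnorm \<omega> (\<lambda>z. T t f z - f z)) \<longlongrightarrow> 0) (at_right 0))"

definition immediately_compact :: "(nat \<Rightarrow> real) \<Rightarrow> (real \<Rightarrow> fun_op) \<Rightarrow> bool" where
  "immediately_compact \<omega> T \<longleftrightarrow> (\<forall>t>0. compact_op \<omega> (T t))"

definition immediately_trace_class :: "(nat \<Rightarrow> real) \<Rightarrow> (real \<Rightarrow> fun_op) \<Rightarrow> bool" where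
  "immediately_trace_class \<omega> T \<longleftrightarrow> (\<forall>t>0. trace_class_op \<omega> (T t))"

definition composition_op :: "(complex \<Rightarrow> complex) \<Rightarrow> fun_op" where
  "composition_op \<phi> f = (\<lambda>z. if z \<in> unit_disc then f (\<phi> z) else 0)"

definition sup_norm :: "(complex \<Rightarrow> complex) \<Rightarrow> real" where
  "sup_norm \<phi> = (SUP z\<in>unit_disc. cmod (\<phi> z))"

definition semiflow :: "(real \<Rightarrow> complex \<Rightarrow> complex) \<Rightarrow> bool" where
  "semiflow \<phi> \<longleftrightarrow>
     (\<forall>t\<ge>0. \<phi> t holomorphic_on unit_disc \<and> \<phi> t ` unit_disc \<subseteq> unit_disc) \<and>
     (\<forall>z\<in>unit_disc. \<phi> 0 z = z) \<and>
     (\<forall>s\<ge>0. \<forall>t\<ge>0. \<forall>z\<in>unit_disc. \<phi> (s + t) z = \<phi> s (\<phi> t z)) \<and>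
     continuous_on ({0..} \<times> unit_disc) (\<lambda>(t, z). \<phi> t z)"

definition denjoy_wolff_point :: "(complex \<Rightarrow> complex) \<Rightarrow> complex \<Rightarrow> bool" where
  "denjoy_wolff_point \<phi> \<alpha> \<longleftrightarrow> \<alpha> \<in> cball 0 1 \<and>
     (\<forall>K. compact K \<and> K \<subseteq> unit_disc \<longrightarrow>
        uniform_limit K (\<lambda>n. \<phi> ^^ n) (\<lambda>_. \<alpha>) sequentially)"

definition disc_involution :: "complex \<Rightarrow> complex \<Rightarrow> complex" where
  "disc_involution \<alpha> z = (\<alpha> - z) / (1 - cnj \<alpha> * z)"

text \<open>
  The model of a semiflow with interior Denjoy--Wolff point \<open>\<alpha>\<close>: after conjugation with the
  involution exchanging \<open>0\<close> and \<open>\<alpha>\<close>, the semiflow is \<open>z \<mapsto> h\<^sup>-\<^sup>1 (exp (-c t) h z)\<close>.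
\<close>

definition semiflow_model ::
  "(real \<Rightarrow> complex \<Rightarrow> complex) \<Rightarrow> complex \<Rightarrow> complex \<Rightarrow> (complex \<Rightarrow> complex) \<Rightarrow> complex set \<Rightarrow> bool" where
  "semiflow_model \<phi> \<alpha> c h \<Omega> \<longleftrightarrow>
     \<alpha> \<in> unit_disc \<and> (\<forall>t>0. denjoy_wolff_point (\<phi> t) \<alpha>) \<and>
     0 \<le> Re c \<and>
     open \<Omega> \<and> connected \<Omega> \<and>
     h holomorphic_on unit_disc \<and> bij_betw h unit_disc \<Omega> \<and> h 0 = 0 \<and>
     (\<forall>t\<ge>0. \<forall>w\<in>\<Omega>. exp (- c * of_real t) * w \<in> \<Omega>) \<and>
     (\<forall>t\<ge>0. \<forall>z\<in>unit_disc.
        disc_involution \<alpha> (\<phi> t (disc_involution \<alpha> z)) =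
        inv_into unit_disc h (exp (- c * of_real t) * h z))"

end

theory Submission
  imports Defs
begin

text \<open>
  Conjugating with the disc involution that exchanges \<open>0\<close> and \<open>\<alpha>\<close> changes neither of the conditions on
  the norms, so the model maps \<open>\<psi>\<^sub>t = h\<^sup>-\<^sup>1 (exp (-c t) h)\<close> may be considered. The bound at
  \<open>t\<^sub>0\<close> says that \<open>exp (-c t\<^sub>0)\<close> maps \<open>\<Omega>\<close> into a compact subset of \<open>\<Omega>\<close>. In particular
  \<open>\<Omega>\<close> is bounded, and the bound at \<open>t\<close> fails only if some \<open>w\<^sub>0\<close> in the closure of \<open>\<Omega>\<close> has
  \<open>exp (-c t) w\<^sub>0 \<notin> \<Omega>\<close>. Since \<open>\<Omega>\<close> is invariant under the flow, the whole arc
  \<open>exp (-c s) w\<^sub>0\<close>, \<open>0 \<le> s \<le> t\<close>, then lies on the boundary of \<open>\<Omega>\<close>.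

  This contradicts compactness. In the coordinate \<open>w = w\<^sub>0 exp (-c \<sigma>)\<close> the flow is translation to
  the right, the arc is the real segment \<open>[0, t]\<close>, and every horizontal line meets the preimage of
  \<open>\<Omega>\<close> in a right half-line (or misses it, or lies in it). Points of \<open>\<Omega>\<close> near \<open>w\<^sub>0\<close> give horizontal lines arbitrarily
  close to the segment, on one of its sides, that enter \<open>\<Omega>\<close> before \<open>t/3\<close>. If other lines on that side entered
  only after \<open>t/2\<close>, the boundary would have points near \<open>t/2\<close> separated from the arc by the former lines,
  and \<open>\<partial>\<Omega>\<close> would not be locally connected at \<open>t/2\<close>. So a whole rectangle with lower (or upper) edge
  \<open>[t/2, t]\<close> lies in \<open>\<Omega>\<close> (\<open>one_sided_box\<close>). On this rectangle \<open>f = h\<^sup>-\<^sup>1 (w\<^sub>0 exp (-c \<sigma>))\<close>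
  has modulus below \<open>1\<close> that tends to \<open>1\<close> at the edge, and \<open>1 - |f|\<close> is comparable to the distance
  from the edge: from below by the Schwarz--Pick inequality in a ball tangent to the edge, from
  above by the maximum principle with an explicit barrier. Comparing two points that a time \<open>s\<close>
  moves to each other gives \<open>z\<close> near the circle with \<open>1 - |\<psi>\<^sub>s(z)| \<le> C (1 - |z|)\<close>
  (\<open>contact_along_flow\<close>). But then the images of normalised reproducing kernels do not tend to zero, while
  the kernels tend to zero pointwise, so the composition operator is not compact
  (\<open>compact_composition_op_no_linear_contact\<close>).

  For the trace class, the modulus of \<open>T\<close> is constructed by the iteration
  \<open>Y\<^sub>n\<^sub>+\<^sub>1 = (B + Y\<^sub>n\<^sup>2) / 2\<close>, whose limit satisfies \<open>(1 - Y)\<^sup>2 = 1 - B\<close>. In the orthonormal basis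
  \<open>e\<^sub>n\<close> of normalised monomials, the trace of the modulus is at most the sum of the norms of \<open>T e\<^sub>n\<close>,
  and for composition with \<open>\<phi>\<close>, \<open>|\<phi>| \<le> r < 1\<close>, these norms are bounded by \<open>M (n + 1) r\<^sup>n\<close>
  because of Parseval's identity on circles, applied to \<open>\<phi>\<^sup>n\<close> in the Hardy space and to the derivative of
  \<open>\<phi>\<^sup>n\<close> in the Dirichlet space.
\<close>


section \<open>The modulus of an operator on a real Hilbert space\<close>

text \<open>
  The scalar case \<open>B = 1\<close> of the iteration for the square root; it dominates the operator iteration
  term by term.
\<close>

lemma real_quadratic_iteration_Cauchy:
  fixes y :: "nat \<Rightarrow> real"
  assumes y0: "y 0 = 0" and yS: "\<And>n. y (Suc n) = (1 + (y n)\<^sup>2) / 2"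
  shows "Cauchy y" "\<And>n. 0 \<le> y n \<and> y n \<le> 1" "incseq y"
proof -
  show b: "0 \<le> y n \<and> y n \<le> 1" for n
  proof (induction n)
    case (Suc n)
    then have "(y n)\<^sup>2 \<le> 1" by (simp add: power_le_one)
    then show ?case by (simp add: yS)
  qed (simp add: y0)
  have "y n \<le> y (Suc n)" for n
  proof -
    have "0 \<le> (1 - y n)\<^sup>2" by simp
    then show ?thesis unfolding yS by (simp add: power2_eq_square algebra_simps)
  qed
  then show inc: "incseq y" by (rule incseq_SucI)
  have "Bseq y" by (rule BseqI'[where K=1]) (use b in auto)
  with inc show "Cauchy y"
    by (intro convergent_Cauchy Bseq_mono_convergent) (auto simp: incseq_def)
qed

lemma blinfun_compose_assoc: "(f o\<^sub>L g) o\<^sub>L k = f o\<^sub>L (g o\<^sub>L k)"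
  by (rule blinfun_eqI) simp

text \<open>
  With \<open>Z = 1 - Y\<close> the equation \<open>2 Y = B + Y\<^sup>2\<close> reads \<open>Z\<^sup>2 = 1 - B\<close>, so this is the square root of
  \<open>1 - B\<close>. The iterates are polynomials in \<open>B\<close> and therefore inherit self-adjointness and every
  commutation relation; their increments are bounded in norm by those of the scalar iteration.
\<close>

lemma blinfun_quadratic_fixed_point:
  fixes B :: "'a::{real_inner,banach} \<Rightarrow>\<^sub>L 'a"
  assumes B: "norm B \<le> 1" and sa: "\<And>x z. inner (B x) z = inner x (B z)"
  shows "\<exists>Y. norm Y \<le> 1 \<and> 2 *\<^sub>R Y = B + (Y o\<^sub>L Y) \<and> (\<forall>x z. inner (Y x) z = inner x (Y z)) \<and>
     (\<forall>J. B o\<^sub>L J = J o\<^sub>L B \<longrightarrow> Y o\<^sub>L J = J o\<^sub>L Y)"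
proof -
  define y :: "nat \<Rightarrow> real" where "y = rec_nat 0 (\<lambda>_ a. (1 + a\<^sup>2) / 2)"
  define Y where "Y = rec_nat (0 :: 'a \<Rightarrow>\<^sub>L 'a) (\<lambda>_ C. (1/2) *\<^sub>R (B + (C o\<^sub>L C)))"
  have y0: "y 0 = 0" and yS: "y (Suc n) = (1 + (y n)\<^sup>2) / 2" for n by (simp_all add: y_def)
  have Y0: "Y 0 = 0" and YS: "Y (Suc n) = (1/2) *\<^sub>R (B + (Y n o\<^sub>L Y n))" for n
    by (simp_all add: Y_def)
  note y = real_quadratic_iteration_Cauchy[of y, OF y0 yS]
  interpret bb: bounded_bilinear "(o\<^sub>L) :: ('a \<Rightarrow>\<^sub>L 'a) \<Rightarrow> ('a \<Rightarrow>\<^sub>L 'a) \<Rightarrow> _"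
    by (rule bounded_bilinear_blinfun_compose)
  have nY: "norm (Y n) \<le> y n" for n
  proof (induction n)
    case (Suc n)
    have "norm (B + (Y n o\<^sub>L Y n)) \<le> norm B + norm (Y n o\<^sub>L Y n)" by (rule norm_triangle_ineq)
    also have "norm (Y n o\<^sub>L Y n) \<le> norm (Y n) * norm (Y n)" by (rule norm_blinfun_compose)
    also have "norm (Y n) * norm (Y n) \<le> y n * y n"
      using Suc y(2)[of n] by (intro mult_mono) auto
    finally show ?case using B by (simp add: YS yS power2_eq_square)
  qed (simp add: Y0 y0)
  have dY: "norm (Y (Suc n) - Y n) \<le> y (Suc n) - y n" for n
  proof (induction n)
    case 0 then show ?case using nY[of "Suc 0"] by (simp add: Y0 y0)
  next
    case (Suc n)
    let ?D = "Y (Suc n) - Y n" and ?P = "Y (Suc n) + Y n"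
    \<comment> \<open>the difference of squares in a form that does not use commutativity\<close>
    have *: "(Y (Suc n) o\<^sub>L Y (Suc n)) - (Y n o\<^sub>L Y n) = (1/2) *\<^sub>R ((?D o\<^sub>L ?P) + (?P o\<^sub>L ?D))"
      by (simp add: bb.add_left bb.add_right bb.diff_left bb.diff_right scaleR_diff_right
           flip: scaleR_2)
    have eq: "Y (Suc (Suc n)) - Y (Suc n) = (1/4) *\<^sub>R ((?D o\<^sub>L ?P) + (?P o\<^sub>L ?D))"
    proof -
      have "Y (Suc (Suc n)) - Y (Suc n) = (1/2) *\<^sub>R ((Y (Suc n) o\<^sub>L Y (Suc n)) - (Y n o\<^sub>L Y n))"
        unfolding YS[of "Suc n"] by (subst (2) YS) (simp add: algebra_simps)
      then show ?thesis unfolding * by simp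
    qed
    have dp: "norm ?P \<le> y (Suc n) + y n"
      using norm_triangle_ineq[of "Y (Suc n)" "Y n"] nY[of n] nY[of "Suc n"] by linarith
    have "norm ((?D o\<^sub>L ?P) + (?P o\<^sub>L ?D)) \<le> norm (?D o\<^sub>L ?P) + norm (?P o\<^sub>L ?D)"
      by (rule norm_triangle_ineq)
    also have "\<dots> \<le> norm ?D * norm ?P + norm ?P * norm ?D"
      by (intro add_mono norm_blinfun_compose)
    also have "\<dots> = 2 * (norm ?D * norm ?P)" by simp
    also have "norm ?D * norm ?P \<le> (y (Suc n) - y n) * (y (Suc n) + y n)"
      using Suc dp incseqD[OF y(3), of n "Suc n"] by (intro mult_mono) auto
    finally have "norm (Y (Suc (Suc n)) - Y (Suc n)) \<le> (y (Suc n) - y n) * (y (Suc n) + y n) / 2"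
      by (simp add: eq)
    also have "\<dots> = y (Suc (Suc n)) - y (Suc n)"
      unfolding yS[of "Suc n"] yS[of n] by (simp add: power2_eq_square field_simps)
    finally show ?case .
  qed
  have dist: "norm (Y (n + k) - Y n) \<le> y (n + k) - y n" for n k
  proof (induction k)
    case (Suc k)
    have "norm (Y (n + Suc k) - Y n) \<le> norm (Y (Suc (n + k)) - Y (n + k)) + norm (Y (n + k) - Y n)"
      using norm_triangle_ineq[of "Y (Suc (n + k)) - Y (n + k)" "Y (n + k) - Y n"] by simp
    with Suc dY[of "n + k"] show ?case by simp
  qed simp
  have "Cauchy Y"
  proof (rule metric_CauchyI)
    fix e :: real assume "e > 0"
    then obtain M where M: "\<And>m n. m \<ge> M \<Longrightarrow> n \<ge> M \<Longrightarrow> dist (y m) (y n) < e"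
      using y(1) unfolding Cauchy_def by meson
    have *: "dist (Y n) (Y m) < e" if "n \<ge> m" "m \<ge> M" for m n
      using dist[of m "n - m"] M[of n m] that by (simp add: dist_norm)
    then show "\<exists>M. \<forall>m\<ge>M. \<forall>n\<ge>M. dist (Y m) (Y n) < e"
      by (metis dist_commute nat_le_linear)
  qed
  then obtain L where L: "Y \<longlonglongrightarrow> L" using convergent_eq_Cauchy by blast
  have "norm L \<le> 1"
  proof (rule Lim_norm_ubound[OF _ L])
    show "\<forall>\<^sub>F n in sequentially. norm (Y n) \<le> 1"
      using nY y(2) by (intro always_eventually allI) (meson order_trans)
  qed simp
  moreover have "2 *\<^sub>R L = B + (L o\<^sub>L L)"
  proof -
    have "(\<lambda>n. (1/2) *\<^sub>R (B + (Y n o\<^sub>L Y n))) \<longlonglongrightarrow> (1/2) *\<^sub>R (B + (L o\<^sub>L L))"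
      by (intro tendsto_intros bb.tendsto L)
    moreover have "(\<lambda>n. Y (Suc n)) \<longlonglongrightarrow> L" using L by (rule LIMSEQ_Suc)
    ultimately have "L = (1/2) *\<^sub>R (B + (L o\<^sub>L L))"
      unfolding YS using LIMSEQ_unique by blast
    then have "2 *\<^sub>R L = 2 *\<^sub>R ((1/2) *\<^sub>R (B + (L o\<^sub>L L)))" by (rule arg_cong)
    then show ?thesis by simp
  qed
  moreover have "inner (L x) z = inner x (L z)" for x z
  proof -
    have "inner (Y n x) z = inner x (Y n z)" for n x z
      by (induction n arbitrary: x z)
         (simp_all add: Y0 YS blinfun.add_left blinfun.scaleR_left inner_add_left inner_add_right sa)
    moreover have "(\<lambda>n. inner (Y n x) z) \<longlonglongrightarrow> inner (L x) z"
      "(\<lambda>n. inner x (Y n z)) \<longlonglongrightarrow> inner x (L z)"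
      by (intro tendsto_intros L)+
    ultimately show ?thesis using LIMSEQ_unique by auto
  qed
  moreover have "L o\<^sub>L J = J o\<^sub>L L" if J: "B o\<^sub>L J = J o\<^sub>L B" for J
  proof -
    have "Y n o\<^sub>L J = J o\<^sub>L Y n" for n
    proof (induction n)
      case (Suc n)
      have "Y n o\<^sub>L Y n o\<^sub>L J = J o\<^sub>L (Y n o\<^sub>L Y n)"
        by (metis Suc blinfun_compose_assoc)
      then show ?case by (simp add: YS bb.add_left bb.add_right bb.scaleR_left bb.scaleR_right J)
    qed (simp add: Y0)
    moreover have "(\<lambda>n. Y n o\<^sub>L J) \<longlonglongrightarrow> (L o\<^sub>L J)" "(\<lambda>n. J o\<^sub>L Y n) \<longlonglongrightarrow> (J o\<^sub>L L)"
      by (intro bb.tendsto tendsto_const L)+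
    ultimately show ?thesis using LIMSEQ_unique by auto
  qed
  ultimately show ?thesis by blast
qed

text \<open>
  After division by \<open>k\<^sup>2\<close>, where \<open>k\<close> bounds both norms, \<open>A = T' T\<close> satisfies
  \<open>|A x|\<^sup>2 \<le> (A x, x)\<close>; hence \<open>|x - A x| \<le> |x|\<close>, and the fixed point lemma applies to
  \<open>B = 1 - A\<close>. The clause on \<open>J\<close> is there for multiplication by \<open>\<i>\<close>: it makes the modulus of
  a complex linear operator complex linear.
\<close>

lemma blinfun_modulus_exists:
  fixes T T' :: "'a::{real_inner,banach} \<Rightarrow>\<^sub>L 'a"
  assumes adj: "\<And>x z. inner (T x) z = inner x (T' z)"
  shows "\<exists>S. S o\<^sub>L S = T' o\<^sub>L T \<and> (\<forall>x z. inner (S x) z = inner x (S z)) \<and> (\<forall>x. 0 \<le> inner (S x) x) \<and>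
     (\<forall>J. T o\<^sub>L J = J o\<^sub>L T \<and> T' o\<^sub>L J = J o\<^sub>L T' \<longrightarrow> S o\<^sub>L J = J o\<^sub>L S)"
proof -
  interpret bb: bounded_bilinear "(o\<^sub>L) :: ('a \<Rightarrow>\<^sub>L 'a) \<Rightarrow> ('a \<Rightarrow>\<^sub>L 'a) \<Rightarrow> _"
    by (rule bounded_bilinear_blinfun_compose)
  define k where "k = 1 + norm T + norm T'"
  have k: "k > 0" "norm T \<le> k" "norm T' \<le> k" by (auto simp: k_def add_pos_nonneg)
  define A where "A = (1/k\<^sup>2) *\<^sub>R (T' o\<^sub>L T)"
  have Aq: "inner (A x) x = (norm (T x))\<^sup>2 / k\<^sup>2" for x
    using adj[of x "T x"] by (simp add: A_def blinfun.scaleR_left power2_norm_eq_inner inner_commute)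
  have nA: "(norm (A x))\<^sup>2 \<le> inner (A x) x" for x
  proof -
    have "norm (T' (T x)) \<le> k * norm (T x)"
      using norm_blinfun[of T' "T x"] k by (meson mult_right_mono norm_ge_zero order_trans)
    then have "(norm (T' (T x)))\<^sup>2 \<le> (k * norm (T x))\<^sup>2" by (intro power_mono) auto
    then have "(norm (A x))\<^sup>2 \<le> (k * norm (T x))\<^sup>2 / (k\<^sup>2)\<^sup>2"
      using k by (simp add: A_def blinfun.scaleR_left divide_right_mono power_divide)
    also have "\<dots> = inner (A x) x" using k by (simp add: Aq power_mult_distrib field_simps power2_eq_square)
    finally show ?thesis .
  qed
  define B where "B = id_blinfun - A"
  have "norm (B x) \<le> 1 * norm x" for x
  proof -
    have "(norm (B x))\<^sup>2 = (norm x)\<^sup>2 - 2 * inner (A x) x + (norm (A x))\<^sup>2"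
      by (simp add: B_def blinfun.diff_left power2_norm_eq_inner inner_diff_left inner_diff_right inner_commute)
    also have "\<dots> \<le> (norm x)\<^sup>2" using nA[of x] Aq[of x] by (smt (verit) zero_le_divide_iff zero_le_power2)
    finally have "norm (B x) \<le> norm x" by (rule power2_le_imp_le) simp
    then show ?thesis by simp
  qed
  then have nB: "norm B \<le> 1" by (intro norm_blinfun_bound) auto
  have T'T: "inner (T' y) z = inner y (T z)" for y z
    by (metis adj inner_commute)
  have saA: "inner (A x) z = inner x (A z)" for x z
    by (simp add: A_def blinfun.scaleR_left adj T'T)
  have saB: "inner (B x) z = inner x (B z)" for x z
    by (simp add: B_def blinfun.diff_left inner_diff_left inner_diff_right saA)
  obtain Y where Y: "norm Y \<le> 1" "2 *\<^sub>R Y = B + (Y o\<^sub>L Y)" "\<And>x z. inner (Y x) z = inner x (Y z)"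
    "\<And>J. B o\<^sub>L J = J o\<^sub>L B \<Longrightarrow> Y o\<^sub>L J = J o\<^sub>L Y"
    using blinfun_quadratic_fixed_point[OF nB saB] by blast
  define S where "S = k *\<^sub>R (id_blinfun - Y)"
  have idl: "id_blinfun o\<^sub>L X = X" "X o\<^sub>L id_blinfun = X" for X :: "'a \<Rightarrow>\<^sub>L 'a"
    by (auto intro: blinfun_eqI)
  have "S o\<^sub>L S = k\<^sup>2 *\<^sub>R (id_blinfun - 2 *\<^sub>R Y + (Y o\<^sub>L Y))"
    by (simp add: S_def bb.scaleR_left bb.scaleR_right bb.diff_left bb.diff_right idl power2_eq_square
       scaleR_2 algebra_simps)
  also have "id_blinfun - 2 *\<^sub>R Y + (Y o\<^sub>L Y) = A" unfolding Y(2) B_def by simp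
  also have "k\<^sup>2 *\<^sub>R A = T' o\<^sub>L T" using k by (simp add: A_def)
  finally have "S o\<^sub>L S = T' o\<^sub>L T" .
  moreover have "inner (S x) z = inner x (S z)" for x z
    by (simp add: S_def blinfun.scaleR_left blinfun.diff_left inner_diff_left inner_diff_right Y(3))
  moreover have "0 \<le> inner (S x) x" for x
  proof -
    have "inner (Y x) x \<le> norm (Y x) * norm x" by (rule norm_cauchy_schwarz)
    also have "norm (Y x) \<le> 1 * norm x"
      using norm_blinfun[of Y x] Y(1) by (meson mult_right_mono norm_ge_zero order_trans)
    finally have "inner (Y x) x \<le> inner x x" by (simp add: mult_right_mono dot_square_norm power2_eq_square)
    then show ?thesis using k by (simp add: S_def blinfun.scaleR_left blinfun.diff_left inner_diff_left)
  qed
  moreover have "S o\<^sub>L J = J o\<^sub>L S" if "T o\<^sub>L J = J o\<^sub>L T" "T' o\<^sub>L J = J o\<^sub>L T'" for J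
  proof -
    have "(T' o\<^sub>L T) o\<^sub>L J = J o\<^sub>L (T' o\<^sub>L T)" by (metis that blinfun_compose_assoc)
    then have "B o\<^sub>L J = J o\<^sub>L B"
      by (simp add: B_def A_def bb.diff_left bb.diff_right idl bb.scaleR_left bb.scaleR_right)
    from Y(4)[OF this] show ?thesis
      by (simp add: S_def bb.diff_left bb.diff_right idl bb.scaleR_left bb.scaleR_right)
  qed
  ultimately show ?thesis by blast
qed

section \<open>Square-summable sequences as a real Hilbert space\<close>

text \<open>
  The complex sequences form a real Hilbert space, so that complex linear operators are the bounded real linear
  ones that commute with multiplication by \<open>\<i>\<close>.
\<close>

typedef ell2 = "{x :: nat \<Rightarrow> complex. summable (\<lambda>n. (cmod (x n))\<^sup>2)}"
  morphisms ell2_nth ell2_of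
  by (rule exI[of _ "\<lambda>_. 0"]) simp

lemma ell2_summable: "summable (\<lambda>n. (cmod (ell2_nth x n))\<^sup>2)"
  using ell2_nth[of x] by simp

lemma ell2_nth_of: "summable (\<lambda>n. (cmod (f n))\<^sup>2) \<Longrightarrow> ell2_nth (ell2_of f) = f"
  by (simp add: ell2_of_inverse)

lemma ell2_eqI: "(\<And>n. ell2_nth x n = ell2_nth y n) \<Longrightarrow> x = y"
  by (metis ell2_nth_inject ext)

lemma summable_cmod_square_add:
  assumes "summable (\<lambda>n. (cmod (f n))\<^sup>2)" "summable (\<lambda>n. (cmod (g n))\<^sup>2)"
  shows "summable (\<lambda>n. (cmod (f n + g n))\<^sup>2)"
proof (rule summable_comparison_test'[where N=0])
  show "summable (\<lambda>n. 2 * (cmod (f n))\<^sup>2 + 2 * (cmod (g n))\<^sup>2)"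
    by (intro summable_add summable_mult assms)
  fix n
  have "(cmod (f n + g n))\<^sup>2 \<le> (cmod (f n) + cmod (g n))\<^sup>2"
    by (intro power_mono norm_triangle_ineq) auto
  also have "\<dots> \<le> 2 * (cmod (f n))\<^sup>2 + 2 * (cmod (g n))\<^sup>2"
    using zero_le_power2[of "cmod (f n) - cmod (g n)"] by (simp add: power2_eq_square algebra_simps)
  finally show "norm ((cmod (f n + g n))\<^sup>2) \<le> 2 * (cmod (f n))\<^sup>2 + 2 * (cmod (g n))\<^sup>2" by simp
qed

lemma summable_mult_cnj_norm:
  assumes "summable (\<lambda>n. (cmod (f n))\<^sup>2)" "summable (\<lambda>n. (cmod (g n))\<^sup>2)"
  shows "summable (\<lambda>n. norm (f n * cnj (g n)))"
proof (rule summable_comparison_test'[where N=0])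
  show "summable (\<lambda>n. (cmod (f n))\<^sup>2 + (cmod (g n))\<^sup>2)"
    by (intro summable_add assms)
  fix n
  have "cmod (f n) * cmod (g n) \<le> (cmod (f n))\<^sup>2 + (cmod (g n))\<^sup>2"
    using sum_squares_bound[of "cmod (f n)" "cmod (g n)"]
      mult_nonneg_nonneg[OF norm_ge_zero[of "f n"] norm_ge_zero[of "g n"]] by linarith
  then show "norm (norm (f n * cnj (g n))) \<le> (cmod (f n))\<^sup>2 + (cmod (g n))\<^sup>2"
    by (simp add: norm_mult)
qed

instantiation ell2 :: real_vector
begin

definition zero_ell2 :: ell2 where "0 = ell2_of (\<lambda>_. 0)"
definition plus_ell2 :: "ell2 \<Rightarrow> ell2 \<Rightarrow> ell2"
  where "x + y = ell2_of (\<lambda>n. ell2_nth x n + ell2_nth y n)"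
definition uminus_ell2 :: "ell2 \<Rightarrow> ell2" where "- x = ell2_of (\<lambda>n. - ell2_nth x n)"
definition minus_ell2 :: "ell2 \<Rightarrow> ell2 \<Rightarrow> ell2"
  where "x - y = ell2_of (\<lambda>n. ell2_nth x n - ell2_nth y n)"
definition scaleR_ell2 :: "real \<Rightarrow> ell2 \<Rightarrow> ell2"
  where "scaleR r x = ell2_of (\<lambda>n. of_real r * ell2_nth x n)"

lemma ell2_nth_zero [simp]: "ell2_nth 0 n = 0"
  by (simp add: zero_ell2_def ell2_nth_of)

lemma ell2_nth_add [simp]: "ell2_nth (x + y) n = ell2_nth x n + ell2_nth y n"
  by (simp add: plus_ell2_def ell2_nth_of summable_cmod_square_add ell2_summable)

lemma ell2_nth_uminus [simp]: "ell2_nth (- x) n = - ell2_nth x n"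
  by (simp add: uminus_ell2_def ell2_nth_of ell2_summable)

lemma ell2_nth_minus [simp]: "ell2_nth (x - y) n = ell2_nth x n - ell2_nth y n"
  using summable_cmod_square_add[OF ell2_summable[of x], of "\<lambda>n. - ell2_nth y n"] ell2_summable[of y]
  by (simp add: minus_ell2_def ell2_nth_of)

lemma ell2_nth_scaleR [simp]: "ell2_nth (scaleR r x) n = of_real r * ell2_nth x n"
  by (simp add: scaleR_ell2_def ell2_nth_of norm_mult power_mult_distrib summable_mult ell2_summable)

instance
  by standard (auto intro!: ell2_eqI simp: algebra_simps)

end

instantiation ell2 :: real_inner
begin

definition inner_ell2 :: "ell2 \<Rightarrow> ell2 \<Rightarrow> real"
  where "inner x y = (\<Sum>n. Re (ell2_nth x n * cnj (ell2_nth y n)))"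
definition norm_ell2 :: "ell2 \<Rightarrow> real" where "norm x = sqrt (inner x x)" for x :: ell2
definition sgn_ell2 :: "ell2 \<Rightarrow> ell2" where "sgn x = scaleR (inverse (norm x)) x" for x :: ell2
definition dist_ell2 :: "ell2 \<Rightarrow> ell2 \<Rightarrow> real" where "dist x y = norm (x - y)" for x y :: ell2
definition uniformity_ell2 :: "(ell2 \<times> ell2) filter"
  where "uniformity_ell2 = (INF e\<in>{0<..}. principal {(x, y). dist x y < e})"
definition open_ell2 :: "ell2 set \<Rightarrow> bool"
  where "open_ell2 U \<longleftrightarrow> (\<forall>x\<in>U. \<forall>\<^sub>F (x', y) in uniformity. x' = x \<longrightarrow> y \<in> U)"

lemma ell2_inner_summable: "summable (\<lambda>n. Re (ell2_nth x n * cnj (ell2_nth y n)))"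
  by (rule summable_Re[OF summable_norm_cancel[OF summable_mult_cnj_norm[OF ell2_summable ell2_summable]]])

lemma ell2_inner_self: "inner x x = (\<Sum>n. (cmod (ell2_nth x n))\<^sup>2)" for x :: ell2
  unfolding inner_ell2_def cmod_power2 by (simp add: power2_eq_square)

instance
proof
  fix x y z :: ell2 and r :: real
  show "dist x y = norm (x - y)" "sgn x = inverse (norm x) *\<^sub>R x"
    by (simp_all add: dist_ell2_def sgn_ell2_def)
  show "uniformity = (INF e\<in>{0<..}. principal {(x :: ell2, y). dist x y < e})"
    by (rule uniformity_ell2_def)
  show "open U = (\<forall>x\<in>U. \<forall>\<^sub>F (x', y) in uniformity. x' = x \<longrightarrow> y \<in> U)" for U :: "ell2 set"
    by (rule open_ell2_def)
  show "inner x y = inner y x"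
    by (simp add: inner_ell2_def algebra_simps)
  show "inner (x + y) z = inner x z + inner y z"
    unfolding inner_ell2_def suminf_add[OF ell2_inner_summable ell2_inner_summable]
    by (simp add: algebra_simps)
  show "inner (r *\<^sub>R x) y = r * inner x y"
    unfolding inner_ell2_def suminf_mult[OF ell2_inner_summable, symmetric]
    by (simp add: algebra_simps)
  show "0 \<le> inner x x"
    unfolding ell2_inner_self by (intro suminf_nonneg ell2_summable) auto
  show "(inner x x = 0) = (x = 0)"
    unfolding ell2_inner_self
    by (subst suminf_eq_zero_iff[OF ell2_summable]) (auto intro: ell2_eqI)
  show "norm x = sqrt (inner x x)" by (rule norm_ell2_def)
qed

end

lemma ell2_norm_square: "(norm x)\<^sup>2 = (\<Sum>n. (cmod (ell2_nth x n))\<^sup>2)" for x :: ell2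
  by (simp only: power2_norm_eq_inner[of x] ell2_inner_self)

lemma ell2_sum_le_norm: "(\<Sum>n<N. (cmod (ell2_nth x n))\<^sup>2) \<le> (norm x)\<^sup>2"
  unfolding ell2_norm_square by (rule sum_le_suminf) (auto simp: ell2_summable)

lemma ell2_nth_le_norm: "cmod (ell2_nth x n) \<le> norm x"
proof (rule power2_le_imp_le)
  have "(cmod (ell2_nth x n))\<^sup>2 \<le> (\<Sum>k<Suc n. (cmod (ell2_nth x k))\<^sup>2)"
    by (rule member_le_sum[where f="\<lambda>k. (cmod (ell2_nth x k))\<^sup>2"]) auto
  with ell2_sum_le_norm[of x "Suc n"] show "(cmod (ell2_nth x n))\<^sup>2 \<le> (norm x)\<^sup>2" by linarith
qed simp

text \<open>
  Coordinatewise limits and functionals are shown to be given by square-summable sequences by bounding partial sums.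
\<close>

lemma ell2_of_bounded_sums:
  assumes "\<And>N. (\<Sum>n<N. (cmod (f n))\<^sup>2) \<le> C\<^sup>2" "C \<ge> 0"
  shows "ell2_nth (ell2_of f) = f" "norm (ell2_of f) \<le> C"
proof -
  have s: "summable (\<lambda>n. (cmod (f n))\<^sup>2)"
    by (rule bounded_imp_summable[where B="C\<^sup>2"]) (use assms(1)[of "Suc _"] in \<open>simp_all add: lessThan_Suc_atMost\<close>)
  then show *: "ell2_nth (ell2_of f) = f" by (rule ell2_nth_of)
  have "(norm (ell2_of f))\<^sup>2 \<le> C\<^sup>2"
    unfolding ell2_norm_square * by (rule suminf_le_const[OF s assms(1)])
  then show "norm (ell2_of f) \<le> C" using assms(2) by (rule power2_le_imp_le)
qed

instance ell2 :: banach
proof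
  fix X :: "nat \<Rightarrow> ell2" assume X: "Cauchy X"
  have "Cauchy (\<lambda>k. ell2_nth (X k) n)" for n
  proof (rule metric_CauchyI)
    fix e :: real assume "e > 0"
    then obtain M where M: "\<And>j k. j \<ge> M \<Longrightarrow> k \<ge> M \<Longrightarrow> dist (X j) (X k) < e"
      using X unfolding Cauchy_def by meson
    have "dist (ell2_nth (X j) n) (ell2_nth (X k) n) < e" if "j \<ge> M" "k \<ge> M" for j k
      using M[OF that] ell2_nth_le_norm[of "X j - X k" n] by (simp add: dist_norm)
    then show "\<exists>M. \<forall>j\<ge>M. \<forall>k\<ge>M. dist (ell2_nth (X j) n) (ell2_nth (X k) n) < e" by blast
  qed
  then have "\<forall>n. \<exists>a. (\<lambda>k. ell2_nth (X k) n) \<longlonglongrightarrow> a"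
    by (simp add: Cauchy_convergent_iff convergent_def)
  then obtain a where a: "\<And>n. (\<lambda>k. ell2_nth (X k) n) \<longlonglongrightarrow> a n" by metis
  have tail: "\<exists>M. \<forall>j\<ge>M. norm (X j - ell2_of a) \<le> e" if e: "e > 0" for e
  proof -
    obtain M where M: "\<And>j k. j \<ge> M \<Longrightarrow> k \<ge> M \<Longrightarrow> dist (X j) (X k) < e"
      using X e unfolding Cauchy_def by meson
    have b: "(\<Sum>n<N. (cmod (ell2_nth (X j) n - a n))\<^sup>2) \<le> e\<^sup>2" if j: "j \<ge> M" for j N
    proof (rule LIMSEQ_le_const2)
      show "(\<lambda>k. \<Sum>n<N. (cmod (ell2_nth (X j) n - ell2_nth (X k) n))\<^sup>2)
          \<longlonglongrightarrow> (\<Sum>n<N. (cmod (ell2_nth (X j) n - a n))\<^sup>2)"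
        by (intro tendsto_intros a)
      show "\<exists>K. \<forall>k\<ge>K. (\<Sum>n<N. (cmod (ell2_nth (X j) n - ell2_nth (X k) n))\<^sup>2) \<le> e\<^sup>2"
      proof (intro exI allI impI)
        fix k assume "k \<ge> M"
        then have "(norm (X j - X k))\<^sup>2 \<le> e\<^sup>2"
          using M[OF j, of k] by (intro power_mono) (auto simp: dist_norm)
        with ell2_sum_le_norm[of "X j - X k" N]
        show "(\<Sum>n<N. (cmod (ell2_nth (X j) n - ell2_nth (X k) n))\<^sup>2) \<le> e\<^sup>2" by simp
      qed
    qed
    define d where "d j = ell2_of (\<lambda>n. ell2_nth (X j) n - a n)" for j
    have d: "ell2_nth (d j) = (\<lambda>n. ell2_nth (X j) n - a n)" "norm (d j) \<le> e" if "j \<ge> M" for j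
      unfolding d_def using ell2_of_bounded_sums[OF b[OF that]] e by auto
    have "summable (\<lambda>n. (cmod (a n))\<^sup>2)"
      using ell2_summable[of "X M - d M"] by (simp add: d)
    then have "ell2_nth (ell2_of a) = a" by (rule ell2_nth_of)
    then have "X j - ell2_of a = d j" if "j \<ge> M" for j
      using d(1)[OF that] by (intro ell2_eqI) simp
    then show ?thesis using d(2) by metis
  qed
  have "X \<longlonglongrightarrow> ell2_of a"
  proof (rule metric_LIMSEQ_I)
    fix e :: real assume "e > 0"
    then obtain M where "\<forall>j\<ge>M. norm (X j - ell2_of a) \<le> e / 2" using tail[of "e/2"] by auto
    with \<open>e > 0\<close> show "\<exists>M. \<forall>j\<ge>M. dist (X j) (ell2_of a) < e"
      by (intro exI[of _ M]) (force simp: dist_norm)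
  qed
  then show "convergent X" by (auto simp: convergent_def)
qed

definition ell2_imult :: "ell2 \<Rightarrow>\<^sub>L ell2"
  where "ell2_imult = Blinfun (\<lambda>x. ell2_of (\<lambda>n. \<i> * ell2_nth x n))"

lemma ell2_nth_imult [simp]: "ell2_nth (ell2_imult x) n = \<i> * ell2_nth x n"
proof -
  define g where "g x = ell2_of (\<lambda>n. \<i> * ell2_nth x n)" for x
  have "summable (\<lambda>n. (cmod (\<i> * ell2_nth x n))\<^sup>2)" for x
    by (simp add: norm_mult ell2_summable)
  then have nth: "ell2_nth (g x) n = \<i> * ell2_nth x n" for x n
    by (simp add: g_def ell2_nth_of)
  have nrm: "norm (g x) = norm x" for x
    unfolding norm_ell2_def ell2_inner_self by (simp add: nth norm_mult)
  have "bounded_linear g"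
  proof (rule bounded_linear_intro[where K=1])
    show "g (x + y) = g x + g y" for x y by (rule ell2_eqI) (simp add: nth algebra_simps)
    show "g (r *\<^sub>R x) = r *\<^sub>R g x" for r x by (rule ell2_eqI) (simp add: nth)
  qed (simp add: nrm)
  then have "blinfun_apply ell2_imult = g"
    unfolding ell2_imult_def g_def[symmetric, abs_def] by (rule bounded_linear_Blinfun_apply)
  then show ?thesis by (simp add: nth)
qed

lemma ell2_imult_skew: "inner (ell2_imult x) y = - inner x (ell2_imult y)"
  unfolding inner_ell2_def suminf_minus[OF ell2_inner_summable, symmetric]
  by (simp add: algebra_simps)

lemma ell2_cinner:
  "(\<Sum>n. ell2_nth x n * cnj (ell2_nth y n)) = Complex (inner x y) (inner x (ell2_imult y))"
proof (rule complex_eqI)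
  have s: "summable (\<lambda>n. ell2_nth x n * cnj (ell2_nth y n))"
    by (rule summable_norm_cancel[OF summable_mult_cnj_norm[OF ell2_summable ell2_summable]])
  show "Re (\<Sum>n. ell2_nth x n * cnj (ell2_nth y n)) = Re (Complex (inner x y) (inner x (ell2_imult y)))"
    unfolding Re_suminf[OF s] by (simp add: inner_ell2_def)
  show "Im (\<Sum>n. ell2_nth x n * cnj (ell2_nth y n)) = Im (Complex (inner x y) (inner x (ell2_imult y)))"
    unfolding Im_suminf[OF s] by (simp add: inner_ell2_def algebra_simps)
qed

definition ell2_unit :: "nat \<Rightarrow> complex \<Rightarrow> ell2"
  where "ell2_unit k a = ell2_of (\<lambda>n. if n = k then a else 0)"

lemma ell2_nth_unit [simp]: "ell2_nth (ell2_unit k a) n = (if n = k then a else 0)"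
proof -
  have "summable (\<lambda>n. (cmod (if n = k then a else 0))\<^sup>2)"
    by (rule summable_finite[of "{k}"]) auto
  then show ?thesis by (simp add: ell2_unit_def ell2_nth_of)
qed

lemma ell2_inner_unit: "inner (ell2_unit k a) y = Re (a * cnj (ell2_nth y k))"
proof -
  have "inner (ell2_unit k a) y = (\<Sum>n\<in>{k}. Re (ell2_nth (ell2_unit k a) n * cnj (ell2_nth y n)))"
    unfolding inner_ell2_def by (rule suminf_finite) auto
  then show ?thesis by simp
qed

lemma ell2_nth_sum: "ell2_nth (sum f A) n = (\<Sum>k\<in>A. ell2_nth (f k) n)"
  by (induction A rule: infinite_finite_induct) auto

lemma ell2_truncation_tendsto: "(\<lambda>N. \<Sum>k<N. ell2_unit k (ell2_nth x k)) \<longlonglongrightarrow> x"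
proof -
  have nth: "ell2_nth (\<Sum>k<N. ell2_unit k (ell2_nth x k)) n = (if n < N then ell2_nth x n else 0)" for n N
    by (simp add: ell2_nth_sum)
  have "(norm ((\<Sum>k<N. ell2_unit k (ell2_nth x k)) - x))\<^sup>2 = (norm x)\<^sup>2 - (\<Sum>n<N. (cmod (ell2_nth x n))\<^sup>2)" for N
  proof -
    have "(norm ((\<Sum>k<N. ell2_unit k (ell2_nth x k)) - x))\<^sup>2 =
        (\<Sum>n. (cmod (ell2_nth x n))\<^sup>2 - (if n < N then (cmod (ell2_nth x n))\<^sup>2 else 0))"
      unfolding ell2_norm_square by (intro suminf_cong) (auto simp: nth)
    also have "\<dots> = (norm x)\<^sup>2 - (\<Sum>n. (if n < N then (cmod (ell2_nth x n))\<^sup>2 else 0))"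
      unfolding ell2_norm_square
      by (rule suminf_diff[symmetric]) (auto simp: ell2_summable intro: summable_finite[of "{..<N}"])
    also have "(\<Sum>n. (if n < N then (cmod (ell2_nth x n))\<^sup>2 else 0)) = (\<Sum>n<N. (cmod (ell2_nth x n))\<^sup>2)"
      by (subst suminf_finite[of "{..<N}"]) auto
    finally show ?thesis .
  qed
  moreover have "(\<lambda>N. (norm x)\<^sup>2 - (\<Sum>n<N. (cmod (ell2_nth x n))\<^sup>2)) \<longlonglongrightarrow> (norm x)\<^sup>2 - (norm x)\<^sup>2"
    using summable_LIMSEQ[OF ell2_summable[of x]]
    by (intro tendsto_intros) (simp add: ell2_norm_square)
  ultimately have "(\<lambda>N. (norm ((\<Sum>k<N. ell2_unit k (ell2_nth x k)) - x))\<^sup>2) \<longlonglongrightarrow> 0" by simp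
  then have "(\<lambda>N. sqrt ((norm ((\<Sum>k<N. ell2_unit k (ell2_nth x k)) - x))\<^sup>2)) \<longlonglongrightarrow> sqrt 0"
    by (rule tendsto_real_sqrt)
  then show ?thesis by (simp add: LIM_zero_iff tendsto_norm_zero_iff)
qed

text \<open>
  The representing sequence is read off from the values of the functional on the unit vectors and their
  multiples by \<open>\<i>\<close>. Testing the functional on a truncation of that sequence bounds the truncation by the
  norm of the functional.
\<close>

lemma ell2_riesz:
  fixes F :: "ell2 \<Rightarrow>\<^sub>L real"
  shows "\<exists>y. \<forall>x. F x = inner x y"
proof -
  define f where "f k = Complex (F (ell2_unit k 1)) (F (ell2_unit k \<i>))" for k
  have Fu: "F (ell2_unit k a) = Re (a * cnj (f k))" for k a
  proof -
    have "ell2_unit k a = Re a *\<^sub>R ell2_unit k 1 + Im a *\<^sub>R ell2_unit k \<i>"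
      by (intro ell2_eqI) (auto simp: complex_eq_iff)
    then show ?thesis by (simp add: f_def blinfun.add_right blinfun.scaleR_right)
  qed
  have b: "(\<Sum>n<N. (cmod (f n))\<^sup>2) \<le> (norm F)\<^sup>2" for N
  proof -
    define x where "x = (\<Sum>k<N. ell2_unit k (f k))"
    have nth: "ell2_nth x n = (if n < N then f n else 0)" for n
      by (simp add: x_def ell2_nth_sum)
    have nx: "(norm x)\<^sup>2 = (\<Sum>n<N. (cmod (f n))\<^sup>2)"
      unfolding ell2_norm_square by (subst suminf_finite[of "{..<N}"]) (auto simp: nth)
    have "F x = (\<Sum>n<N. (cmod (f n))\<^sup>2)"
      unfolding x_def blinfun.sum_right Fu cmod_power2 by (simp add: power2_eq_square)
    then have "(norm x)\<^sup>2 \<le> norm F * norm x" using norm_blinfun[of F x] nx by simp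
    then have "norm x \<le> norm F"
      by (cases "norm x = 0") (auto simp: power2_eq_square)
    then show ?thesis unfolding nx[symmetric] by (intro power_mono) auto
  qed
  note y = ell2_of_bounded_sums(1)[OF b norm_ge_zero]
  have "F x = inner x (ell2_of f)" for x
  proof (rule LIMSEQ_unique)
    let ?x = "\<lambda>N. \<Sum>k<N. ell2_unit k (ell2_nth x k)"
    show "(\<lambda>N. F (?x N)) \<longlonglongrightarrow> F x" by (intro tendsto_intros ell2_truncation_tendsto)
    have "F (?x N) = inner (?x N) (ell2_of f)" for N
      by (simp add: blinfun.sum_right Fu inner_sum_left ell2_inner_unit y)
    then show "(\<lambda>N. F (?x N)) \<longlonglongrightarrow> inner x (ell2_of f)"
      by (simp only:) (intro tendsto_intros ell2_truncation_tendsto)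
  qed
  then show ?thesis by blast
qed

lemma ell2_adjoint:
  fixes T :: "ell2 \<Rightarrow>\<^sub>L ell2"
  shows "\<exists>T' :: ell2 \<Rightarrow>\<^sub>L ell2. \<forall>x y. inner (T x) y = inner x (T' y)"
proof -
  have "\<exists>z. \<forall>x. inner (T x) y = inner x z" for y
  proof -
    have "bounded_linear (\<lambda>x. inner (T x) y)" by (intro bounded_linear_intros)
    then show ?thesis using ell2_riesz[of "Blinfun (\<lambda>x. inner (T x) y)"]
      by (simp add: bounded_linear_Blinfun_apply)
  qed
  then obtain g where g: "\<And>x y. inner (T x) y = inner x (g y)" by metis
  have eqI: "u = v" if "\<And>x. inner x u = inner x v" for u v :: ell2
    using that[of "u - v"] by (metis inner_diff_right inner_eq_zero_iff right_minus_eq)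
  have "bounded_linear g"
  proof (rule bounded_linear_intro[where K="norm T"])
    show "g (x + y) = g x + g y" for x y by (rule eqI) (simp add: inner_add_right flip: g)
    show "g (r *\<^sub>R x) = r *\<^sub>R g x" for r x by (rule eqI) (simp flip: g)
    show "norm (g y) \<le> norm y * norm T" for y
    proof -
      have "(norm (g y))\<^sup>2 = inner (T (g y)) y" by (simp add: g power2_norm_eq_inner)
      also have "\<dots> \<le> norm (T (g y)) * norm y" by (rule norm_cauchy_schwarz)
      also have "\<dots> \<le> (norm T * norm (g y)) * norm y" by (intro mult_right_mono norm_blinfun) auto
      finally show ?thesis
        by (cases "norm (g y) = 0") (auto simp: power2_eq_square mult_ac)
    qed
  qed
  then have "\<forall>x y. inner (T x) y = inner x (Blinfun g y)"
    by (simp add: bounded_linear_Blinfun_apply g)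
  then show ?thesis by blast
qed

lemma ell2_adjoint_commutes_imult:
  fixes T T' :: "ell2 \<Rightarrow>\<^sub>L ell2"
  assumes adj: "\<And>x y. inner (T x) y = inner x (T' y)"
    and T: "T o\<^sub>L ell2_imult = ell2_imult o\<^sub>L T"
  shows "T' o\<^sub>L ell2_imult = ell2_imult o\<^sub>L T'"
proof (rule blinfun_eqI)
  fix y
  have Tx: "T (ell2_imult x) = ell2_imult (T x)" for x
    using T by (metis blinfun_apply_blinfun_compose)
  have "inner x (T' (ell2_imult y)) = inner x (ell2_imult (T' y))" for x
    using adj[of x "ell2_imult y"] adj[of "ell2_imult x" y] Tx[of x]
      ell2_imult_skew[of "T x" y] ell2_imult_skew[of x "T' y"] by simp
  from this[of "T' (ell2_imult y) - ell2_imult (T' y)"]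
  have "inner (T' (ell2_imult y) - ell2_imult (T' y)) (T' (ell2_imult y) - ell2_imult (T' y)) = 0"
    by (simp add: inner_diff_right)
  then show "(T' o\<^sub>L ell2_imult) y = (ell2_imult o\<^sub>L T') y" by simp
qed

section \<open>Weighted spaces in the coordinates of the monomials\<close>

lemma taylor_sums:
  assumes "f holomorphic_on unit_disc" "z \<in> unit_disc"
  shows "(\<lambda>n. taylor_coeff f n * z ^ n) sums f z"
  using holomorphic_power_series[OF assms] by (simp add: taylor_coeff_def)

lemma taylor_coeff_unique:
  assumes "\<And>z. z \<in> unit_disc \<Longrightarrow> (\<lambda>n. a n * z ^ n) sums f z"
  shows "taylor_coeff f n = a n"
proof -
  have sm: "summable (\<lambda>n. a n * (1/2 :: complex) ^ n)"
    using assms[of "1/2"] by (simp add: sums_iff norm_divide)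
  have "f has_fps_expansion Abs_fps a"
    unfolding has_fps_expansion_def
  proof
    have "ereal (norm (1/2 :: complex)) \<le> fps_conv_radius (Abs_fps a)"
      unfolding fps_conv_radius_def fps_nth_Abs_fps by (rule conv_radius_geI[OF sm])
    moreover have "(0::ereal) < ereal (norm (1/2 :: complex))" by (simp add: norm_divide)
    ultimately show "0 < fps_conv_radius (Abs_fps a)" by (rule less_le_trans[rotated])
    have "eventually (\<lambda>z. z \<in> unit_disc) (nhds (0::complex))" by (rule eventually_nhds_in_open) auto
    then show "\<forall>\<^sub>F z in nhds 0. eval_fps (Abs_fps a) z = f z"
      by eventually_elim (use assms in \<open>simp add: eval_fps_def sums_iff\<close>)
  qed
  from fps_nth_fps_expansion[OF this] show ?thesis by (simp add: taylor_coeff_def)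
qed

lemma taylor_coeff_linear:
  assumes "f holomorphic_on unit_disc" "g holomorphic_on unit_disc"
  shows "taylor_coeff (\<lambda>z. a * f z + b * g z) n = a * taylor_coeff f n + b * taylor_coeff g n"
proof (rule taylor_coeff_unique)
  fix z :: complex assume z: "z \<in> unit_disc"
  have "(\<lambda>n. a * (taylor_coeff f n * z ^ n) + b * (taylor_coeff g n * z ^ n)) sums (a * f z + b * g z)"
    by (intro sums_add sums_mult taylor_sums assms z)
  then show "(\<lambda>n. (a * taylor_coeff f n + b * taylor_coeff g n) * z ^ n) sums (a * f z + b * g z)"
    by (simp add: algebra_simps)
qed

text \<open>
  The weight is split evenly, so that the norm becomes the norm of square-summable sequences.
\<close>

definition wcoeffs :: "(nat \<Rightarrow> real) \<Rightarrow> (complex \<Rightarrow> complex) \<Rightarrow> ell2"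
  where "wcoeffs \<omega> f = ell2_of (\<lambda>n. of_real (sqrt (\<omega> n)) * taylor_coeff f n)"

definition wseries :: "(nat \<Rightarrow> real) \<Rightarrow> ell2 \<Rightarrow> complex \<Rightarrow> complex"
  where "wseries \<omega> x z = (if z \<in> unit_disc then \<Sum>n. ell2_nth x n / of_real (sqrt (\<omega> n)) * z ^ n else 0)"

text \<open>
  The square of the norm of the reproducing kernel at a point \<open>a\<close> is this sum at \<open>x = |a|\<^sup>2\<close>.
\<close>

definition kernel_sum :: "(nat \<Rightarrow> real) \<Rightarrow> real \<Rightarrow> real"
  where "kernel_sum \<omega> x = (\<Sum>n. x ^ n / \<omega> n)"

text \<open>
  The coordinates of the reproducing kernel at \<open>a\<close>.
\<close>

definition kernel_vec :: "(nat \<Rightarrow> real) \<Rightarrow> complex \<Rightarrow> ell2"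
  where "kernel_vec \<omega> a = ell2_of (\<lambda>n. cnj a ^ n / of_real (sqrt (\<omega> n)))"

context
  fixes \<omega> :: "nat \<Rightarrow> real"
  assumes weight_ge_1: "\<And>n. 1 \<le> \<omega> n"
begin

lemma weight_pos: "0 < \<omega> n"
  using weight_ge_1[of n] by simp

lemma cmod_weighted_square: "(cmod (of_real (sqrt (\<omega> n)) * a))\<^sup>2 = \<omega> n * (cmod a)\<^sup>2"
  using weight_pos[of n] by (simp add: norm_mult power_mult_distrib)

lemma wspaceD: "f \<in> wspace \<omega> \<Longrightarrow> f holomorphic_on unit_disc"
  by (simp add: wspace_def)

lemma ell2_nth_wcoeffs:
  "f \<in> wspace \<omega> \<Longrightarrow> ell2_nth (wcoeffs \<omega> f) n = of_real (sqrt (\<omega> n)) * taylor_coeff f n"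
  unfolding wcoeffs_def
  by (subst ell2_nth_of) (auto simp: cmod_weighted_square wspace_def)

lemma wseries_sums:
  assumes "z \<in> unit_disc"
  shows "(\<lambda>n. ell2_nth x n / of_real (sqrt (\<omega> n)) * z ^ n) sums wseries \<omega> x z"
proof -
  have "summable (\<lambda>n. ell2_nth x n / of_real (sqrt (\<omega> n)) * z ^ n)"
  proof (rule summable_comparison_test'[where N=0])
    show "summable (\<lambda>n. norm x * cmod z ^ n)"
      using assms by (intro summable_mult summable_geometric) simp
    fix n
    have "cmod (ell2_nth x n) / sqrt (\<omega> n) \<le> norm x / 1"
      using weight_ge_1[of n] by (intro frac_le ell2_nth_le_norm) auto
    then have "cmod (ell2_nth x n) / sqrt (\<omega> n) * cmod z ^ n \<le> norm x * cmod z ^ n"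
      by (intro mult_right_mono) auto
    then show "norm (ell2_nth x n / of_real (sqrt (\<omega> n)) * z ^ n) \<le> norm x * cmod z ^ n"
      using weight_pos[of n] by (simp add: norm_mult norm_divide norm_power)
  qed
  then show ?thesis using assms by (simp add: wseries_def summable_sums)
qed

lemma taylor_coeff_wseries: "taylor_coeff (wseries \<omega> x) n = ell2_nth x n / of_real (sqrt (\<omega> n))"
  by (intro taylor_coeff_unique wseries_sums)

lemma wseries_in_wspace: "wseries \<omega> x \<in> wspace \<omega>"
proof -
  have "\<omega> n * (cmod (taylor_coeff (wseries \<omega> x) n))\<^sup>2 = (cmod (ell2_nth x n))\<^sup>2" for n
    using weight_pos[of n] by (simp add: taylor_coeff_wseries norm_divide power_divide)
  moreover have "wseries \<omega> x holomorphic_on unit_disc"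
    by (rule power_series_holomorphic[where a="\<lambda>n. ell2_nth x n / of_real (sqrt (\<omega> n))"])
       (use wseries_sums in simp)
  ultimately show ?thesis by (auto simp: wspace_def ell2_summable wseries_def)
qed

lemma wcoeffs_wseries: "wcoeffs \<omega> (wseries \<omega> x) = x"
  using weight_pos by (intro ell2_eqI)
    (simp add: ell2_nth_wcoeffs[OF wseries_in_wspace] taylor_coeff_wseries less_imp_neq[symmetric])

lemma wseries_wcoeffs:
  assumes f: "f \<in> wspace \<omega>"
  shows "wseries \<omega> (wcoeffs \<omega> f) = f"
proof
  fix z
  show "wseries \<omega> (wcoeffs \<omega> f) z = f z"
  proof (cases "z \<in> unit_disc")
    case True
    have "(\<lambda>n. ell2_nth (wcoeffs \<omega> f) n / of_real (sqrt (\<omega> n)) * z ^ n) = (\<lambda>n. taylor_coeff f n * z ^ n)"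
      using weight_pos by (simp add: ell2_nth_wcoeffs[OF f] less_imp_neq[symmetric])
    with wseries_sums[OF True, of "wcoeffs \<omega> f"] taylor_sums[OF wspaceD[OF f] True]
    show ?thesis by (simp add: sums_unique2)
  qed (use f in \<open>auto simp: wspace_def wseries_def\<close>)
qed

lemma wnorm_eq: "f \<in> wspace \<omega> \<Longrightarrow> wnorm \<omega> f = norm (wcoeffs \<omega> f)"
  unfolding wnorm_def norm_ell2_def ell2_inner_self
  by (simp add: ell2_nth_wcoeffs cmod_weighted_square)

lemma winner_eq:
  assumes "f \<in> wspace \<omega>" "g \<in> wspace \<omega>"
  shows "winner \<omega> f g = Complex (inner (wcoeffs \<omega> f) (wcoeffs \<omega> g))
     (inner (wcoeffs \<omega> f) (ell2_imult (wcoeffs \<omega> g)))"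
proof -
  have "of_real (\<omega> n) * taylor_coeff f n * cnj (taylor_coeff g n)
      = ell2_nth (wcoeffs \<omega> f) n * cnj (ell2_nth (wcoeffs \<omega> g) n)" for n
  proof -
    have "of_real (\<omega> n) = complex_of_real (sqrt (\<omega> n)) * complex_of_real (sqrt (\<omega> n))"
      using weight_pos[of n] by (simp flip: of_real_mult)
    then show ?thesis by (simp add: ell2_nth_wcoeffs assms mult_ac)
  qed
  then show ?thesis unfolding winner_def by (simp add: ell2_cinner)
qed

lemma wspace_linear:
  assumes "f \<in> wspace \<omega>" "g \<in> wspace \<omega>"
  shows "(\<lambda>z. a * f z + b * g z) \<in> wspace \<omega>"
proof -
  let ?u = "\<lambda>n. a * ell2_nth (wcoeffs \<omega> f) n" and ?v = "\<lambda>n. b * ell2_nth (wcoeffs \<omega> g) n"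
  have "summable (\<lambda>n. (cmod (?u n))\<^sup>2)" "summable (\<lambda>n. (cmod (?v n))\<^sup>2)"
    by (simp_all add: norm_mult power_mult_distrib summable_mult ell2_summable)
  then have "summable (\<lambda>n. (cmod (?u n + ?v n))\<^sup>2)"
    by (rule summable_cmod_square_add)
  moreover have "?u n + ?v n = of_real (sqrt (\<omega> n)) * taylor_coeff (\<lambda>z. a * f z + b * g z) n" for n
    by (simp add: ell2_nth_wcoeffs assms taylor_coeff_linear[OF wspaceD wspaceD] algebra_simps)
  ultimately have "summable (\<lambda>n. \<omega> n * (cmod (taylor_coeff (\<lambda>z. a * f z + b * g z) n))\<^sup>2)"
    by (simp only: cmod_weighted_square)
  then show ?thesis using assms by (auto simp: wspace_def intro!: holomorphic_intros)
qed

lemma wcoeffs_linear: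
  assumes "f \<in> wspace \<omega>" "g \<in> wspace \<omega>"
  shows "ell2_nth (wcoeffs \<omega> (\<lambda>z. a * f z + b * g z)) n =
    a * ell2_nth (wcoeffs \<omega> f) n + b * ell2_nth (wcoeffs \<omega> g) n"
  using assms by (simp add: ell2_nth_wcoeffs wspace_linear taylor_coeff_linear wspaceD algebra_simps)

lemma wseries_linear:
  assumes "\<And>n. ell2_nth w n = a * ell2_nth x n + b * ell2_nth y n"
  shows "wseries \<omega> w = (\<lambda>z. a * wseries \<omega> x z + b * wseries \<omega> y z)"
proof -
  have "w = wcoeffs \<omega> (\<lambda>z. a * wseries \<omega> x z + b * wseries \<omega> y z)"
    by (rule ell2_eqI) (simp add: wcoeffs_linear wseries_in_wspace wcoeffs_wseries assms)
  then show ?thesis by (metis wseries_wcoeffs wspace_linear wseries_in_wspace)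
qed

lemma bounded_op_on_ell2:
  assumes "bounded_op \<omega> T"
  shows "\<exists>A :: ell2 \<Rightarrow>\<^sub>L ell2. A o\<^sub>L ell2_imult = ell2_imult o\<^sub>L A \<and>
      (\<forall>f\<in>wspace \<omega>. wcoeffs \<omega> (T f) = A (wcoeffs \<omega> f))"
proof -
  have Tw: "\<And>f. f \<in> wspace \<omega> \<Longrightarrow> T f \<in> wspace \<omega>"
    and Tlin: "\<And>f g a b. f \<in> wspace \<omega> \<Longrightarrow> g \<in> wspace \<omega> \<Longrightarrow>
        T (\<lambda>z. a * f z + b * g z) = (\<lambda>z. a * T f z + b * T g z)"
    using assms by (auto simp: bounded_op_def)
  obtain K where K: "\<And>f. f \<in> wspace \<omega> \<Longrightarrow> wnorm \<omega> (T f) \<le> K * wnorm \<omega> f"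
    using assms unfolding bounded_op_def by blast
  define G where "G x = wcoeffs \<omega> (T (wseries \<omega> x))" for x
  have lin: "ell2_nth (G w) n = a * ell2_nth (G x) n + b * ell2_nth (G y) n"
    if "\<And>n. ell2_nth w n = a * ell2_nth x n + b * ell2_nth y n" for w x y a b n
    unfolding G_def wseries_linear[OF that]
    by (simp add: Tlin wcoeffs_linear wseries_in_wspace Tw)
  have "bounded_linear G"
  proof (rule bounded_linear_intro[where K=K])
    show "G (x + y) = G x + G y" for x y
      by (rule ell2_eqI) (use lin[of "x + y" 1 x 1 y] in simp)
    show "G (r *\<^sub>R x) = r *\<^sub>R G x" for r x
      by (rule ell2_eqI) (use lin[of "r *\<^sub>R x" "of_real r" x 0 x] in simp)
    show "norm (G x) \<le> norm x * K" for x
      using K[of "wseries \<omega> x"]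
      by (simp add: G_def wnorm_eq wseries_in_wspace Tw wcoeffs_wseries mult.commute)
  qed
  then have B: "blinfun_apply (Blinfun G) = G" by (rule bounded_linear_Blinfun_apply)
  have "Blinfun G o\<^sub>L ell2_imult = ell2_imult o\<^sub>L Blinfun G"
    by (intro blinfun_eqI ell2_eqI) (use lin[of "ell2_imult _" "\<i>" _ 0] in \<open>simp add: B\<close>)
  moreover have "\<forall>f\<in>wspace \<omega>. wcoeffs \<omega> (T f) = Blinfun G (wcoeffs \<omega> f)"
    by (simp add: B G_def wseries_wcoeffs)
  ultimately show ?thesis by blast
qed

lemma bounded_op_of_ell2:
  fixes A :: "ell2 \<Rightarrow>\<^sub>L ell2"
  assumes A: "A o\<^sub>L ell2_imult = ell2_imult o\<^sub>L A"
  shows "bounded_op \<omega> (\<lambda>f. wseries \<omega> (A (wcoeffs \<omega> f)))"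
proof -
  have Ai: "A (ell2_imult x) = ell2_imult (A x)" for x
    using A by (metis blinfun_apply_blinfun_compose)
  have lin: "ell2_nth (A w) n = a * ell2_nth (A x) n + b * ell2_nth (A y) n"
    if w: "\<And>n. ell2_nth w n = a * ell2_nth x n + b * ell2_nth y n" for w x y a b n
  proof -
    have "w = Re a *\<^sub>R x + Im a *\<^sub>R ell2_imult x + Re b *\<^sub>R y + Im b *\<^sub>R ell2_imult y"
      by (rule ell2_eqI) (simp add: w complex_eq_iff algebra_simps)
    then have "A w = Re a *\<^sub>R A x + Im a *\<^sub>R ell2_imult (A x) + Re b *\<^sub>R A y + Im b *\<^sub>R ell2_imult (A y)"
      by (simp add: blinfun.add_right blinfun.scaleR_right Ai)
    then show ?thesis by (simp add: complex_eq_iff algebra_simps)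
  qed
  show ?thesis unfolding bounded_op_def
  proof (intro conjI ballI allI exI)
    fix f g :: "complex \<Rightarrow> complex" and a b :: complex
    assume "f \<in> wspace \<omega>" "g \<in> wspace \<omega>"
    then show "wseries \<omega> (A (wcoeffs \<omega> (\<lambda>z. a * f z + b * g z))) =
       (\<lambda>z. a * wseries \<omega> (A (wcoeffs \<omega> f)) z + b * wseries \<omega> (A (wcoeffs \<omega> g)) z)"
      by (intro wseries_linear lin wcoeffs_linear)
  next
    fix f assume "f \<in> wspace \<omega>"
    then show "wnorm \<omega> (wseries \<omega> (A (wcoeffs \<omega> f))) \<le> norm A * wnorm \<omega> f"
      by (simp add: wnorm_eq wseries_in_wspace wcoeffs_wseries norm_blinfun)
  qed (rule wseries_in_wspace)
qed

lemma orthonormal_basis_monomials: "orthonormal_basis \<omega> (\<lambda>n. wseries \<omega> (ell2_unit n 1))"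
  unfolding orthonormal_basis_def
proof (intro conjI allI ballI impI)
  show "winner \<omega> (wseries \<omega> (ell2_unit m 1)) (wseries \<omega> (ell2_unit n 1)) = (if m = n then 1 else 0)" for m n
    by (simp add: winner_eq wseries_in_wspace wcoeffs_wseries ell2_inner_unit complex_eq_iff)
  fix f assume f: "f \<in> wspace \<omega>" and 0: "\<forall>n. winner \<omega> f (wseries \<omega> (ell2_unit n 1)) = 0"
  have "ell2_nth (wcoeffs \<omega> f) n = 0" for n
  proof -
    let ?x = "wcoeffs \<omega> f" and ?u = "ell2_unit n 1"
    have "inner ?u ?x = 0" "inner (ell2_imult ?u) ?x = 0"
      using 0[rule_format, of n] f
      by (simp_all add: winner_eq wseries_in_wspace wcoeffs_wseries complex_eq_iff inner_commute)
    moreover have "ell2_imult ?u = ell2_unit n \<i>" by (rule ell2_eqI) simp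
    ultimately show ?thesis by (simp add: ell2_inner_unit complex_eq_iff)
  qed
  then have "wcoeffs \<omega> f = 0" by (intro ell2_eqI) simp
  with wseries_wcoeffs[OF f] have "f = wseries \<omega> 0" by simp
  then show "f = (\<lambda>z. 0)" by (simp add: wseries_def fun_eq_iff)
qed (rule wseries_in_wspace)

text \<open>
  If \<open>S\<close> is the modulus of \<open>T\<close>, then \<open>|S e| = |T e|\<close>, so \<open>(S e, e) \<le> |T e|\<close> for unit vectors \<open>e\<close>.
  All operators are constructed on square-summable sequences and carried back to functions.
\<close>

lemma trace_class_if_summable_norms:
  assumes T: "bounded_op \<omega> T"
    and sm: "summable (\<lambda>n. wnorm \<omega> (T (wseries \<omega> (ell2_unit n 1))))"
  shows "trace_class_op \<omega> T"
proof -
  have Tw: "\<And>f. f \<in> wspace \<omega> \<Longrightarrow> T f \<in> wspace \<omega>" using T by (auto simp: bounded_op_def)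
  obtain A :: "ell2 \<Rightarrow>\<^sub>L ell2" where Ai: "A o\<^sub>L ell2_imult = ell2_imult o\<^sub>L A"
    and A: "\<And>f. f \<in> wspace \<omega> \<Longrightarrow> wcoeffs \<omega> (T f) = A (wcoeffs \<omega> f)"
    using bounded_op_on_ell2[OF T] by blast
  obtain A' :: "ell2 \<Rightarrow>\<^sub>L ell2" where A': "\<And>x y. inner (A x) y = inner x (A' y)"
    using ell2_adjoint by blast
  have A'i: "A' o\<^sub>L ell2_imult = ell2_imult o\<^sub>L A'" by (rule ell2_adjoint_commutes_imult[OF A' Ai])
  obtain M where M: "M o\<^sub>L M = A' o\<^sub>L A" "\<And>x z. inner (M x) z = inner x (M z)"
      "\<And>x. 0 \<le> inner (M x) x" and Mi: "M o\<^sub>L ell2_imult = ell2_imult o\<^sub>L M"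
    using blinfun_modulus_exists[OF A'] Ai A'i by blast
  have MM: "M (M x) = A' (A x)" for x using M(1) by (metis blinfun_apply_blinfun_compose)
  have A'i': "A' (ell2_imult x) = ell2_imult (A' x)" and Mi': "M (ell2_imult x) = ell2_imult (M x)" for x
    using A'i Mi by (metis blinfun_apply_blinfun_compose)+
  define S where "S f = wseries \<omega> (M (wcoeffs \<omega> f))" for f
  define T' where "T' f = wseries \<omega> (A' (wcoeffs \<omega> f))" for f
  note simps = winner_eq wseries_in_wspace wcoeffs_wseries Tw A
  have "is_adjoint \<omega> T T'"
    unfolding is_adjoint_def
  proof (intro conjI ballI)
    show "bounded_op \<omega> T'" unfolding T'_def by (rule bounded_op_of_ell2[OF A'i])
    fix f g assume "f \<in> wspace \<omega>" "g \<in> wspace \<omega>"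
    then show "winner \<omega> (T f) g = winner \<omega> f (T' g)"
      by (simp add: simps T'_def A' A'i')
  qed
  moreover have "positive_op \<omega> S"
    unfolding positive_op_def
  proof (intro conjI ballI)
    show "bounded_op \<omega> S" unfolding S_def by (rule bounded_op_of_ell2[OF Mi])
    fix f assume f: "f \<in> wspace \<omega>"
    let ?x = "wcoeffs \<omega> f"
    have "inner (M ?x) (ell2_imult ?x) = - inner (M ?x) (ell2_imult ?x)"
      using M(2)[of ?x "ell2_imult ?x"] ell2_imult_skew[of ?x "M ?x"] ell2_imult_skew[of "M ?x" ?x]
      by (simp add: Mi' inner_commute)
    then show "winner \<omega> (S f) f \<in> \<real>" "0 \<le> Re (winner \<omega> (S f) f)"
      using f M(3)[of ?x] by (simp_all add: simps S_def complex_is_Real_iff)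
  qed
  moreover have "S (S f) = T' (T f)" if "f \<in> wspace \<omega>" for f
    using that by (simp add: S_def T'_def wcoeffs_wseries A MM)
  ultimately have "is_modulus \<omega> T S" unfolding is_modulus_def by blast
  moreover have "summable (\<lambda>n. Re (winner \<omega> (S (wseries \<omega> (ell2_unit n 1))) (wseries \<omega> (ell2_unit n 1))))"
  proof (rule summable_comparison_test'[OF sm, where N=0])
    fix n
    let ?e = "ell2_unit n 1"
    have "norm ?e = 1" unfolding norm_ell2_def ell2_inner_unit by simp
    then have "inner (M ?e) ?e \<le> norm (M ?e)" using norm_cauchy_schwarz[of "M ?e" ?e] by simp
    also have "norm (M ?e) = norm (A ?e)"
      unfolding norm_ell2_def A' M(2) MM ..
    finally show "norm (Re (winner \<omega> (S (wseries \<omega> ?e)) (wseries \<omega> ?e))) \<le> wnorm \<omega> (T (wseries \<omega> ?e))"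
      using M(3)[of ?e] by (simp add: simps S_def wnorm_eq)
  qed
  ultimately show ?thesis
    using T orthonormal_basis_monomials unfolding trace_class_op_def by blast
qed

subsection \<open>Compact composition operators and contact with the circle\<close>

lemma kernel_sum_summable:
  assumes "0 \<le> x" "x < 1"
  shows "summable (\<lambda>n. x ^ n / \<omega> n)"
proof (rule summable_comparison_test'[where N=0])
  show "summable (\<lambda>n. x ^ n)" using assms by (intro summable_geometric) simp
  fix n
  have "x ^ n / \<omega> n \<le> x ^ n / 1"
    using assms weight_ge_1[of n] by (intro frac_le) auto
  then show "norm (x ^ n / \<omega> n) \<le> x ^ n" using assms weight_pos[of n] by simp
qed

lemma kernel_sum_mono:
  assumes "0 \<le> x" "x \<le> y" "y < 1"
  shows "kernel_sum \<omega> x \<le> kernel_sum \<omega> y"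
  unfolding kernel_sum_def
  using assms weight_pos by (intro suminf_le kernel_sum_summable divide_right_mono power_mono)
    (auto simp: less_imp_le)

lemma kernel_sum_ge_partial:
  assumes "0 \<le> x" "x < 1"
  shows "(\<Sum>n<N. x ^ n / \<omega> n) \<le> kernel_sum \<omega> x"
  unfolding kernel_sum_def
  by (rule sum_le_suminf[OF kernel_sum_summable[OF assms]])
     (use assms weight_pos in \<open>auto simp: less_imp_le\<close>)

text \<open>
  Replacing \<open>y\<close> by a power costs at most a constant factor: in each block of \<open>k\<close> consecutive terms of the
  series at \<open>y\<close>, every term is at most the corresponding single term of the series at \<open>y\<^sup>k\<close>.
\<close>

lemma kernel_sum_power:
  assumes \<omega>: "mono \<omega>" and y: "0 \<le> y" "y < 1" and k: "k > 0"
  shows "kernel_sum \<omega> y \<le> real k * kernel_sum \<omega> (y ^ k)"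
proof -
  have yk: "0 \<le> y ^ k" "y ^ k < 1" using y k by (auto simp: power_less_one_iff)
  have block: "y ^ j / \<omega> j \<le> (y ^ k) ^ m / \<omega> m" if "j \<in> {m * k..<m * k + k}" for j m
  proof (intro frac_le)
    have "m \<le> m * k" using k by simp
    from order_trans[OF this, of j] have "m \<le> j" using that by simp
    then show "\<omega> m \<le> \<omega> j" by (rule monoD[OF \<omega>])
    have "y ^ j \<le> y ^ (m * k)" using that y by (intro power_decreasing) auto
    then show "y ^ j \<le> (y ^ k) ^ m" by (simp add: power_mult[symmetric] mult.commute)
  qed (use y weight_pos in auto)
  have "(\<Sum>j<M. y ^ j / \<omega> j) \<le> real k * kernel_sum \<omega> (y ^ k)" for M
  proof -
    have "(\<Sum>j<M. y ^ j / \<omega> j) \<le> (\<Sum>j<M * k. y ^ j / \<omega> j)"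
      using k y weight_pos by (intro sum_mono2) (auto simp: less_imp_le intro: less_le_trans)
    also have "\<dots> = (\<Sum>m<M. \<Sum>j\<in>{m * k..<m * k + k}. y ^ j / \<omega> j)"
      by (rule sum.nat_group[symmetric])
    also have "\<dots> \<le> (\<Sum>m<M. \<Sum>j\<in>{m * k..<m * k + k}. (y ^ k) ^ m / \<omega> m)"
      by (intro sum_mono block)
    also have "\<dots> = real k * (\<Sum>m<M. (y ^ k) ^ m / \<omega> m)"
      by (simp add: sum_distrib_left)
    also have "\<dots> \<le> real k * kernel_sum \<omega> (y ^ k)"
      by (intro mult_left_mono kernel_sum_ge_partial yk) auto
    finally show ?thesis .
  qed
  then show ?thesis
    unfolding kernel_sum_def[of \<omega> y] by (intro suminf_le_const kernel_sum_summable y)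
qed

lemma kernel_sum_at_top:
  assumes div: "\<not> summable (\<lambda>n. 1 / \<omega> n)"
    and x: "x \<longlonglongrightarrow> 1" "\<And>j. 0 \<le> x j" "\<And>j. x j < 1"
  shows "filterlim (\<lambda>j. kernel_sum \<omega> (x j)) at_top sequentially"
  unfolding filterlim_at_top_dense
proof
  fix Z
  have "\<exists>N. Z < (\<Sum>n<N. 1 / \<omega> n)"
  proof (rule ccontr)
    assume "\<not> ?thesis"
    then have "(\<Sum>n\<le>N. 1 / \<omega> n) \<le> Z" for N
      by (metis lessThan_Suc_atMost linorder_not_less)
    then have "summable (\<lambda>n. 1 / \<omega> n)"
      using weight_pos by (intro bounded_imp_summable[where B=Z]) (auto simp: less_imp_le)
    with div show False by simp
  qed
  then obtain N where N: "Z < (\<Sum>n<N. 1 / \<omega> n)" by blast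
  have "(\<lambda>j. \<Sum>n<N. x j ^ n / \<omega> n) \<longlonglongrightarrow> (\<Sum>n<N. 1 ^ n / \<omega> n)"
    using weight_pos by (intro tendsto_intros x) (auto simp: less_imp_neq[symmetric])
  then have "\<forall>\<^sub>F j in sequentially. Z < (\<Sum>n<N. x j ^ n / \<omega> n)"
    using N by (intro order_tendstoD) auto
  then show "\<forall>\<^sub>F j in sequentially. Z < kernel_sum \<omega> (x j)"
    by eventually_elim (use kernel_sum_ge_partial x in \<open>meson less_le_trans\<close>)
qed

lemma ell2_nth_kernel_vec:
  assumes "a \<in> unit_disc"
  shows "ell2_nth (kernel_vec \<omega> a) n = cnj a ^ n / of_real (sqrt (\<omega> n))"
    and "(norm (kernel_vec \<omega> a))\<^sup>2 = kernel_sum \<omega> ((cmod a)\<^sup>2)"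
proof -
  have eq: "(cmod (cnj a ^ n / of_real (sqrt (\<omega> n))))\<^sup>2 = ((cmod a)\<^sup>2) ^ n / \<omega> n" for n
    using weight_pos[of n] by (simp add: norm_divide norm_power power_divide power_mult[symmetric] mult.commute)
  have "(cmod a)\<^sup>2 < 1" using assms by (simp add: power_less_one_iff)
  then have nth: "ell2_nth (kernel_vec \<omega> a) = (\<lambda>n. cnj a ^ n / of_real (sqrt (\<omega> n)))"
    unfolding kernel_vec_def by (intro ell2_nth_of) (unfold eq, intro kernel_sum_summable, auto)
  then show "ell2_nth (kernel_vec \<omega> a) n = cnj a ^ n / of_real (sqrt (\<omega> n))" by simp
  show "(norm (kernel_vec \<omega> a))\<^sup>2 = kernel_sum \<omega> ((cmod a)\<^sup>2)"
    unfolding ell2_norm_square nth eq kernel_sum_def ..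
qed

text \<open>
  The factor \<open>2\<close> comes from estimating real and imaginary part of the complex inner product separately.
\<close>

lemma wspace_point_bound:
  assumes f: "f \<in> wspace \<omega>" and z: "z \<in> unit_disc"
  shows "cmod (f z) \<le> 2 * (wnorm \<omega> f * norm (kernel_vec \<omega> z))"
proof -
  let ?x = "wcoeffs \<omega> f" and ?k = "kernel_vec \<omega> z"
  have "f z = wseries \<omega> ?x z" by (simp add: wseries_wcoeffs[OF f])
  also have "\<dots> = (\<Sum>n. ell2_nth ?x n / of_real (sqrt (\<omega> n)) * z ^ n)"
    using z by (simp add: wseries_def)
  also have "\<dots> = Complex (inner ?x ?k) (inner ?x (ell2_imult ?k))"
    unfolding ell2_cinner[symmetric] by (simp add: ell2_nth_kernel_vec(1)[OF z])
  finally have "cmod (f z) \<le> \<bar>inner ?x ?k\<bar> + \<bar>inner ?x (ell2_imult ?k)\<bar>"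
    using cmod_le[of "f z"] by simp
  also have "\<dots> \<le> norm ?x * norm ?k + norm ?x * norm (ell2_imult ?k)"
    by (intro add_mono Cauchy_Schwarz_ineq2)
  also have "norm (ell2_imult ?k) = norm ?k"
    unfolding norm_ell2_def ell2_inner_self by (simp add: norm_mult)
  finally show ?thesis unfolding wnorm_eq[OF f] by linarith
qed

text \<open>
  Let \<open>a\<^sub>n = \<phi>(z\<^sub>n)\<close>. The normalised kernels at \<open>a\<^sub>n\<close> tend to zero pointwise, so by compactness the norms of
  their images tend to zero along a subsequence. Write \<open>|k(a)|\<close> for the norm of the kernel at \<open>a\<close>. At \<open>z\<^sub>n\<close> the image takes the value \<open>|k(a\<^sub>n)|\<close>, whence
  its norm is at least \<open>|k(a\<^sub>n)| / (2 |k(z\<^sub>n)|)\<close>. This quotient is bounded below because the contact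
  inequality gives \<open>|z\<^sub>n|\<^sup>K \<le> |a\<^sub>n|\<close> for a fixed \<open>K\<close>.
\<close>

lemma compact_composition_op_no_linear_contact:
  assumes cpt: "compact_op \<omega> (composition_op \<phi>)"
    and \<omega>: "mono \<omega>" "\<not> summable (\<lambda>n. 1 / \<omega> n)"
    and self: "\<And>w. w \<in> unit_disc \<Longrightarrow> \<phi> w \<in> unit_disc"
    and z: "\<And>n. z n \<in> unit_disc" "(\<lambda>n. cmod (z n)) \<longlonglongrightarrow> 1"
    and C: "\<And>n. 1 - cmod (\<phi> (z n)) \<le> C * (1 - cmod (z n))"
  shows False
proof -
  have bdd: "bounded_op \<omega> (composition_op \<phi>)" using cpt by (simp add: compact_op_def)
  define a where "a n = \<phi> (z n)" for n
  have a: "a n \<in> unit_disc" for n unfolding a_def by (intro self z)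
  have lim_a: "(\<lambda>n. cmod (a n)) \<longlonglongrightarrow> 1"
  proof (rule tendsto_sandwich)
    have "(\<lambda>n. 1 - C * (1 - cmod (z n))) \<longlonglongrightarrow> 1 - C * (1 - 1)" by (intro tendsto_intros z)
    then show "(\<lambda>n. 1 - C * (1 - cmod (z n))) \<longlonglongrightarrow> 1" by simp
    have "1 - C * (1 - cmod (z n)) \<le> cmod (a n)" for n using C[of n] unfolding a_def by linarith
    then show "\<forall>\<^sub>F n in sequentially. 1 - C * (1 - cmod (z n)) \<le> cmod (a n)" by simp
    show "\<forall>\<^sub>F n in sequentially. cmod (a n) \<le> 1" using a by (simp add: less_imp_le)
  qed simp
  define k where "k n = norm (kernel_vec \<omega> (a n))" for n
  have k_top: "filterlim k at_top sequentially"
  proof -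
    have "filterlim (\<lambda>j. kernel_sum \<omega> ((cmod (a j))\<^sup>2)) at_top sequentially"
      using tendsto_power[OF lim_a, of 2] a
      by (intro kernel_sum_at_top \<omega>) (auto simp: power_less_one_iff)
    then have "filterlim (\<lambda>j. sqrt (kernel_sum \<omega> ((cmod (a j))\<^sup>2))) at_top sequentially"
      by (rule filterlim_compose[OF sqrt_at_top])
    then show ?thesis by (simp add: k_def[abs_def] ell2_nth_kernel_vec(2)[OF a, symmetric])
  qed
  have k_pos: "k n > 0" for n
  proof -
    have "ell2_nth (kernel_vec \<omega> (a n)) 0 \<noteq> 0"
      using weight_pos[of 0] by (simp add: ell2_nth_kernel_vec(1)[OF a])
    then show ?thesis by (auto simp: k_def)
  qed
  define F where "F n = wseries \<omega> ((1 / k n) *\<^sub>R kernel_vec \<omega> (a n))" for n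
  have Fw: "F n \<in> wspace \<omega>" for n unfolding F_def by (rule wseries_in_wspace)
  have Fn: "wnorm \<omega> (F n) = 1" for n
    using k_pos[of n] Fw[of n]
    by (simp add: wnorm_eq F_def wcoeffs_wseries) (simp add: k_def)
  have "(\<forall>n. F n \<in> wspace \<omega>) \<and> (\<exists>B. \<forall>n. wnorm \<omega> (F n) \<le> B)"
    by (auto intro!: exI[of _ 1] simp: Fw Fn)
  then obtain r g where r: "strict_mono r" and g: "g \<in> wspace \<omega>"
    and lim: "(\<lambda>n. wnorm \<omega> (\<lambda>z. composition_op \<phi> (F (r n)) z - g z)) \<longlonglongrightarrow> 0"
    using cpt unfolding compact_op_def by blast
  define G where "G n = composition_op \<phi> (F (r n))" for n
  have Gw: "G n \<in> wspace \<omega>" for n using bdd Fw by (simp add: bounded_op_def G_def)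
  have F_eval: "F n w = (\<Sum>m. (cnj (a n) * w) ^ m / of_real (\<omega> m)) / of_real (k n)"
    and F_eval_summable: "summable (\<lambda>m. (cnj (a n) * w) ^ m / of_real (\<omega> m))"
    if w: "w \<in> unit_disc" for n w
  proof -
    have *: "ell2_nth ((1 / k n) *\<^sub>R kernel_vec \<omega> (a n)) m / of_real (sqrt (\<omega> m)) * w ^ m
        = (cnj (a n) * w) ^ m / of_real (\<omega> m) / of_real (k n)" for m
    proof -
      have "complex_of_real (sqrt (\<omega> m)) * complex_of_real (sqrt (\<omega> m)) = of_real (\<omega> m)"
        using weight_pos[of m] by (simp flip: of_real_mult)
      then show ?thesis by (simp add: ell2_nth_kernel_vec(1)[OF a] power_mult_distrib field_simps)
    qed
    have s: "(\<lambda>m. (cnj (a n) * w) ^ m / of_real (\<omega> m) / of_real (k n)) sums F n w"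
      using wseries_sums[OF w, of "(1 / k n) *\<^sub>R kernel_vec \<omega> (a n)"]
      unfolding * F_def .
    from sums_mult2[OF s, of "of_real (k n)"] k_pos[of n]
    have s': "(\<lambda>m. (cnj (a n) * w) ^ m / of_real (\<omega> m)) sums (F n w * of_real (k n))" by simp
    then show "summable (\<lambda>m. (cnj (a n) * w) ^ m / of_real (\<omega> m))" by (rule sums_summable)
    from s' k_pos[of n] show "F n w = (\<Sum>m. (cnj (a n) * w) ^ m / of_real (\<omega> m)) / of_real (k n)"
      by (simp add: sums_iff)
  qed
  have F_bound: "cmod (F n w) \<le> 1 / (1 - cmod w) / k n" if w: "w \<in> unit_disc" for n w
  proof -
    have "cmod (\<Sum>m. (cnj (a n) * w) ^ m / of_real (\<omega> m)) \<le> (\<Sum>m. cmod w ^ m)"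
    proof (rule norm_suminf_le)
      show "summable (\<lambda>m. cmod w ^ m)" using w by (intro summable_geometric) simp
      fix m
      have "(cmod (a n) * cmod w) ^ m / \<omega> m \<le> (cmod w) ^ m / 1"
        using a[of n] weight_ge_1[of m]
        by (intro frac_le power_mono mult_left_le_one_le) (auto simp: less_imp_le)
      then show "norm ((cnj (a n) * w) ^ m / of_real (\<omega> m)) \<le> cmod w ^ m"
        using weight_pos[of m] by (simp add: norm_divide norm_power norm_mult)
    qed
    also have "\<dots> = 1 / (1 - cmod w)" using w by (intro suminf_geometric) simp
    finally have "cmod (\<Sum>m. (cnj (a n) * w) ^ m / of_real (\<omega> m)) / k n \<le> 1 / (1 - cmod w) / k n"
      using k_pos[of n] by (intro divide_right_mono) auto
    then show ?thesis using k_pos[of n] unfolding F_eval[OF w] norm_divide norm_of_real by simp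
  qed
  have F_peak: "F n (a n) = of_real (k n)" for n
  proof -
    have "(\<Sum>m. (cnj (a n) * a n) ^ m / of_real (\<omega> m)) = (\<Sum>m. complex_of_real (((cmod (a n))\<^sup>2) ^ m / \<omega> m))"
    proof -
      have "cnj (a n) * a n = complex_of_real ((cmod (a n))\<^sup>2)"
        unfolding complex_norm_square by (rule mult.commute)
      then show ?thesis by simp
    qed
    also have "\<dots> = of_real ((k n)\<^sup>2)"
      unfolding k_def ell2_nth_kernel_vec(2)[OF a] kernel_sum_def
      by (rule suminf_of_real[symmetric], rule kernel_sum_summable)
         (use a in \<open>auto simp: power_less_one_iff\<close>)
    finally show ?thesis using k_pos[of n] by (simp add: F_eval[OF a] power2_eq_square)
  qed
  have g0: "g w = 0" for w
  proof (cases "w \<in> unit_disc")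
    case True
    have "(\<lambda>n. G n w) \<longlonglongrightarrow> 0"
    proof (rule Lim_null_comparison)
      show "\<forall>\<^sub>F n in sequentially. norm (G n w) \<le> 1 / (1 - cmod (\<phi> w)) / k (r n)"
        using F_bound[OF self[OF True]] True by (simp add: G_def composition_op_def)
      show "(\<lambda>n. 1 / (1 - cmod (\<phi> w)) / k (r n)) \<longlonglongrightarrow> 0"
        by (intro tendsto_divide_0[OF tendsto_const] filterlim_at_top_imp_at_infinity
              filterlim_compose[OF k_top] filterlim_subseq r)
    qed
    moreover have "(\<lambda>n. G n w - g w) \<longlonglongrightarrow> 0"
    proof (rule Lim_null_comparison)
      have "(\<lambda>z. 1 * G n z + (-1) * g z) \<in> wspace \<omega>" for n
        by (rule wspace_linear[OF Gw g])
      from wspace_point_bound[OF this True]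
      show "\<forall>\<^sub>F n in sequentially. norm (G n w - g w)
          \<le> 2 * (wnorm \<omega> (\<lambda>z. composition_op \<phi> (F (r n)) z - g z) * norm (kernel_vec \<omega> w))"
        by (simp add: G_def)
      show "(\<lambda>n. 2 * (wnorm \<omega> (\<lambda>z. composition_op \<phi> (F (r n)) z - g z) * norm (kernel_vec \<omega> w))) \<longlonglongrightarrow> 0"
        by (intro tendsto_mult_right_zero tendsto_mult_left_zero lim)
    qed
    ultimately have "(\<lambda>n. G n w - (G n w - g w)) \<longlonglongrightarrow> 0 - 0" by (rule tendsto_diff)
    then show ?thesis by (simp add: LIMSEQ_const_iff)
  qed (use g in \<open>simp add: wspace_def\<close>)
  have G0: "(\<lambda>n. wnorm \<omega> (G n)) \<longlonglongrightarrow> 0" using lim by (simp add: g0 G_def)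
  \<comment> \<open>for small \<open>u = 1 - |z n|\<close>: \<open>(1 - u)\<^sup>K \<le> exp (- 2 C u) \<le> 1 - C u \<le> |a n|\<close>\<close>
  define K where "K = Suc (nat \<lceil>2 * C\<rceil>)"
  have K: "K > 0" "2 * C \<le> real K" unfolding K_def by linarith+
  have "(\<lambda>n. C * (1 - cmod (z n))) \<longlonglongrightarrow> C * (1 - 1)" by (intro tendsto_intros z)
  then have "\<forall>\<^sub>F n in sequentially. C * (1 - cmod (z n)) < 1 / 2"
    by (intro order_tendstoD) auto
  then have lower: "\<forall>\<^sub>F n in sequentially. k n \<ge> norm (kernel_vec \<omega> (z n)) / sqrt K"
  proof eventually_elim
    case (elim n)
    define u where "u = 1 - cmod (z n)"
    have u: "0 < u" "u \<le> 1" using z(1)[of n] by (auto simp: u_def)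
    have C0: "C \<ge> 0"
      using C[of n] u a[of n] unfolding u_def[symmetric] a_def by (auto simp: zero_le_mult_iff intro: ccontr)
        (smt (verit) mult_nonpos_nonneg)
    have v: "C * u \<le> 1 / 2" "0 \<le> C * u" using elim u C0 by (auto simp: u_def)
    have "cmod (z n) ^ K \<le> exp (- u) ^ K"
      using exp_ge_add_one_self[of "- u"] by (intro power_mono) (auto simp: u_def)
    also have "\<dots> = exp (- (real K * u))" by (simp add: exp_of_nat_mult[symmetric])
    also have "\<dots> \<le> exp (- (2 * (C * u)))" using K u by (simp add: mult_right_mono flip: mult.assoc)
    also have "\<dots> \<le> 1 / (1 + 2 * (C * u))"
      using exp_ge_add_one_self[of "2 * (C * u)"] v by (simp add: exp_minus field_simps)
    also have "\<dots> \<le> 1 - C * u"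
    proof -
      have "(C * u) * (C * u) \<le> (1 / 2) * (C * u)" using v by (intro mult_right_mono) auto
      then have "1 \<le> (1 - C * u) * (1 + 2 * (C * u))" by (simp add: algebra_simps)
      then show ?thesis using v by (simp add: divide_le_eq)
    qed
    also have "\<dots> \<le> cmod (a n)" using C[of n] by (simp add: a_def u_def)
    finally have "(cmod (z n) ^ K)\<^sup>2 \<le> (cmod (a n))\<^sup>2" by (intro power_mono) auto
    then have "((cmod (z n))\<^sup>2) ^ K \<le> (cmod (a n))\<^sup>2" by (simp add: power_mult[symmetric] mult.commute)
    then have "kernel_sum \<omega> (((cmod (z n))\<^sup>2) ^ K) \<le> kernel_sum \<omega> ((cmod (a n))\<^sup>2)"
      using a[of n] by (intro kernel_sum_mono) (auto simp: power_less_one_iff)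
    moreover have "kernel_sum \<omega> ((cmod (z n))\<^sup>2) \<le> K * kernel_sum \<omega> (((cmod (z n))\<^sup>2) ^ K)"
      using z(1)[of n] K by (intro kernel_sum_power \<omega>) (auto simp: power_less_one_iff)
    ultimately have "kernel_sum \<omega> ((cmod (z n))\<^sup>2) \<le> K * kernel_sum \<omega> ((cmod (a n))\<^sup>2)"
      using K by (meson mult_left_mono of_nat_0_le_iff order_trans)
    then have "(norm (kernel_vec \<omega> (z n)))\<^sup>2 \<le> (sqrt K * k n)\<^sup>2"
      by (simp add: k_def ell2_nth_kernel_vec(2)[OF a] ell2_nth_kernel_vec(2)[OF z(1)] power_mult_distrib)
    then have "norm (kernel_vec \<omega> (z n)) \<le> sqrt K * k n"
      by (rule power2_le_imp_le) (use less_imp_le[OF k_pos[of n]] in simp)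
    then show ?case using K by (simp add: divide_le_eq mult.commute)
  qed
  have "\<forall>\<^sub>F n in sequentially. 1 / (2 * sqrt K) \<le> wnorm \<omega> (G n)"
  proof -
    have "\<forall>\<^sub>F n in sequentially. k (r n) \<ge> norm (kernel_vec \<omega> (z (r n))) / sqrt K"
      by (rule eventually_subseq[OF r lower])
    then show ?thesis
    proof eventually_elim
      case (elim n)
      let ?N = "norm (kernel_vec \<omega> (z (r n)))"
      have "ell2_nth (kernel_vec \<omega> (z (r n))) 0 \<noteq> 0"
        using weight_pos[of 0] by (simp add: ell2_nth_kernel_vec(1)[OF z(1)])
      then have N: "?N > 0" by auto
      have "G n (z (r n)) = of_real (k (r n))"
        using z(1) F_peak[of "r n"] by (simp add: G_def composition_op_def a_def)
      with wspace_point_bound[OF Gw z(1), of n "r n"] k_pos[of "r n"]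
      have "k (r n) \<le> 2 * (wnorm \<omega> (G n) * ?N)" by simp
      with elim have "?N / sqrt K \<le> 2 * (wnorm \<omega> (G n) * ?N)" by simp
      then have "(1 / (2 * sqrt K)) * ?N \<le> wnorm \<omega> (G n) * ?N" by (simp add: field_simps)
      with N show ?case by (simp only: mult_le_cancel_right_pos)
    qed
  qed
  moreover have "\<forall>\<^sub>F n in sequentially. wnorm \<omega> (G n) < 1 / (2 * sqrt K)"
    using G0 K by (intro order_tendstoD) auto
  ultimately have "\<forall>\<^sub>F n :: nat in sequentially. False" by eventually_elim simp
  then show False by simp
qed

end

section \<open>Trace-class composition operators\<close>

lemma integral_cis_frequency:
  fixes m :: int
  shows "((\<lambda>t. exp (of_int m * (2 * of_real pi * \<i>) * of_real t)) has_integral (if m = 0 then 1 else 0)) {0..1}"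
proof (cases "m = 0")
  case True
  then show ?thesis using has_integral_const_real[of "1::complex" 0 1] by simp
next
  case False
  define k where "k = of_int m * (2 * of_real pi * \<i>)"
  have k: "k \<noteq> 0" using False by (simp add: k_def)
  have "((\<lambda>t. exp (k * of_real t)) has_integral (exp (k * of_real 1) / k - exp (k * of_real 0) / k)) {0..1}"
    by (rule fundamental_theorem_of_calculus)
       (auto intro!: derivative_eq_intros has_vector_derivative_real_field simp: k)
  moreover have "exp k = 1"
    unfolding exp_eq_1 by (auto simp: k_def intro!: exI[of _ m])
  ultimately show ?thesis using False by (simp add: k_def[symmetric])
qed

definition circle_point :: "real \<Rightarrow> real \<Rightarrow> complex"
  where "circle_point r t = of_real r * exp (2 * of_real pi * \<i> * of_real t)"

lemma cmod_circle_point: "cmod (circle_point r t) = \<bar>r\<bar>"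
  by (simp add: circle_point_def norm_mult)

lemma continuous_circle_point [continuous_intros]: "continuous_on A (circle_point r)"
  unfolding circle_point_def by (intro continuous_intros)

lemma parseval_polynomial:
  "((\<lambda>t. (cmod (\<Sum>k<N. a k * circle_point r t ^ k))\<^sup>2) has_integral (\<Sum>k<N. (cmod (a k))\<^sup>2 * (r\<^sup>2) ^ k)) {0..1}"
proof -
  have expand: "a j * circle_point r t ^ j * cnj (a k * circle_point r t ^ k)
     = (a j * cnj (a k) * of_real (r ^ j * r ^ k)) * exp (of_int (int j - int k) * (2 * of_real pi * \<i>) * of_real t)"
    for j k t
  proof -
    have "exp (of_int (int j - int k) * (2 * of_real pi * \<i>) * of_real t)
       = exp (2 * of_real pi * \<i> * of_real t) ^ j * exp (- (2 * of_real pi * \<i> * of_real t)) ^ k"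
      unfolding exp_of_nat_mult[symmetric] exp_add[symmetric] by (simp add: algebra_simps)
    then show ?thesis
      by (simp add: circle_point_def power_mult_distrib exp_cnj)
  qed
  have "((\<lambda>t. \<Sum>j<N. \<Sum>k<N. (a j * cnj (a k) * of_real (r ^ j * r ^ k)) *
          exp (of_int (int j - int k) * (2 * of_real pi * \<i>) * of_real t))
      has_integral (\<Sum>j<N. \<Sum>k<N. (a j * cnj (a k) * of_real (r ^ j * r ^ k)) * (if int j - int k = 0 then 1 else 0))) {0..1}"
    by (intro has_integral_sum has_integral_mult_right integral_cis_frequency) auto
  also have "(\<lambda>t. \<Sum>j<N. \<Sum>k<N. (a j * cnj (a k) * of_real (r ^ j * r ^ k)) *
          exp (of_int (int j - int k) * (2 * of_real pi * \<i>) * of_real t))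
     = (\<lambda>t. complex_of_real ((cmod (\<Sum>k<N. a k * circle_point r t ^ k))\<^sup>2))"
    unfolding complex_norm_square cnj_sum sum_product expand ..
  also have "(\<Sum>j<N. \<Sum>k<N. (a j * cnj (a k) * of_real (r ^ j * r ^ k)) * (if int j - int k = 0 then 1 else 0))
     = complex_of_real (\<Sum>k<N. (cmod (a k))\<^sup>2 * (r\<^sup>2) ^ k)"
  proof -
    have "(\<Sum>k<N. (a j * cnj (a k) * of_real (r ^ j * r ^ k)) * (if int j - int k = 0 then 1 else 0))
       = complex_of_real ((cmod (a j))\<^sup>2 * (r\<^sup>2) ^ j)" if "j < N" for j
    proof -
      have "(\<Sum>k<N. (a j * cnj (a k) * of_real (r ^ j * r ^ k)) * (if int j - int k = 0 then 1 else 0))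
        = (\<Sum>k<N. if k = j then a j * cnj (a j) * of_real (r ^ j * r ^ j) else 0)"
        by (intro sum.cong) auto
      also have "\<dots> = a j * cnj (a j) * of_real (r ^ j * r ^ j)" using that by simp
      also have "\<dots> = complex_of_real ((cmod (a j))\<^sup>2 * (r\<^sup>2) ^ j)"
      proof -
        have "r ^ j * r ^ j = (r\<^sup>2) ^ j" by (simp add: power2_eq_square power_mult_distrib)
        then show ?thesis by (simp only: of_real_mult complex_norm_square)
      qed
      finally show ?thesis .
    qed
    then show ?thesis unfolding of_real_sum by (intro sum.cong) auto
  qed
  finally have "((\<lambda>t. complex_of_real ((cmod (\<Sum>k<N. a k * circle_point r t ^ k))\<^sup>2)) has_integral
      complex_of_real (\<Sum>k<N. (cmod (a k))\<^sup>2 * (r\<^sup>2) ^ k)) {0..1}" .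
  from has_integral_Re[OF this] show ?thesis by (simp only: Re_complex_of_real)
qed

text \<open>
  Parseval's identity for the Taylor polynomials passes to the limit because they converge uniformly on the circle.
\<close>

lemma parseval_circle:
  assumes f: "f holomorphic_on unit_disc" and r: "0 \<le> r" "r < 1"
  shows "(\<lambda>k. (cmod (taylor_coeff f k))\<^sup>2 * (r\<^sup>2) ^ k) sums integral {0..1} (\<lambda>t. (cmod (f (circle_point r t)))\<^sup>2)"
proof -
  define p where "p N t = (\<Sum>k<N. taylor_coeff f k * circle_point r t ^ k)" for N t
  define F where "F t = f (circle_point r t)" for t
  have unif: "uniform_limit {0..1} p F sequentially"
  proof -
    have sm: "summable (\<lambda>k. norm (taylor_coeff f k * of_real r ^ k))"
    proof -
      have "of_real ((r + 1) / 2) \<in> unit_disc" using r by simp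
      from sums_summable[OF taylor_sums[OF f this]]
      show ?thesis by (rule powser_insidea) (use r in simp)
    qed
    have "uniform_limit {0..1} (\<lambda>N t. \<Sum>k<N. taylor_coeff f k * circle_point r t ^ k)
        (\<lambda>t. \<Sum>k. taylor_coeff f k * circle_point r t ^ k) sequentially"
      by (rule Weierstrass_m_test[OF _ sm]) (simp add: norm_mult norm_power cmod_circle_point)
    moreover have "(\<Sum>k. taylor_coeff f k * circle_point r t ^ k) = F t" for t
      using taylor_sums[OF f, of "circle_point r t"] r
      by (simp add: F_def sums_iff cmod_circle_point)
    ultimately show ?thesis by (simp add: p_def[abs_def])
  qed
  have contF: "continuous_on {0..1} F"
  proof -
    have "continuous_on {0..1} (f \<circ> circle_point r)"
      by (intro continuous_on_compose continuous_intros
            continuous_on_subset[OF holomorphic_on_imp_continuous_on[OF f]])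
         (use r in \<open>auto simp: cmod_circle_point\<close>)
    then show ?thesis by (simp add: F_def[abs_def] o_def)
  qed
  have bF: "bounded (F ` {0..1})"
    by (intro compact_imp_bounded compact_continuous_image contF compact_Icc)
  have "uniform_limit {0..1} (\<lambda>N t. p N t * cnj (p N t)) (\<lambda>t. F t * cnj (F t)) sequentially"
  proof (rule uniform_lim_mult[OF unif _ bF])
    show "uniform_limit {0..1} (\<lambda>N t. cnj (p N t)) (\<lambda>t. cnj (F t)) sequentially"
      by (rule bounded_linear.uniform_limit[OF bounded_linear_cnj unif])
    show "bounded ((\<lambda>t. cnj (F t)) ` {0..1})"
      using bF by (auto simp: bounded_iff)
  qed
  then have "uniform_limit {0..1} (\<lambda>N t. Re (p N t * cnj (p N t))) (\<lambda>t. Re (F t * cnj (F t))) sequentially"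
    by (rule bounded_linear.uniform_limit[OF bounded_linear_Re])
  then have u2: "uniform_limit {0..1} (\<lambda>N t. (cmod (p N t))\<^sup>2) (\<lambda>t. (cmod (F t))\<^sup>2) sequentially"
    by (simp add: complex_norm_square[symmetric] del: complex_mult_cnj)
  have hi: "((\<lambda>t. (cmod (p N t))\<^sup>2) has_integral (\<Sum>k<N. (cmod (taylor_coeff f k))\<^sup>2 * (r\<^sup>2) ^ k)) {0..1}" for N
    unfolding p_def by (rule parseval_polynomial)
  have int: "(\<lambda>t. (cmod (F t))\<^sup>2) integrable_on {0..1}"
    by (intro integrable_continuous_interval continuous_intros contF)
  have "(\<lambda>N. integral {0..1} (\<lambda>t. (cmod (p N t))\<^sup>2)) \<longlonglongrightarrow> integral {0..1} (\<lambda>t. (cmod (F t))\<^sup>2)"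
  proof -
    obtain I J where I: "\<And>n. ((\<lambda>t. (cmod (p n t))\<^sup>2) has_integral I n) {0..1}"
      and J: "((\<lambda>t. (cmod (F t))\<^sup>2) has_integral J) {0..1}" and IJ: "I \<longlonglongrightarrow> J"
    proof (rule uniform_limit_integral[OF u2])
      show "continuous_on {0..1} (\<lambda>t. (cmod (p N t))\<^sup>2)" for N
        unfolding p_def by (intro continuous_intros)
    qed auto
    then show ?thesis using integral_unique[OF I] integral_unique[OF J] by simp
  qed
  then show ?thesis unfolding sums_def F_def by (simp add: integral_unique[OF hi])
qed

lemma taylor_square_sums_mono:
  assumes f: "f holomorphic_on unit_disc" and g: "g holomorphic_on unit_disc"
    and le: "\<And>z. z \<in> unit_disc \<Longrightarrow> cmod (f z) \<le> K * cmod (g z)"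
    and x: "0 \<le> x" "x < 1"
  shows "(\<Sum>k<N. (cmod (taylor_coeff f k))\<^sup>2 * x ^ k) \<le> K\<^sup>2 * (\<Sum>k. (cmod (taylor_coeff g k))\<^sup>2 * x ^ k)"
    and "summable (\<lambda>k. (cmod (taylor_coeff g k))\<^sup>2 * x ^ k)"
proof -
  define r where "r = sqrt x"
  have r: "0 \<le> r" "r < 1" "r\<^sup>2 = x" using x by (auto simp: r_def)
  note pf = parseval_circle[OF f r(1,2), unfolded r(3)] and pg = parseval_circle[OF g r(1,2), unfolded r(3)]
  show "summable (\<lambda>k. (cmod (taylor_coeff g k))\<^sup>2 * x ^ k)" using pg by (rule sums_summable)
  have circ: "circle_point r t \<in> unit_disc" for t using r by (simp add: cmod_circle_point)
  have int: "(\<lambda>t. (cmod (u (circle_point r t)))\<^sup>2) integrable_on {0..1}" if u: "u holomorphic_on unit_disc" for u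
  proof -
    have "continuous_on {0..1} (u \<circ> circle_point r)"
      by (intro continuous_on_compose continuous_intros
            continuous_on_subset[OF holomorphic_on_imp_continuous_on[OF u]])
         (use circ in auto)
    then show ?thesis by (intro integrable_continuous_interval continuous_intros) (simp add: o_def)
  qed
  have "(\<Sum>k<N. (cmod (taylor_coeff f k))\<^sup>2 * x ^ k) \<le> integral {0..1} (\<lambda>t. (cmod (f (circle_point r t)))\<^sup>2)"
    unfolding sums_unique[OF pf]
    by (rule sum_le_suminf[OF sums_summable[OF pf]]) (use x in auto)
  also have "\<dots> \<le> integral {0..1} (\<lambda>t. K\<^sup>2 * (cmod (g (circle_point r t)))\<^sup>2)"
    by (intro integral_le integrable_on_mult_right int f g)
       (use le[OF circ] in \<open>auto simp: power_mult_distrib[symmetric] intro!: power_mono\<close>)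
  also have "\<dots> = K\<^sup>2 * (\<Sum>k. (cmod (taylor_coeff g k))\<^sup>2 * x ^ k)"
    unfolding sums_unique[OF pg, symmetric] by simp
  finally show "(\<Sum>k<N. (cmod (taylor_coeff f k))\<^sup>2 * x ^ k) \<le> K\<^sup>2 * (\<Sum>k. (cmod (taylor_coeff g k))\<^sup>2 * x ^ k)" .
qed

text \<open>
  Integration of the inequality between power series over \<open>[0, 1]\<close>, carried out with antiderivatives: the
  difference \<open>D\<close> of the antiderivatives vanishes at \<open>0\<close> and is nondecreasing.
\<close>

lemma power_series_integral_mono:
  fixes p q :: "nat \<Rightarrow> real"
  assumes q: "\<And>n. 0 \<le> q n" "\<And>x. 0 \<le> x \<Longrightarrow> x < 1 \<Longrightarrow> (\<Sum>n<N. p n * x ^ n) \<le> L * (\<Sum>n. q n * x ^ n)"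
    and sm: "summable (\<lambda>n. q n / real (Suc n))" and L: "L \<ge> 0"
  shows "(\<Sum>n<N. p n / real (Suc n)) \<le> L * (\<Sum>n. q n / real (Suc n))"
proof -
  define c where "c n = (case n of 0 \<Rightarrow> 0 | Suc m \<Rightarrow> q m / real (Suc m))" for n
  have smc: "summable c"
    using sm unfolding summable_Suc_iff[of c, symmetric] by (simp add: c_def)
  have sumc: "suminf c = (\<Sum>n. q n / real (Suc n))"
    using suminf_split_head[OF smc] by (simp add: c_def)
  have c0: "0 \<le> c n" for n using q by (cases n) (auto simp: c_def)
  have diffs: "diffs c = q" by (simp add: diffs_def c_def fun_eq_iff del: of_nat_Suc)
  define D where "D x = L * (\<Sum>n. c n * x ^ n) - (\<Sum>n<N. p n * (x ^ Suc n / real (Suc n)))" for x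
  have deriv: "(D has_real_derivative (L * (\<Sum>n. q n * x ^ n) - (\<Sum>n<N. p n * x ^ n))) (at x)" if "\<bar>x\<bar> < 1" for x
  proof -
    have "((\<lambda>x. \<Sum>n. c n * x ^ n) has_real_derivative (\<Sum>n. diffs c n * x ^ n)) (at x)"
      by (rule termdiffs_strong[where K=1]) (use smc that in auto)
    moreover have "((\<lambda>x. x ^ Suc n / real (Suc n)) has_real_derivative x ^ n) (at x)" for n
      by (rule derivative_eq_intros refl | simp)+
    ultimately show ?thesis unfolding D_def[abs_def] diffs
      by (intro DERIV_diff DERIV_cmult DERIV_sum) 
  qed
  have D0: "D 0 = 0" by (simp add: D_def c_def)
  have le: "(\<Sum>n<N. p n * (x ^ Suc n / real (Suc n))) \<le> L * suminf c" if x: "0 < x" "x < 1" for x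
  proof -
    have "D 0 \<le> D x"
    proof (rule DERIV_nonneg_imp_nondecreasing[of 0 x])
      fix y assume "0 \<le> y" "y \<le> x"
      then show "\<exists>d. (D has_real_derivative d) (at y) \<and> 0 \<le> d"
        using deriv[of y] q(2)[of y] x
        by (intro exI[of _ "L * (\<Sum>n. q n * y ^ n) - (\<Sum>n<N. p n * y ^ n)"] conjI) auto
    qed (use x in auto)
    then have "(\<Sum>n<N. p n * (x ^ Suc n / real (Suc n))) \<le> L * (\<Sum>n. c n * x ^ n)" by (simp add: D0) (simp add: D_def)
    also have "(\<Sum>n. c n * x ^ n) \<le> suminf c"
    proof (rule suminf_le)
      show le: "c n * x ^ n \<le> c n" for n
        using c0[of n] x by (simp add: mult_left_le power_le_one)
      show "summable (\<lambda>n. c n * x ^ n)"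
        by (rule summable_comparison_test'[OF smc, where N=0]) (use le c0 x in \<open>simp add: abs_mult\<close>)
    qed (rule smc)
    finally show ?thesis using L by (simp add: mult_left_mono)
  qed
  have "((\<lambda>x. \<Sum>n<N. p n * (x ^ Suc n / real (Suc n))) \<longlongrightarrow> (\<Sum>n<N. p n * (1 ^ Suc n / real (Suc n)))) (at_left 1)"
    by (intro tendsto_intros) auto
  moreover have "\<forall>\<^sub>F x in at_left (1::real). (\<Sum>n<N. p n * (x ^ Suc n / real (Suc n))) \<le> L * suminf c"
    by (rule eventually_at_leftI[of 0]) (use le in auto)
  ultimately have "(\<Sum>n<N. p n * (1 ^ Suc n / real (Suc n))) \<le> L * suminf c"
    by (intro tendsto_upperbound) auto
  then show ?thesis by (simp add: sumc)
qed

lemma taylor_coeff_cong: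
  assumes "\<And>z. z \<in> unit_disc \<Longrightarrow> f z = g z"
  shows "taylor_coeff f n = taylor_coeff g n"
proof -
  have "\<forall>\<^sub>F z in nhds (0::complex). z \<in> unit_disc" by (rule eventually_nhds_in_open) auto
  then have "\<forall>\<^sub>F z in nhds 0. f z = g z" by eventually_elim (rule assms)
  then show ?thesis unfolding taylor_coeff_def by (simp add: higher_deriv_cong_ev)
qed

lemma taylor_coeff_deriv: "taylor_coeff (deriv f) n = of_nat (Suc n) * taylor_coeff f (Suc n)"
  unfolding taylor_coeff_def funpow_Suc_right by (simp add: field_simps del: of_nat_Suc)

lemma taylor_square_sum_le_sup:
  assumes f: "f holomorphic_on unit_disc" and le: "\<And>z. z \<in> unit_disc \<Longrightarrow> cmod (f z) \<le> K"
  shows "(\<Sum>k<N. (cmod (taylor_coeff f k))\<^sup>2) \<le> K\<^sup>2"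
proof -
  have "(\<Sum>k<N. (cmod (taylor_coeff f k))\<^sup>2 * x ^ k) \<le> K\<^sup>2" if x: "0 \<le> x" "x < 1" for x
  proof -
    have "(\<Sum>k. (cmod (taylor_coeff (\<lambda>_. 1) k))\<^sup>2 * x ^ k) = 1"
      by (subst suminf_finite[of "{0}"]) (auto simp: taylor_coeff_def)
    with taylor_square_sums_mono(1)[OF f holomorphic_on_const[of 1] _ x, of K N] le
    show ?thesis by simp
  qed
  then have "\<forall>\<^sub>F x in at_left (1::real). (\<Sum>k<N. (cmod (taylor_coeff f k))\<^sup>2 * x ^ k) \<le> K\<^sup>2"
    by (intro eventually_at_leftI[of 0]) auto
  moreover have "((\<lambda>x. \<Sum>k<N. (cmod (taylor_coeff f k))\<^sup>2 * x ^ k) \<longlongrightarrow>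
      (\<Sum>k<N. (cmod (taylor_coeff f k))\<^sup>2 * 1 ^ k)) (at_left 1)"
    by (intro tendsto_intros)
  ultimately have "(\<Sum>k<N. (cmod (taylor_coeff f k))\<^sup>2 * 1 ^ k) \<le> K\<^sup>2"
    by (intro tendsto_upperbound) auto
  then show ?thesis by simp
qed

text \<open>
  The weighted sums are the squared norms in the Bergman space, obtained by integrating the squared means over
  circles with respect to the square of the radius.
\<close>

lemma taylor_square_sum_le_bergman:
  assumes f: "f holomorphic_on unit_disc" and g: "g holomorphic_on unit_disc"
    and le: "\<And>z. z \<in> unit_disc \<Longrightarrow> cmod (f z) \<le> K * cmod (g z)"
    and sm: "summable (\<lambda>k. (cmod (taylor_coeff g k))\<^sup>2 / real (Suc k))"
  shows "(\<Sum>k<N. (cmod (taylor_coeff f k))\<^sup>2 / real (Suc k))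
      \<le> K\<^sup>2 * (\<Sum>k. (cmod (taylor_coeff g k))\<^sup>2 / real (Suc k))"
  by (rule power_series_integral_mono) (use taylor_square_sums_mono(1)[OF f g le] sm in auto)

lemma wnorm_le:
  assumes "f \<in> wspace \<omega>" "\<And>N. (\<Sum>k<N. \<omega> k * (cmod (taylor_coeff f k))\<^sup>2) \<le> B\<^sup>2" "0 \<le> B"
  shows "wnorm \<omega> f \<le> B"
proof -
  have "(\<Sum>k. \<omega> k * (cmod (taylor_coeff f k))\<^sup>2) \<le> B\<^sup>2"
    using assms by (intro suminf_le_const) (auto simp: wspace_def)
  then have "wnorm \<omega> f \<le> sqrt (B\<^sup>2)" unfolding wnorm_def by (rule real_sqrt_le_mono)
  then show ?thesis using assms by simp
qed

lemma hardy_weight_ge_1: "1 \<le> hardy_weight n" and dirichlet_weight_ge_1: "1 \<le> dirichlet_weight n"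
  by (auto simp: hardy_weight_def dirichlet_weight_def)

lemma wseries_unit:
  assumes "\<And>n. 1 \<le> \<omega> n" and z: "z \<in> unit_disc"
  shows "wseries \<omega> (ell2_unit n 1) z = z ^ n / of_real (sqrt (\<omega> n))"
proof -
  have "(\<Sum>k. ell2_nth (ell2_unit n 1) k / of_real (sqrt (\<omega> k)) * z ^ k) = z ^ n / of_real (sqrt (\<omega> n))"
    by (subst suminf_finite[of "{n}"]) auto
  then show ?thesis using z by (simp add: wseries_def)
qed

lemma summable_geometric_linear:
  fixes r :: real
  assumes "0 \<le> r" "r < 1"
  shows "summable (\<lambda>n. M * (real (Suc n) * r ^ n))"
  using assms by (intro summable_mult sums_summable[OF geometric_deriv_sums]) auto

text \<open>
  The norm of the image of the \<open>n\<close>-th basis vector is at most a constant times \<open>(n + 1) r\<^sup>n\<close>. In the Hardy space this is the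
  bound for \<open>\<phi>\<^sup>n\<close> by its supremum. In the Dirichlet space the norm is, up to the value at \<open>0\<close>, the Bergman
  norm of the derivative \<open>n \<phi>\<^sup>n\<^sup>-\<^sup>1 \<phi>'\<close>, and \<open>\<phi>'\<close> has finite Bergman norm because \<open>\<phi>\<close> is the image of
  the coordinate function.
\<close>

lemma composition_op_trace_class:
  assumes \<omega>: "\<omega> = hardy_weight \<or> \<omega> = dirichlet_weight"
    and hol: "\<phi> holomorphic_on unit_disc" and self: "\<And>z. z \<in> unit_disc \<Longrightarrow> \<phi> z \<in> unit_disc"
    and bdd: "bounded_op \<omega> (composition_op \<phi>)"
    and r: "0 < r" "r < 1" "\<And>z. z \<in> unit_disc \<Longrightarrow> cmod (\<phi> z) \<le> r"
  shows "trace_class_op \<omega> (composition_op \<phi>)"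
proof -
  have w1: "1 \<le> \<omega> n" for n using \<omega> hardy_weight_ge_1 dirichlet_weight_ge_1 by auto
  define e where "e n = composition_op \<phi> (wseries \<omega> (ell2_unit n 1))" for n
  have ew: "e n \<in> wspace \<omega>" for n
    using bdd wseries_in_wspace[of \<omega>, OF w1] by (simp add: bounded_op_def e_def)
  have e: "e n z = (1 / of_real (sqrt (\<omega> n))) * \<phi> z ^ n" if "z \<in> unit_disc" for n z
    using that wseries_unit[of \<omega>, OF w1 self[OF that]] by (simp add: e_def composition_op_def)
  have ec: "taylor_coeff (e n) k = (1 / of_real (sqrt (\<omega> n))) * taylor_coeff (\<lambda>z. \<phi> z ^ n) k" for n k
  proof -
    have "taylor_coeff (e n) k = taylor_coeff (\<lambda>z. (1 / of_real (sqrt (\<omega> n))) * \<phi> z ^ n + 0 * \<phi> z) k"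
      by (rule taylor_coeff_cong) (simp add: e)
    also have "\<dots> = (1 / of_real (sqrt (\<omega> n))) * taylor_coeff (\<lambda>z. \<phi> z ^ n) k"
      by (subst taylor_coeff_linear) (auto intro!: holomorphic_intros hol)
    finally show ?thesis .
  qed
  have ec_le: "(cmod (taylor_coeff (e n) k))\<^sup>2 \<le> (cmod (taylor_coeff (\<lambda>z. \<phi> z ^ n) k))\<^sup>2" for n k
  proof -
    have "cmod (taylor_coeff (e n) k) = cmod (taylor_coeff (\<lambda>z. \<phi> z ^ n) k) / sqrt (\<omega> n)"
      using w1[of n] by (simp add: ec norm_mult norm_divide)
    also have "\<dots> \<le> cmod (taylor_coeff (\<lambda>z. \<phi> z ^ n) k) / 1"
      using w1[of n] by (intro frac_le) auto
    finally show ?thesis by (intro power_mono) auto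
  qed
  have pow_le: "cmod (\<phi> z ^ n) \<le> r ^ n" if "z \<in> unit_disc" for z n
    unfolding norm_power by (intro power_mono r that) auto
  have hol_pow: "(\<lambda>z. \<phi> z ^ n) holomorphic_on unit_disc" for n by (intro holomorphic_intros hol)
  have "\<exists>M. \<forall>n. wnorm \<omega> (e n) \<le> M * (real (Suc n) * r ^ n)"
  proof (cases "\<omega> = hardy_weight")
    case True
    have "wnorm \<omega> (e n) \<le> 1 * (real (Suc n) * r ^ n)" for n
    proof -
      have "wnorm \<omega> (e n) \<le> r ^ n"
      proof (rule wnorm_le[OF ew])
        fix N
        have "(\<Sum>k<N. \<omega> k * (cmod (taylor_coeff (e n) k))\<^sup>2) \<le> (\<Sum>k<N. (cmod (taylor_coeff (\<lambda>z. \<phi> z ^ n) k))\<^sup>2)"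
          by (intro sum_mono) (simp add: True hardy_weight_def ec_le)
        also have "\<dots> \<le> (r ^ n)\<^sup>2" by (rule taylor_square_sum_le_sup[OF hol_pow pow_le])
        finally show "(\<Sum>k<N. \<omega> k * (cmod (taylor_coeff (e n) k))\<^sup>2) \<le> (r ^ n)\<^sup>2" .
      qed (use r in simp)
      also have "r ^ n \<le> real (Suc n) * r ^ n" using r by (simp add: algebra_simps)
      finally show ?thesis by simp
    qed
    then show ?thesis by blast
  next
    case False
    then have D: "\<omega> = dirichlet_weight" using \<omega> by simp
    have D0: "\<omega> 0 = 1" and DS: "\<omega> (Suc k) = real (Suc k)" for k by (simp_all add: D dirichlet_weight_def)
    have coeff_deriv: "(cmod (taylor_coeff (deriv f) k))\<^sup>2 / real (Suc k) = real (Suc k) * (cmod (taylor_coeff f (Suc k)))\<^sup>2" for f k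
      unfolding taylor_coeff_deriv by (simp add: norm_mult power_mult_distrib power2_eq_square del: of_nat_Suc)
    define E where "E = (\<Sum>k. (cmod (taylor_coeff (deriv \<phi>) k))\<^sup>2 / real (Suc k))"
    have smE: "summable (\<lambda>k. (cmod (taylor_coeff (deriv \<phi>) k))\<^sup>2 / real (Suc k))"
    proof -
      have "summable (\<lambda>k. \<omega> k * (cmod (taylor_coeff (e 1) k))\<^sup>2)" using ew[of 1] by (simp add: wspace_def)
      then have "summable (\<lambda>k. \<omega> (Suc k) * (cmod (taylor_coeff (e 1) (Suc k)))\<^sup>2)"
        by (subst summable_Suc_iff)
      then show ?thesis unfolding coeff_deriv by (simp add: ec DS[of 0] DS del: of_nat_Suc) (simp add: D dirichlet_weight_def)
    qed
    have E0: "0 \<le> E" unfolding E_def by (intro suminf_nonneg smE) auto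
    define s where "s = sqrt E / r"
    define M where "M = 1 + s"
    have M: "M \<ge> 1" using E0 r by (simp add: M_def s_def)
    have "wnorm \<omega> (e n) \<le> M * (real (Suc n) * r ^ n)" for n
    proof (rule wnorm_le[OF ew])
      let ?p = "\<lambda>z. \<phi> z ^ n"
      have dp: "cmod (deriv ?p z) \<le> (real n * r ^ n / r) * cmod (deriv \<phi> z)" if z: "z \<in> unit_disc" for z
      proof (cases n)
        case (Suc m)
        have "(\<phi> has_field_derivative deriv \<phi> z) (at z)"
          by (rule holomorphic_derivI[OF hol _ z]) simp
        then have "(?p has_field_derivative (of_nat n * \<phi> z ^ m * deriv \<phi> z)) (at z)"
          using DERIV_power_Suc[of \<phi> "deriv \<phi> z" z UNIV m] by (simp add: Suc mult_ac)
        then have "deriv ?p z = of_nat n * \<phi> z ^ m * deriv \<phi> z" by (rule DERIV_imp_deriv)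
        then have "cmod (deriv ?p z) = real n * cmod (\<phi> z ^ m) * cmod (deriv \<phi> z)" by (simp add: norm_mult)
        also have "\<dots> \<le> real n * r ^ m * cmod (deriv \<phi> z)"
          by (intro mult_right_mono mult_left_mono pow_le z) auto
        finally show ?thesis using r by (simp add: Suc)
      qed simp
      fix N
      have "(\<Sum>k<N. \<omega> k * (cmod (taylor_coeff (e n) k))\<^sup>2) \<le> (\<Sum>k<Suc N. \<omega> k * (cmod (taylor_coeff ?p k))\<^sup>2)"
      proof -
        have "(\<Sum>k<N. \<omega> k * (cmod (taylor_coeff (e n) k))\<^sup>2) \<le> (\<Sum>k<N. \<omega> k * (cmod (taylor_coeff ?p k))\<^sup>2)"
          using w1 by (intro sum_mono mult_left_mono ec_le) (meson order_trans zero_le_one)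
        also have "\<dots> \<le> (\<Sum>k<Suc N. \<omega> k * (cmod (taylor_coeff ?p k))\<^sup>2)"
          using w1[of N] by simp
        finally show ?thesis .
      qed
      also have "\<dots> = (cmod (taylor_coeff ?p 0))\<^sup>2 + (\<Sum>k<N. (cmod (taylor_coeff (deriv ?p) k))\<^sup>2 / real (Suc k))"
        unfolding sum.lessThan_Suc_shift coeff_deriv by (simp add: D0 DS del: of_nat_Suc)
      also have "(cmod (taylor_coeff ?p 0))\<^sup>2 \<le> (r ^ n)\<^sup>2"
        using pow_le[of 0 n] by (intro power_mono) (auto simp: taylor_coeff_def)
      also have "(\<Sum>k<N. (cmod (taylor_coeff (deriv ?p) k))\<^sup>2 / real (Suc k)) \<le> (real n * r ^ n / r)\<^sup>2 * E"
        unfolding E_def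
        by (rule taylor_square_sum_le_bergman[OF _ _ dp smE])
           (auto intro!: holomorphic_deriv hol hol_pow)
      also have "(r ^ n)\<^sup>2 + (real n * r ^ n / r)\<^sup>2 * E = (r ^ n)\<^sup>2 * (1 + (real n * s)\<^sup>2)"
        using E0 by (simp add: s_def power_mult_distrib power_divide algebra_simps)
      also have "\<dots> \<le> (r ^ n)\<^sup>2 * (M * real (Suc n))\<^sup>2"
      proof (intro mult_left_mono)
        have q: "0 \<le> s" using E0 r by (simp add: s_def)
        then have ns: "0 \<le> real n * s" by simp
        then have "1 + (real n * s)\<^sup>2 \<le> (1 + real n * s)\<^sup>2"
          by (simp add: power2_eq_square algebra_simps)
        also have "\<dots> \<le> (M * real (Suc n))\<^sup>2"
          using q ns by (intro power_mono) (auto simp: M_def algebra_simps)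
        finally show "1 + (real n * s)\<^sup>2 \<le> (M * real (Suc n))\<^sup>2" .
      qed simp
      also have "\<dots> = (M * (real (Suc n) * r ^ n))\<^sup>2" by (simp add: power_mult_distrib mult_ac)
      finally show "(\<Sum>k<N. \<omega> k * (cmod (taylor_coeff (e n) k))\<^sup>2) \<le> (M * (real (Suc n) * r ^ n))\<^sup>2" by simp
    qed (use M r in simp)
    then show ?thesis by blast
  qed
  then obtain M where M: "\<And>n. wnorm \<omega> (e n) \<le> M * (real (Suc n) * r ^ n)" by blast
  have "summable (\<lambda>n. wnorm \<omega> (e n))"
  proof (rule summable_comparison_test'[OF summable_geometric_linear, where N=0])
    show "norm (wnorm \<omega> (e n)) \<le> M * (real (Suc n) * r ^ n)" for n
      using M[of n] wnorm_eq[of \<omega>, OF w1 ew] by simp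
  qed (use r in auto)
  then show ?thesis unfolding e_def by (rule trace_class_if_summable_norms[of \<omega>, OF w1 bdd])
qed

section \<open>Moduli of disc-valued functions near a boundary segment\<close>

lemma disc_involution_denom:
  assumes "cmod a < 1" "cmod z < 1"
  shows "1 - cnj a * z \<noteq> 0"
proof -
  have "cmod (cnj a * z) < 1"
    using assms by (simp add: norm_mult) (metis mult_less_cancel_right1 norm_ge_zero order_less_imp_le mult_strict_mono' mult_1)
  then show ?thesis by auto
qed

lemma disc_involution_identity:
  assumes "cmod a < 1" "cmod z < 1"
  shows "1 - (cmod (disc_involution a z))\<^sup>2 = (1 - (cmod a)\<^sup>2) * (1 - (cmod z)\<^sup>2) / (cmod (1 - cnj a * z))\<^sup>2"
proof -
  have "(cmod (1 - cnj a * z))\<^sup>2 - (cmod (a - z))\<^sup>2 = (1 - (cmod a)\<^sup>2) * (1 - (cmod z)\<^sup>2)"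
    unfolding cmod_power2 by (simp add: power2_eq_square algebra_simps)
  then show ?thesis
    using disc_involution_denom[OF assms]
    by (simp add: disc_involution_def norm_divide power_divide divide_simps)
qed

lemma disc_involution_in_disc:
  assumes "cmod a < 1" "cmod z < 1"
  shows "cmod (disc_involution a z) < 1"
proof -
  have "0 < (1 - (cmod a)\<^sup>2) * (1 - (cmod z)\<^sup>2) / (cmod (1 - cnj a * z))\<^sup>2"
    using assms disc_involution_denom[OF assms] by (simp add: power_less_one_iff)
  then have "(cmod (disc_involution a z))\<^sup>2 < 1" unfolding disc_involution_identity[OF assms, symmetric] by simp
  then show ?thesis by (simp add: power_less_one_iff)
qed

lemma disc_involution_involutive:
  assumes "cmod a < 1" "cmod z < 1"
  shows "disc_involution a (disc_involution a z) = z"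
proof -
  have d: "1 - cnj a * z \<noteq> 0" by (rule disc_involution_denom[OF assms])
  have nz: "1 - cnj a * a \<noteq> 0" by (rule disc_involution_denom[OF assms(1) assms(1)])
  have num: "a * (1 - cnj a * z) - (a - z) = z * (1 - cnj a * a)" by (simp add: algebra_simps)
  have den: "(1 - cnj a * z) - cnj a * (a - z) = 1 - cnj a * a" by (simp add: algebra_simps)
  have "disc_involution a (disc_involution a z)
      = (a * (1 - cnj a * z) - (a - z)) / ((1 - cnj a * z) - cnj a * (a - z))"
    unfolding disc_involution_def using d by (simp add: divide_simps)
  then show ?thesis unfolding num den using nz by simp
qed

lemma disc_involution_holomorphic:
  assumes "cmod a < 1"
  shows "disc_involution a holomorphic_on unit_disc"
  unfolding disc_involution_def[abs_def]
  by (intro holomorphic_intros) (use disc_involution_denom[OF assms] in auto)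

lemma disc_involution_defect_le:
  assumes a: "cmod a < 1" and z: "cmod z < 1"
  shows "1 - (cmod (disc_involution a z))\<^sup>2 \<le> (1 + cmod a) / (1 - cmod a) * (1 - (cmod z)\<^sup>2)"
proof -
  have "1 - cmod (cnj a * z) \<le> cmod (1 - cnj a * z)" using norm_triangle_ineq2[of 1 "cnj a * z"] by simp
  moreover have "cmod (cnj a * z) \<le> cmod a" using z by (simp add: norm_mult mult_left_le)
  ultimately have d: "1 - cmod a \<le> cmod (1 - cnj a * z)" by linarith
  have "1 - (cmod (disc_involution a z))\<^sup>2 \<le> (1 - (cmod a)\<^sup>2) * (1 - (cmod z)\<^sup>2) / (1 - cmod a)\<^sup>2"
    unfolding disc_involution_identity[OF a z]
    using a z d by (intro divide_left_mono power_mono mult_nonneg_nonneg mult_pos_pos)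
      (auto simp: power_le_one disc_involution_denom)
  also have "\<dots> = (1 + cmod a) / (1 - cmod a) * (1 - (cmod z)\<^sup>2)"
  proof -
    have "1 - (cmod a)\<^sup>2 = (1 + cmod a) * (1 - cmod a)" by (simp add: power2_eq_square algebra_simps)
    then show ?thesis using a by (simp add: power2_eq_square)
  qed
  finally show ?thesis .
qed

text \<open>
  The involution preserves the order of contact with the circle; this transfers contact
  sequences between the semiflow and its model.
\<close>

lemma disc_involution_contact:
  assumes a: "cmod a < 1" and z: "cmod z < 1"
  shows "1 - cmod (disc_involution a z) \<le> 4 / (1 - cmod a) * (1 - cmod z)"
proof -
  let ?b = "disc_involution a z"
  have "1 - cmod ?b \<le> 1 - (cmod ?b)\<^sup>2"
    using disc_involution_in_disc[OF a z] by (simp add: power2_eq_square mult_left_le)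
  also have "\<dots> \<le> (1 + cmod a) / (1 - cmod a) * (1 - (cmod z)\<^sup>2)"
    by (rule disc_involution_defect_le[OF a z])
  also have "\<dots> \<le> 2 / (1 - cmod a) * (2 * (1 - cmod z))"
  proof (intro mult_mono divide_right_mono)
    have "0 \<le> (1 - cmod z)\<^sup>2" by simp
    then show "1 - (cmod z)\<^sup>2 \<le> 2 * (1 - cmod z)" by (simp add: power2_eq_square algebra_simps)
  qed (use a z in \<open>auto simp: power_le_one\<close>)
  finally show ?thesis by simp
qed

text \<open>
  The Schwarz lemma for \<open>f\<close> followed by the involution that sends the value at the centre to \<open>0\<close>.
\<close>

lemma schwarz_pick_radial:
  assumes hol: "f holomorphic_on ball p R" and R: "R > 0" and f: "\<And>z. z \<in> ball p R \<Longrightarrow> cmod (f z) < 1"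
  shows "\<exists>k>0. \<forall>z\<in>ball p R. 1 - cmod (f z) \<ge> k * (R - dist p z)"
proof -
  define a where "a = f p"
  have a: "cmod a < 1" using f[of p] R by (simp add: a_def)
  define g where "g z = f (p + of_real R * z)" for z
  have in_ball: "p + of_real R * z \<in> ball p R" if "cmod z < 1" for z
    using that R by (simp add: dist_norm norm_mult)
  have g: "cmod (g z) < 1" if "cmod z < 1" for z unfolding g_def by (intro f in_ball that)
  have "g holomorphic_on unit_disc"
    unfolding g_def[abs_def] using in_ball
    by (intro holomorphic_on_compose_gen[OF _ hol, unfolded o_def] holomorphic_intros) auto
  then have "(disc_involution a \<circ> g) holomorphic_on unit_disc"
    by (rule holomorphic_on_compose_gen[OF _ disc_involution_holomorphic[OF a]]) (use g in auto)
  then have S: "cmod (disc_involution a (g z)) \<le> cmod z" if "cmod z < 1" for z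
    using Schwarz_Lemma(1)[of "disc_involution a \<circ> g" z] that disc_involution_in_disc[OF a g]
    by (auto simp: disc_involution_def g_def a_def)
  define k0 where "k0 = (1 - cmod a) / (2 * (1 + cmod a))"
  define k where "k = k0 / R"
  have k: "k > 0" using a R by (auto simp: k_def k0_def intro!: divide_pos_pos mult_pos_pos add_pos_nonneg)
  have "1 - cmod (f z) \<ge> k * (R - dist p z)" if z: "z \<in> ball p R" for z
  proof -
    define u where "u = (z - p) / of_real R"
    have u: "cmod u < 1" "g u = f z" "dist p z = R * cmod u"
      using z R by (auto simp: u_def g_def norm_divide dist_norm norm_minus_commute)
    have "(1 - cmod u) \<le> 1 - (cmod u)\<^sup>2" using u(1) by (simp add: power2_eq_square mult_left_le)
    also have "\<dots> \<le> 1 - (cmod (disc_involution a (g u)))\<^sup>2" using S[OF u(1)] by (simp add: power_mono)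
    also have "\<dots> \<le> (1 + cmod a) / (1 - cmod a) * (1 - (cmod (g u))\<^sup>2)"
      by (rule disc_involution_defect_le[OF a g[OF u(1)]])
    also have "\<dots> \<le> (1 + cmod a) / (1 - cmod a) * (2 * (1 - cmod (g u)))"
    proof (rule mult_left_mono)
      have "0 \<le> (1 - cmod (g u))\<^sup>2" by simp
      then show "1 - (cmod (g u))\<^sup>2 \<le> 2 * (1 - cmod (g u))" by (simp add: power2_eq_square algebra_simps)
    qed (use a in simp)
    finally have *: "1 - cmod u \<le> (1 + cmod a) / (1 - cmod a) * (2 * (1 - cmod (f z)))" using u by simp
    have "R - dist p z = R * (1 - cmod u)" by (simp add: u algebra_simps)
    then have "k * (R - dist p z) = k0 * (1 - cmod u)" using R by (simp add: k_def)
    also have "\<dots> \<le> k0 * ((1 + cmod a) / (1 - cmod a) * (2 * (1 - cmod (f z))))"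
      using a by (intro mult_left_mono *) (auto simp: k0_def intro!: divide_nonneg_pos add_pos_nonneg)
    also have "\<dots> = 1 - cmod (f z)"
    proof -
      have "1 - cmod a \<noteq> 0" "1 + cmod a \<noteq> 0" using a norm_ge_zero[of a] by linarith+
      moreover have "A / (2 * B) * (B / A * (2 * X)) = X" if "A \<noteq> 0" "B \<noteq> 0" for A B X :: real
        using that by simp
      ultimately show ?thesis unfolding k0_def by blast
    qed
    finally show ?thesis .
  qed
  with k show ?thesis by blast
qed

definition edge_box :: "real \<Rightarrow> real \<Rightarrow> real \<Rightarrow> complex set"
  where "edge_box x1 x2 b = {z. x1 < Re z \<and> Re z < x2 \<and> 0 < Im z \<and> Im z < b}"

lemma in_edge_box [simp]: "z \<in> edge_box x1 x2 b \<longleftrightarrow> x1 < Re z \<and> Re z < x2 \<and> 0 < Im z \<and> Im z < b"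
  by (simp add: edge_box_def)

text \<open>
  Near \<open>x\<close> the function \<open>1 / f\<close> is multiplied by \<open>exp (- v)\<close>, where the real part of
  \<open>v(\<zeta>) = L (\<zeta>\<^sup>2 / \<rho>\<^sup>2 - 2 \<i> \<zeta> / \<rho>)\<close> is nonnegative on the lower side of a rectangle in the box and at least \<open>L\<close> on
  its other three sides. As \<open>|1 / f| \<le> exp L\<close>, the maximum principle bounds the product by \<open>1\<close> in the limit in which
  the lower side approaches the edge, and on the vertical line through \<open>x\<close> the real part of \<open>v\<close> grows only linearly with the distance from the edge.
\<close>

lemma modulus_lower_bound_at_edge:
  assumes hol: "f holomorphic_on edge_box x1 x2 b"
    and m: "m > 0" "\<And>z. z \<in> edge_box x1 x2 b \<Longrightarrow> m \<le> cmod (f z)"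
    and edge: "\<And>\<eta>. 0 < \<eta> \<Longrightarrow> \<eta> < 1 \<Longrightarrow> \<exists>\<delta>>0. \<forall>z\<in>edge_box x1 x2 b. Im z < \<delta> \<longrightarrow> 1 - \<eta> \<le> cmod (f z)"
    and x: "x1 < x" "x < x2" and b: "b > 0"
  shows "\<exists>K>0. \<exists>\<rho>>0. \<forall>\<tau>. 0 < \<tau> \<and> \<tau> < \<rho> \<longrightarrow> exp (- (K * \<tau>)) \<le> cmod (f (Complex x \<tau>))"
proof -
  define \<rho> where "\<rho> = min (min (x - x1) (x2 - x)) b / 2"
  have \<rho>: "\<rho> > 0" "x1 < x - \<rho>" "x + \<rho> < x2" "\<rho> < b" using x b by (auto simp: \<rho>_def min_def field_simps)
  define L where "L = max 1 (- ln m)"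
  have L: "L > 0" "exp (- L) \<le> m"
  proof -
    have "exp (- L) \<le> exp (ln m)" unfolding exp_le_cancel_iff by (simp add: L_def)
    then show "exp (- L) \<le> m" using m by simp
  qed (simp add: L_def)
  define v where "v \<zeta> = of_real L * (\<zeta>\<^sup>2 / of_real (\<rho>\<^sup>2) - 2 * \<i> * \<zeta> / of_real \<rho>)" for \<zeta> :: complex
  have Re_v: "Re (v \<zeta>) = L * (((Re \<zeta>)\<^sup>2 - (Im \<zeta>)\<^sup>2) / \<rho>\<^sup>2 + 2 * Im \<zeta> / \<rho>)" for \<zeta>
  proof -
    have "Re (\<zeta>\<^sup>2 / of_real (\<rho>\<^sup>2)) = ((Re \<zeta>)\<^sup>2 - (Im \<zeta>)\<^sup>2) / \<rho>\<^sup>2"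
      unfolding Re_divide_of_real by (simp add: power2_eq_square)
    moreover have "Re (2 * \<i> * \<zeta> / of_real \<rho>) = - (2 * Im \<zeta> / \<rho>)"
      unfolding Re_divide_of_real by simp
    ultimately show ?thesis by (simp add: v_def)
  qed
  define F where "F \<zeta> = exp (- v \<zeta>) / f (of_real x + \<zeta>)" for \<zeta>
  have cF: "cmod (F \<zeta>) = exp (- Re (v \<zeta>)) / cmod (f (of_real x + \<zeta>))" for \<zeta>
    by (simp add: F_def norm_divide)
  have bound: "(1 - \<eta>) * exp (- (2 * L / \<rho> * \<tau>)) \<le> cmod (f (Complex x \<tau>))"
    if \<tau>: "0 < \<tau>" "\<tau> < \<rho>" and \<eta>: "0 < \<eta>" "\<eta> < 1" for \<tau> \<eta>
  proof -
    obtain \<delta>0 where \<delta>0: "\<delta>0 > 0" "\<And>z. z \<in> edge_box x1 x2 b \<Longrightarrow> Im z < \<delta>0 \<Longrightarrow> 1 - \<eta> \<le> cmod (f z)"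
      using edge[OF \<eta>] by blast
    define \<delta> where "\<delta> = min \<tau> \<delta>0 / 2"
    have \<delta>: "0 < \<delta>" "\<delta> < \<tau>" "\<delta> < \<delta>0" using \<delta>0(1) \<tau> by (auto simp: \<delta>_def)
    define S where "S = cbox (Complex (- \<rho>) \<delta>) (Complex \<rho> \<rho>)"
    have S: "\<zeta> \<in> S \<longleftrightarrow> - \<rho> \<le> Re \<zeta> \<and> Re \<zeta> \<le> \<rho> \<and> \<delta> \<le> Im \<zeta> \<and> Im \<zeta> \<le> \<rho>" for \<zeta>
      unfolding S_def in_cbox_complex_iff by auto
    have SQ: "of_real x + \<zeta> \<in> edge_box x1 x2 b" if "\<zeta> \<in> S" for \<zeta>
      using that \<rho> \<delta> unfolding S by auto
    have f0: "f (of_real x + \<zeta>) \<noteq> 0" if "\<zeta> \<in> S" for \<zeta> using m(2)[OF SQ[OF that]] m(1) by auto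
    have holF: "F holomorphic_on S"
      unfolding F_def[abs_def] v_def
      by (intro holomorphic_intros holomorphic_on_compose_gen[OF _ hol, unfolded o_def]) (use \<rho> f0 SQ in auto)
    have "cmod (F (Complex 0 \<tau>)) \<le> 1 / (1 - \<eta>)"
    proof (rule maximum_modulus_frontier[of F S])
      show "F holomorphic_on interior S" using holF interior_subset by (rule holomorphic_on_subset)
      show "continuous_on (closure S) F"
        using holomorphic_on_imp_continuous_on[OF holF] by (simp add: S_def)
      show "bounded S" by (simp add: S_def)
      show "Complex 0 \<tau> \<in> S" using \<tau> \<delta> \<rho> by (simp add: S)
      fix \<zeta> assume "\<zeta> \<in> frontier S"
      then have "\<zeta> \<in> S" and nb: "\<not> (- \<rho> < Re \<zeta> \<and> Re \<zeta> < \<rho> \<and> \<delta> < Im \<zeta> \<and> Im \<zeta> < \<rho>)"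
        unfolding S_def frontier_cbox by (auto simp: in_box_complex_iff)
      let ?X = "Re \<zeta>" and ?Y = "Im \<zeta>"
      have \<zeta>: "- \<rho> \<le> ?X" "?X \<le> \<rho>" "\<delta> \<le> ?Y" "?Y \<le> \<rho>" using \<open>\<zeta> \<in> S\<close> unfolding S by auto
      have q: "0 \<le> ?Y * (2 * \<rho> - ?Y)" using \<zeta> \<delta> \<rho> by (intro mult_nonneg_nonneg) auto
      have rv: "Re (v \<zeta>) = L * ((?X\<^sup>2 + ?Y * (2 * \<rho> - ?Y)) / \<rho>\<^sup>2)"
        unfolding Re_v using \<rho> by (simp add: power2_eq_square field_simps)
      consider "?Y = \<delta>" | "?X\<^sup>2 = \<rho>\<^sup>2" | "?Y = \<rho>" using nb \<zeta> by (auto simp: power2_eq_iff)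
      then show "cmod (F \<zeta>) \<le> 1 / (1 - \<eta>)"
      proof cases
        case 1
        have "0 \<le> Re (v \<zeta>)" unfolding rv using L q by (intro mult_nonneg_nonneg divide_nonneg_nonneg) auto
        moreover have "1 - \<eta> \<le> cmod (f (of_real x + \<zeta>))"
          using 1 \<delta> by (intro \<delta>0(2) SQ \<open>\<zeta> \<in> S\<close>) auto
        ultimately show ?thesis unfolding cF using \<eta> by (intro frac_le) auto
      next
        case 2
        then have "1 \<le> (?X\<^sup>2 + ?Y * (2 * \<rho> - ?Y)) / \<rho>\<^sup>2" using q \<rho> by (simp add: le_divide_eq)
        from mult_left_mono[OF this, of L] have "L \<le> Re (v \<zeta>)" unfolding rv using L by simp
        then have "exp (- Re (v \<zeta>)) \<le> m" using L(2) by (smt (verit) exp_le_cancel_iff)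
        then have "cmod (F \<zeta>) \<le> m / m" unfolding cF using m SQ[OF \<open>\<zeta> \<in> S\<close>] by (intro frac_le m) auto
        also have "\<dots> \<le> 1 / (1 - \<eta>)" using m \<eta> by simp
        finally show ?thesis .
      next
        case 3
        then have "?Y * (2 * \<rho> - ?Y) = \<rho>\<^sup>2" by (simp add: power2_eq_square)
        then have "1 \<le> (?X\<^sup>2 + ?Y * (2 * \<rho> - ?Y)) / \<rho>\<^sup>2" using \<rho> by (simp add: le_divide_eq)
        from mult_left_mono[OF this, of L] have "L \<le> Re (v \<zeta>)" unfolding rv using L by simp
        then have "exp (- Re (v \<zeta>)) \<le> m" using L(2) by (smt (verit) exp_le_cancel_iff)
        then have "cmod (F \<zeta>) \<le> m / m" unfolding cF using m SQ[OF \<open>\<zeta> \<in> S\<close>] by (intro frac_le m) auto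
        also have "\<dots> \<le> 1 / (1 - \<eta>)" using m \<eta> by simp
        finally show ?thesis .
      qed
    qed
    moreover have "Re (v (Complex 0 \<tau>)) \<le> 2 * L / \<rho> * \<tau>"
      unfolding Re_v using L \<rho> by (simp add: field_simps)
    moreover have "of_real x + Complex 0 \<tau> = Complex x \<tau>" by (simp add: complex_eq_iff)
    moreover have "Complex 0 \<tau> \<in> S" using \<tau> \<delta> \<rho> by (simp add: S)
    ultimately have *: "exp (- Re (v (Complex 0 \<tau>))) / cmod (f (Complex x \<tau>)) \<le> 1 / (1 - \<eta>)"
      and le: "exp (- (2 * L / \<rho> * \<tau>)) \<le> exp (- Re (v (Complex 0 \<tau>)))"
      and nz: "0 < cmod (f (Complex x \<tau>))"
      unfolding cF using f0[of "Complex 0 \<tau>"] by auto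
    from * nz \<eta> have "(1 - \<eta>) * exp (- Re (v (Complex 0 \<tau>))) \<le> cmod (f (Complex x \<tau>))"
      by (simp add: field_simps)
    moreover have "(1 - \<eta>) * exp (- (2 * L / \<rho> * \<tau>)) \<le> (1 - \<eta>) * exp (- Re (v (Complex 0 \<tau>)))"
      using le \<eta> by (intro mult_left_mono) auto
    ultimately show ?thesis by linarith
  qed
  have "exp (- (2 * L / \<rho> * \<tau>)) \<le> cmod (f (Complex x \<tau>))" if \<tau>: "0 < \<tau>" "\<tau> < \<rho>" for \<tau>
  proof (rule tendsto_upperbound)
    show "((\<lambda>\<eta>. (1 - \<eta>) * exp (- (2 * L / \<rho> * \<tau>))) \<longlongrightarrow> exp (- (2 * L / \<rho> * \<tau>))) (at_right 0)"
      by (auto intro!: tendsto_eq_intros)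
    show "\<forall>\<^sub>F \<eta> in at_right 0. (1 - \<eta>) * exp (- (2 * L / \<rho> * \<tau>)) \<le> cmod (f (Complex x \<tau>))"
      by (rule eventually_at_rightI[of 0 1]) (use bound[OF \<tau>] in auto)
  qed simp
  then show ?thesis using L \<rho> by (intro exI[of _ "2 * L / \<rho>"] exI[of _ \<rho>] conjI) auto
qed

lemma comparable_contact_along_edge:
  assumes hol: "f holomorphic_on edge_box x1 x2 b"
    and f1: "\<And>z. z \<in> edge_box x1 x2 b \<Longrightarrow> cmod (f z) < 1"
    and m: "m > 0" "\<And>z. z \<in> edge_box x1 x2 b \<Longrightarrow> m \<le> cmod (f z)"
    and edge: "\<And>\<eta>. 0 < \<eta> \<Longrightarrow> \<eta> < 1 \<Longrightarrow> \<exists>\<delta>>0. \<forall>z\<in>edge_box x1 x2 b. Im z < \<delta> \<longrightarrow> 1 - \<eta> \<le> cmod (f z)"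
    and x: "x1 < x" "x < x2" and x': "x1 < x'" "x' < x2" and b: "b > 0"
  shows "\<exists>C. \<exists>\<rho>>0. \<forall>\<tau>. 0 < \<tau> \<and> \<tau> < \<rho> \<longrightarrow> 1 - cmod (f (Complex x' \<tau>)) \<le> C * (1 - cmod (f (Complex x \<tau>)))"
proof -
  obtain K \<rho>1 where K: "K > 0" "\<rho>1 > 0" "\<And>\<tau>. 0 < \<tau> \<Longrightarrow> \<tau> < \<rho>1 \<Longrightarrow> exp (- (K * \<tau>)) \<le> cmod (f (Complex x' \<tau>))"
    using modulus_lower_bound_at_edge[OF hol m edge x' b] by blast
  define R where "R = min (min (x - x1) (x2 - x)) b / 2"
  have R: "R > 0" "x1 < x - R" "x + R < x2" "2 * R \<le> b" using x b by (auto simp: R_def min_def field_simps)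
  have sub: "ball (Complex x R) R \<subseteq> edge_box x1 x2 b"
  proof
    fix z assume "z \<in> ball (Complex x R) R"
    then have "cmod (z - Complex x R) < R" by (simp add: dist_norm norm_minus_commute)
    with abs_Re_le_cmod[of "z - Complex x R"] abs_Im_le_cmod[of "z - Complex x R"]
    have "\<bar>Re z - x\<bar> < R" "\<bar>Im z - R\<bar> < R" by auto
    then show "z \<in> edge_box x1 x2 b" using R by auto
  qed
  obtain k where k: "k > 0" "\<And>z. z \<in> ball (Complex x R) R \<Longrightarrow> k * (R - dist (Complex x R) z) \<le> 1 - cmod (f z)"
    using schwarz_pick_radial[OF holomorphic_on_subset[OF hol sub] R(1) f1] sub by blast
  have "1 - cmod (f (Complex x' \<tau>)) \<le> K / k * (1 - cmod (f (Complex x \<tau>)))" if \<tau>: "0 < \<tau>" "\<tau> < min \<rho>1 R" for \<tau>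
  proof -
    have d: "dist (Complex x R) (Complex x \<tau>) = R - \<tau>"
      using \<tau> by (simp add: dist_norm cmod_def)
    have "k * \<tau> \<le> 1 - cmod (f (Complex x \<tau>))" using k(2)[of "Complex x \<tau>"] \<tau> d by simp
    then have "K / k * (k * \<tau>) \<le> K / k * (1 - cmod (f (Complex x \<tau>)))"
      using K k by (intro mult_left_mono) auto
    moreover have "1 - cmod (f (Complex x' \<tau>)) \<le> K * \<tau>"
      using K(3)[of \<tau>] \<tau> exp_ge_add_one_self[of "- (K * \<tau>)"] by simp
    ultimately show ?thesis using k by simp
  qed
  then show ?thesis using K R by (intro exI[of _ "K / k"] exI[of _ "min \<rho>1 R"]) auto
qed

section \<open>Boundary arcs of a domain invariant under a spiral flow\<close>

text \<open>
  The situation that a failure of the bound at time \<open>t\<close> produces: up to time \<open>t\<close> the orbit of \<open>w0\<close> is an arc of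
  the boundary.
\<close>

locale spiral_boundary_arc =
  fixes \<Omega> :: "complex set" and c w0 :: complex and t :: real
  assumes open_\<Omega>: "open \<Omega>"
    and flow: "\<And>s w. 0 \<le> s \<Longrightarrow> w \<in> \<Omega> \<Longrightarrow> exp (- c * of_real s) * w \<in> \<Omega>"
    and c_nz: "c \<noteq> 0" and w0_nz: "w0 \<noteq> 0" and t_pos: "0 < t"
    and start: "w0 \<in> closure \<Omega>" and stop: "exp (- c * of_real t) * w0 \<notin> \<Omega>"
begin

definition spiral :: "complex \<Rightarrow> complex"
  where "spiral \<sigma> = w0 * exp (- c * \<sigma>)"

lemma spiral_nz [simp]: "spiral \<sigma> \<noteq> 0"
  using w0_nz by (simp add: spiral_def)

lemma spiral_add: "spiral (\<sigma> + of_real s) = exp (- c * of_real s) * spiral \<sigma>"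
  by (simp add: spiral_def exp_add[symmetric] algebra_simps)

lemma spiral_flow:
  assumes "spiral (Complex x y) \<in> \<Omega>" "x \<le> x'"
  shows "spiral (Complex x' y) \<in> \<Omega>"
proof -
  have "Complex x' y = Complex x y + of_real (x' - x)" by (simp add: complex_eq_iff)
  then show ?thesis using flow[OF _ assms(1), of "x' - x"] assms(2) by (simp only: spiral_add)
qed

lemma spiral_real_notin:
  assumes "x \<le> t"
  shows "spiral (Complex x 0) \<notin> \<Omega>"
proof
  assume "spiral (Complex x 0) \<in> \<Omega>"
  then have "spiral (Complex t 0) \<in> \<Omega>" using assms by (rule spiral_flow)
  moreover have "Complex t 0 = of_real t" by (simp add: complex_eq_iff)
  ultimately show False using stop by (simp add: spiral_def mult.commute)
qed

lemma spiral_real_frontier: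
  assumes "0 \<le> x" "x \<le> t"
  shows "spiral (Complex x 0) \<in> frontier \<Omega>"
proof -
  have "(\<lambda>w. exp (- c * of_real x) * w) ` closure \<Omega> \<subseteq> closure ((\<lambda>w. exp (- c * of_real x) * w) ` \<Omega>)"
    by (intro image_closure_subset closure_subset continuous_intros) auto
  also have "\<dots> \<subseteq> closure \<Omega>" using flow[OF assms(1)] by (intro closure_mono) auto
  finally have "exp (- c * of_real x) * w0 \<in> closure \<Omega>" using start by blast
  moreover have "Complex x 0 = of_real x" by (simp add: complex_eq_iff)
  ultimately have "spiral (Complex x 0) \<in> closure \<Omega>" by (simp add: spiral_def mult.commute)
  then show ?thesis
    using spiral_real_notin[OF assms(2)] open_\<Omega> by (simp add: frontier_def interior_open)
qed

text \<open>
  The branch near the point with parameter \<open>x\<close> of the inverse of the spiral coordinate.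
\<close>

definition unspiral :: "real \<Rightarrow> complex \<Rightarrow> complex"
  where "unspiral x w = of_real x - Ln (w / spiral (of_real x)) / c"

lemma spiral_unspiral:
  assumes "w \<noteq> 0"
  shows "spiral (unspiral x w) = w"
proof -
  let ?p = "spiral (of_real x)"
  have "- c * unspiral x w = - c * of_real x + Ln (w / ?p)"
    using c_nz by (simp add: unspiral_def algebra_simps)
  then have "spiral (unspiral x w) = w0 * exp (- c * of_real x + Ln (w / ?p))"
    by (simp only: spiral_def)
  also have "\<dots> = ?p * exp (Ln (w / ?p))" by (simp only: exp_add spiral_def mult.assoc)
  finally have "spiral (unspiral x w) = ?p * exp (Ln (w / ?p))" .
  then show ?thesis using assms by simp
qed

lemma unspiral_spiral:
  assumes "\<bar>y\<bar> * cmod c < pi"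
  shows "unspiral x (spiral (Complex x y)) = Complex x y"
proof -
  have "Complex x y = of_real x + \<i> * of_real y" by (simp add: complex_eq_iff)
  then have "spiral (Complex x y) / spiral (of_real x) = exp (- c * (\<i> * of_real y))"
    using w0_nz by (simp add: spiral_def exp_diff[symmetric] algebra_simps)
  moreover have "Ln (exp (- c * (\<i> * of_real y))) = - c * (\<i> * of_real y)"
  proof (rule Ln_exp)
    have "\<bar>Im (- c * (\<i> * of_real y))\<bar> \<le> cmod (- c * (\<i> * of_real y))" by (rule abs_Im_le_cmod)
    also have "\<dots> = \<bar>y\<bar> * cmod c" by (simp add: norm_mult)
    finally show "- pi < Im (- c * (\<i> * of_real y))" "Im (- c * (\<i> * of_real y)) \<le> pi"
      using assms by (simp_all add: abs_le_iff)
  qed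
  ultimately have "unspiral x (spiral (Complex x y)) = of_real x - - c * (\<i> * of_real y) / c"
    by (simp only: unspiral_def)
  also have "\<dots> = of_real x + \<i> * of_real y" using c_nz by simp
  finally show ?thesis using \<open>Complex x y = of_real x + \<i> * of_real y\<close> by simp
qed

lemma unspiral_continuous_ball:
  "\<exists>d>0. continuous_on (ball (spiral (of_real x)) d) (unspiral x) \<and>
     (\<forall>w\<in>ball (spiral (of_real x)) d. w \<noteq> 0 \<and> cmod (unspiral x w - of_real x) < e)" if e: "e > 0"
proof -
  let ?p = "spiral (of_real x)"
  have np: "w / ?p \<notin> \<real>\<^sub>\<le>\<^sub>0" if "w \<in> ball ?p (cmod ?p)" for w
  proof -
    have "cmod (1 - w / ?p) = cmod (?p - w) / cmod ?p"
      by (simp add: norm_divide[symmetric] diff_divide_distrib)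
    also have "\<dots> < 1" using that by (simp add: dist_norm)
    finally have "\<bar>Re (1 - w / ?p)\<bar> < 1" using abs_Re_le_cmod[of "1 - w / ?p"] by linarith
    then have "Re (w / ?p) > 0" by simp
    then show ?thesis by (auto simp: complex_nonpos_Reals_iff)
  qed
  have cont: "continuous_on (ball ?p (cmod ?p)) (unspiral x)"
    unfolding unspiral_def[abs_def] by (intro continuous_intros np) (use c_nz in auto)
  have "?p \<in> ball ?p (cmod ?p)" by simp
  then have "isCont (unspiral x) ?p"
    using cont by (simp add: continuous_on_eq_continuous_at)
  then obtain d where d: "d > 0" "\<forall>w. dist w ?p < d \<longrightarrow> dist (unspiral x w) (unspiral x ?p) < e"
    using e unfolding continuous_at_eps_delta by blast
  have xp: "unspiral x ?p = of_real x" by (simp add: unspiral_def)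
  show ?thesis
  proof (intro exI[of _ "min d (cmod ?p)"] conjI ballI)
    show "0 < min d (cmod ?p)" using d by simp
    show "continuous_on (ball ?p (min d (cmod ?p))) (unspiral x)"
      by (rule continuous_on_subset[OF cont]) auto
    fix w assume w: "w \<in> ball ?p (min d (cmod ?p))"
    then have "dist (unspiral x w) (of_real x) < e"
      using d(2)[rule_format, of w] by (simp add: xp dist_commute)
    then show "cmod (unspiral x w - of_real x) < e" by (simp only: dist_norm)
    show "w \<noteq> 0" using w by auto
  qed
qed

text \<open>
  Near \<open>w0\<close> there are points of \<open>\<Omega>\<close>; their parameters are not real, because the arc avoids \<open>\<Omega>\<close>, so infinitely
  many of them lie on the same side of the arc, at arbitrarily small heights. The flow moves them to the vertical line through \<open>t / 3\<close>.
\<close>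

lemma side_exists:
  "\<exists>e\<in>{1, -1 :: real}. \<forall>\<delta>>0. \<exists>\<tau>>0. \<tau> < \<delta> \<and> spiral (Complex (t / 3) (e * \<tau>)) \<in> \<Omega>"
proof -
  have near: "\<exists>y. y \<noteq> 0 \<and> \<bar>y\<bar> < \<delta> \<and> spiral (Complex (t / 3) y) \<in> \<Omega>" if \<delta>: "\<delta> > 0" for \<delta>
  proof -
    have "min \<delta> (t / 3) > 0" using \<delta> t_pos by simp
    then obtain d where d: "d > 0" "\<And>w. w \<in> ball (spiral (of_real 0)) d \<Longrightarrow>
        w \<noteq> 0 \<and> cmod (unspiral 0 w - of_real 0) < min \<delta> (t / 3)"
      using unspiral_continuous_ball[of "min \<delta> (t / 3)" 0] by blast
    have "spiral (of_real 0) = w0" by (simp add: spiral_def)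
    with start d(1) obtain w where w: "w \<in> \<Omega>" "dist w (spiral (of_real 0)) < d"
      unfolding closure_approachable by auto
    let ?\<sigma> = "unspiral 0 w"
    have s: "w \<noteq> 0" "cmod ?\<sigma> < min \<delta> (t / 3)" using d(2)[of w] w(2) by (auto simp: dist_commute)
    have in\<Omega>: "spiral (Complex (Re ?\<sigma>) (Im ?\<sigma>)) \<in> \<Omega>" using spiral_unspiral[OF s(1)] w(1) by simp
    have b: "\<bar>Re ?\<sigma>\<bar> < t / 3" "\<bar>Im ?\<sigma>\<bar> < \<delta>"
      using s(2) abs_Re_le_cmod[of ?\<sigma>] abs_Im_le_cmod[of ?\<sigma>] by linarith+
    have "Im ?\<sigma> \<noteq> 0"
    proof
      assume "Im ?\<sigma> = 0"
      with in\<Omega> have "spiral (Complex (Re ?\<sigma>) 0) \<in> \<Omega>" by simp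
      then show False using spiral_real_notin[of "Re ?\<sigma>"] b t_pos by simp
    qed
    moreover have "spiral (Complex (t / 3) (Im ?\<sigma>)) \<in> \<Omega>"
      by (rule spiral_flow[OF in\<Omega>]) (use b in simp)
    ultimately show ?thesis using b by blast
  qed
  show ?thesis
  proof (cases "\<forall>\<delta>>0. \<exists>\<tau>>0. \<tau> < \<delta> \<and> spiral (Complex (t / 3) (1 * \<tau>)) \<in> \<Omega>")
    case False
    then obtain \<delta>1 where \<delta>1: "\<delta>1 > 0" "\<And>\<tau>. \<tau> > 0 \<Longrightarrow> \<tau> < \<delta>1 \<Longrightarrow> spiral (Complex (t / 3) \<tau>) \<notin> \<Omega>" by auto
    have "\<exists>\<tau>>0. \<tau> < \<delta> \<and> spiral (Complex (t / 3) ((-1) * \<tau>)) \<in> \<Omega>" if \<delta>: "\<delta> > 0" for \<delta>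
    proof -
      obtain y where y: "y \<noteq> 0" "\<bar>y\<bar> < min \<delta> \<delta>1" "spiral (Complex (t / 3) y) \<in> \<Omega>"
        using near[of "min \<delta> \<delta>1"] \<delta> \<delta>1(1) by auto
      have "y < 0" using y \<delta>1(2)[of y] by (cases "y > 0") auto
      then show ?thesis using y by (intro exI[of _ "- y"]) auto
    qed
    then show ?thesis by blast
  qed blast
qed

text \<open>
  This is where local connectedness enters. If the point at distance \<open>\<tau>1\<close> from \<open>t / 2\<close> on the chosen side were outside \<open>\<Omega>\<close>, then
  some boundary point at a distance \<open>\<tau>2 > 0\<close> from the arc would be joined to the arc by a connected part \<open>V\<close> of the boundary
  with parameters to the right of \<open>t / 3\<close>. Such a part crosses the horizontal line at every distance \<open>\<tau>3 < \<tau>2\<close>, but for some of them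
  that line lies, to the right of \<open>t / 3\<close>, in \<open>\<Omega>\<close>.
\<close>

lemma one_sided_box:
  assumes lc: "locally connected (frontier \<Omega>)"
  shows "\<exists>e\<in>{1, -1 :: real}. \<exists>\<epsilon>>0. \<forall>x \<tau>. t / 2 \<le> x \<and> 0 < \<tau> \<and> \<tau> < \<epsilon> \<longrightarrow> spiral (Complex x (e * \<tau>)) \<in> \<Omega>"
proof -
  obtain e :: real where e: "e = 1 \<or> e = -1"
    and near: "\<And>\<delta>. \<delta> > 0 \<Longrightarrow> \<exists>\<tau>>0. \<tau> < \<delta> \<and> spiral (Complex (t / 3) (e * \<tau>)) \<in> \<Omega>"
    using side_exists by blast
  have ee: "e * (e * y) = y" "\<bar>e * y\<bar> = \<bar>y\<bar>" for y using e by auto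
  define p where "p = spiral (of_real (t / 2))"
  have p_eq: "p = spiral (Complex (t / 2) 0)" unfolding p_def by (simp add: complex_of_real_def)
  have p: "p \<in> frontier \<Omega>" unfolding p_eq by (rule spiral_real_frontier) (use t_pos in auto)
  obtain d where d: "d > 0" "continuous_on (ball p d) (unspiral (t / 2))"
    "\<And>w. w \<in> ball p d \<Longrightarrow> w \<noteq> 0 \<and> cmod (unspiral (t / 2) w - of_real (t / 2)) < t / 6"
    using unspiral_continuous_ball[of "t / 6" "t / 2"] t_pos unfolding p_def[symmetric] by auto
  have "openin (top_of_set (frontier \<Omega>)) (frontier \<Omega> \<inter> ball p d)" by (simp add: openin_open_Int)
  moreover have "p \<in> frontier \<Omega> \<inter> ball p d" using p d by simp
  ultimately obtain U V where U: "openin (top_of_set (frontier \<Omega>)) U" "p \<in> U" "U \<subseteq> V"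
    and V: "connected V" "V \<subseteq> frontier \<Omega> \<inter> ball p d"
    using lc by (elim locallyE) blast
  obtain \<rho> where \<rho>: "\<rho> > 0" "ball p \<rho> \<inter> frontier \<Omega> \<subseteq> U"
    using U(1,2) unfolding openin_contains_ball by blast
  have "isCont (\<lambda>y. spiral (Complex (t / 2) y)) 0"
    unfolding spiral_def Complex_eq by (intro continuous_intros)
  then obtain \<epsilon>1 where \<epsilon>1: "\<epsilon>1 > 0" "\<And>y. \<bar>y\<bar> < \<epsilon>1 \<Longrightarrow> dist (spiral (Complex (t / 2) y)) p < \<rho>"
    using \<rho>(1) unfolding continuous_at_eps_delta p_eq by (metis dist_real_def diff_zero)
  \<comment> \<open>the second bound keeps the parameters in the range of the logarithm\<close>
  define \<epsilon> where "\<epsilon> = min \<epsilon>1 (pi / cmod c)"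
  have \<epsilon>: "\<epsilon> > 0" using \<epsilon>1 c_nz by (simp add: \<epsilon>_def)
  have inside: "spiral (Complex (t / 2) (e * \<tau>1)) \<in> \<Omega>" if \<tau>1: "0 < \<tau>1" "\<tau>1 < \<epsilon>" for \<tau>1
  proof (rule ccontr)
    assume out: "spiral (Complex (t / 2) (e * \<tau>1)) \<notin> \<Omega>"
    obtain \<tau>' where \<tau>': "0 < \<tau>'" "\<tau>' < \<tau>1" "spiral (Complex (t / 3) (e * \<tau>')) \<in> \<Omega>"
      using near[OF \<tau>1(1)] by blast
    have in': "spiral (Complex (t / 2) (e * \<tau>')) \<in> \<Omega>" by (rule spiral_flow[OF \<tau>'(3)]) (use t_pos in simp)
    let ?g = "\<lambda>\<tau>. spiral (Complex (t / 2) (e * \<tau>))"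
    have "continuous_on {\<tau>'..\<tau>1} ?g"
      unfolding spiral_def Complex_eq by (intro continuous_intros)
    then have "connected (?g ` {\<tau>'..\<tau>1})" by (rule connected_continuous_image) simp
    moreover have "?g \<tau>' \<in> ?g ` {\<tau>'..\<tau>1}" "?g \<tau>1 \<in> ?g ` {\<tau>'..\<tau>1}" using \<tau>' by auto
    then have "?g ` {\<tau>'..\<tau>1} \<inter> \<Omega> \<noteq> {}" "?g ` {\<tau>'..\<tau>1} - \<Omega> \<noteq> {}" using in' out by blast+
    ultimately have "?g ` {\<tau>'..\<tau>1} \<inter> frontier \<Omega> \<noteq> {}" by (rule connected_Int_frontier)
    then obtain \<tau>2 where \<tau>2: "\<tau>' \<le> \<tau>2" "\<tau>2 \<le> \<tau>1" "?g \<tau>2 \<in> frontier \<Omega>" by auto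
    have "dist (?g \<tau>2) p < \<rho>" by (rule \<epsilon>1(2)) (use \<tau>2 \<tau>' \<tau>1 in \<open>simp add: ee \<epsilon>_def\<close>)
    then have q: "?g \<tau>2 \<in> V" using \<rho>(2) \<tau>2(3) U(3) by (auto simp: dist_commute)
    have "\<tau>2 < pi / cmod c" using \<tau>2 \<tau>1 by (simp add: \<epsilon>_def)
    then have "\<bar>e * \<tau>2\<bar> * cmod c < pi" using c_nz \<tau>2 \<tau>' by (simp add: ee pos_less_divide_eq)
    then have kq: "unspiral (t / 2) (?g \<tau>2) = Complex (t / 2) (e * \<tau>2)" by (rule unspiral_spiral)
    have kp: "unspiral (t / 2) p = Complex (t / 2) 0" unfolding p_eq by (rule unspiral_spiral) simp
    define k where "k w = e * Im (unspiral (t / 2) w)" for w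
    have "continuous_on V (unspiral (t / 2))" by (rule continuous_on_subset[OF d(2)]) (use V(2) in blast)
    then have "continuous_on V k" unfolding k_def[abs_def] by (intro continuous_intros)
    then have "connected (k ` V)" using V(1) by (rule connected_continuous_image)
    moreover have "0 \<in> k ` V" using U(2,3) kp by (intro image_eqI[of _ _ p]) (auto simp: k_def)
    moreover have "\<tau>2 \<in> k ` V" using q kq by (intro image_eqI[of _ _ "?g \<tau>2"]) (auto simp: k_def ee)
    ultimately have Icc: "{0..\<tau>2} \<subseteq> k ` V" by (rule connected_contains_Icc)
    obtain \<tau>3 where \<tau>3: "0 < \<tau>3" "\<tau>3 < \<tau>2" "spiral (Complex (t / 3) (e * \<tau>3)) \<in> \<Omega>"
      using near[of \<tau>2] \<tau>2 \<tau>' by auto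
    have "\<tau>3 \<in> k ` V" using Icc \<tau>3 by auto
    then obtain v where v: "v \<in> V" "k v = \<tau>3" by blast
    let ?\<sigma> = "unspiral (t / 2) v"
    have "v \<in> frontier \<Omega>" and vd: "v \<in> ball p d" using v(1) V(2) by auto
    then have v': "v \<in> frontier \<Omega>" "v \<noteq> 0" "cmod (?\<sigma> - of_real (t / 2)) < t / 6"
      using d(3)[OF vd] by blast+
    have "\<bar>Re (?\<sigma> - of_real (t / 2))\<bar> < t / 6" using v'(3) abs_Re_le_cmod[of "?\<sigma> - of_real (t / 2)"] by linarith
    moreover have "Re (?\<sigma> - of_real (t / 2)) = Re ?\<sigma> - t / 2" by simp
    ultimately have Re: "t / 3 \<le> Re ?\<sigma>" by linarith
    have "Im ?\<sigma> = e * \<tau>3" using v(2) ee(1)[of "Im ?\<sigma>"] by (simp add: k_def)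
    then have "?\<sigma> = Complex (Re ?\<sigma>) (e * \<tau>3)" by (simp add: complex_eq_iff)
    moreover have "spiral (Complex (Re ?\<sigma>) (e * \<tau>3)) \<in> \<Omega>" by (rule spiral_flow[OF \<tau>3(3) Re])
    ultimately have "v \<in> \<Omega>" using spiral_unspiral[OF v'(2), of "t / 2"] by simp
    then show False using v'(1) open_\<Omega> by (simp add: frontier_def interior_open)
  qed
  have "spiral (Complex x (e * \<tau>)) \<in> \<Omega>" if "t / 2 \<le> x" "0 < \<tau>" "\<tau> < \<epsilon>" for x \<tau>
    by (rule spiral_flow[OF inside]) (use that in auto)
  then show ?thesis using e \<epsilon> by blast
qed

text \<open>
  The coordinate function on the box, \<open>f = h\<^sup>-\<^sup>1\<close> of the spiral, has modulus tending to \<open>1\<close> at the edge, because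
  the compact sets \<open>h(|z| \<le> 1 - \<eta>)\<close> have positive distance from the arc. The points \<open>z n\<close> are the
  values of \<open>f\<close> above \<open>x1\<close> (or their conjugates), and the flow during the time \<open>x2 - x1\<close> takes them to the values above \<open>x2\<close>.
\<close>

lemma contact_along_flow:
  assumes lc: "locally connected (frontier \<Omega>)"
    and hol: "h holomorphic_on unit_disc" and bij: "bij_betw h unit_disc \<Omega>" and h0: "h 0 = 0"
  shows "\<exists>s>0. \<exists>C z. (\<forall>n. z n \<in> unit_disc) \<and> (\<lambda>n. cmod (z n)) \<longlonglongrightarrow> 1 \<and>
     (\<forall>n. 1 - cmod (inv_into unit_disc h (exp (- c * of_real s) * h (z n))) \<le> C * (1 - cmod (z n)))"
proof -
  have inj: "inj_on h unit_disc" and img: "h ` unit_disc = \<Omega>" using bij by (auto simp: bij_betw_def)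
  define G where "G = inv_into unit_disc h"
  have Gh: "G (h z) = z" if "z \<in> unit_disc" for z using inj that by (simp add: G_def)
  have hG: "h (G w) = w" and Gd: "G w \<in> unit_disc" if "w \<in> \<Omega>" for w
    using that img unfolding G_def by (metis f_inv_into_f, metis inv_into_into)
  have holG: "G holomorphic_on \<Omega>"
  proof -
    obtain g where g: "g holomorphic_on h ` unit_disc" "\<And>z. z \<in> unit_disc \<Longrightarrow> g (h z) = z"
      using holomorphic_has_inverse[OF hol open_ball inj] by metis
    have "G w = g w" if "w \<in> \<Omega>" for w using g(2)[OF Gd[OF that]] hG[OF that] by simp
    then show ?thesis using g(1) unfolding img by (metis holomorphic_cong)
  qed
  obtain e :: real and b where e: "e = 1 \<or> e = -1" and b: "b > 0"
    and box: "\<And>x \<tau>. t / 2 \<le> x \<Longrightarrow> 0 < \<tau> \<Longrightarrow> \<tau> < b \<Longrightarrow> spiral (Complex x (e * \<tau>)) \<in> \<Omega>"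
    using one_sided_box[OF lc] by blast
  define E where "E \<sigma> = spiral (Complex (Re \<sigma>) (e * Im \<sigma>))" for \<sigma>
  let ?Q = "edge_box (t / 2) t b"
  have EQ: "E \<sigma> \<in> \<Omega>" if "\<sigma> \<in> ?Q" for \<sigma> using that unfolding E_def by (intro box) auto
  \<comment> \<open>a box below the edge (\<open>e = -1\<close>) is reflected into the upper half-plane; conjugating the value as well keeps \<open>f\<close> holomorphic\<close>
  define f where "f = (if e = 1 then (\<lambda>\<sigma>. G (spiral \<sigma>)) else (\<lambda>\<sigma>. cnj (G (spiral (cnj \<sigma>)))))"
  have cf: "cmod (f \<sigma>) = cmod (G (E \<sigma>))" for \<sigma>
    using e by (auto simp: f_def E_def complex_cnj[symmetric] simp del: complex_cnj)
  have holS: "(\<lambda>\<sigma>. G (spiral \<sigma>)) holomorphic_on A" if "spiral ` A \<subseteq> \<Omega>" for A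
    by (rule holomorphic_on_compose_gen[OF _ holG, unfolded o_def])
       (use that in \<open>auto simp: spiral_def[abs_def] intro!: holomorphic_intros\<close>)
  have holf: "f holomorphic_on ?Q"
  proof (cases "e = 1")
    case True
    then show ?thesis using EQ by (auto simp: f_def E_def intro!: holS)
  next
    case False
    then have e': "e = -1" using e by simp
    have "(cnj \<circ> (\<lambda>\<sigma>. G (spiral \<sigma>)) \<circ> cnj) holomorphic_on ?Q"
    proof (rule holomorphic_on_compose_cnj_cnj)
      show "(\<lambda>\<sigma>. G (spiral \<sigma>)) holomorphic_on cnj ` ?Q"
        using EQ e' by (intro holS) (auto simp: E_def complex_cnj[symmetric] simp del: complex_cnj)
      have "?Q = {z. t / 2 < Re z} \<inter> {z. Re z < t} \<inter> {z. 0 < Im z} \<inter> {z. Im z < b}" by auto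
      then show "open ?Q"
        by (simp only:) (intro open_Int open_halfspace_Re_gt open_halfspace_Re_lt open_halfspace_Im_gt open_halfspace_Im_lt)
    qed
    then show ?thesis using False by (simp add: f_def o_def)
  qed
  have contE: "continuous_on A E" for A
    unfolding E_def[abs_def] spiral_def Complex_eq by (intro continuous_intros)
  define B where "B = cbox (Complex (t / 2) 0) (Complex t b)"
  have B: "compact B" "\<And>\<sigma>. \<sigma> \<in> B \<longleftrightarrow> t / 2 \<le> Re \<sigma> \<and> Re \<sigma> \<le> t \<and> 0 \<le> Im \<sigma> \<and> Im \<sigma> \<le> b"
    unfolding B_def in_cbox_complex_iff by auto
  have QB: "?Q \<subseteq> B" by (rule subsetI) (simp add: B(2))
  obtain m where m: "m > 0" "\<And>\<sigma>. \<sigma> \<in> ?Q \<Longrightarrow> m \<le> cmod (f \<sigma>)"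
  proof -
    have "E ` B \<noteq> {}" using B(2)[of "Complex t 0"] t_pos b by auto
    moreover have "compact (E ` B)" by (intro compact_continuous_image contE B)
    moreover have "0 \<notin> E ` B" by (auto simp: E_def spiral_nz[symmetric])
    ultimately obtain \<mu> where \<mu>: "\<mu> > 0" "\<And>w. w \<in> E ` B \<Longrightarrow> \<mu> \<le> dist 0 w"
      using separate_point_closed[of "E ` B" 0] compact_imp_closed by metis
    have "isCont h 0" using hol holomorphic_on_imp_continuous_on
      by (metis centre_in_ball continuous_on_interior interior_ball zero_less_one)
    then obtain m where m: "m > 0" "\<And>z. dist z 0 < m \<Longrightarrow> dist (h z) (h 0) < \<mu>"
      using \<mu>(1) unfolding continuous_at_eps_delta by metis
    have "m \<le> cmod (f \<sigma>)" if "\<sigma> \<in> ?Q" for \<sigma>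
    proof (rule ccontr)
      assume "\<not> ?thesis"
      then have "dist (h (G (E \<sigma>))) (h 0) < \<mu>" by (intro m) (simp add: cf)
      then show False using \<mu>(2)[of "E \<sigma>"] hG[OF EQ[OF that]] QB that by (auto simp: h0)
    qed
    then show thesis using m(1) that by blast
  qed
  have edge: "\<exists>\<delta>>0. \<forall>\<sigma>\<in>?Q. Im \<sigma> < \<delta> \<longrightarrow> 1 - \<eta> \<le> cmod (f \<sigma>)" if \<eta>: "0 < \<eta>" "\<eta> < 1" for \<eta>
  proof -
    define K where "K = h ` cball 0 (1 - \<eta>)"
    have sub: "cball 0 (1 - \<eta>) \<subseteq> unit_disc" using \<eta> by auto
    have "compact K" unfolding K_def
      by (intro compact_continuous_image compact_cball continuous_on_subset[OF holomorphic_on_imp_continuous_on[OF hol] sub])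
    define S where "S = (\<lambda>x. E (of_real x)) ` {t / 2..t}"
    have "continuous_on {t / 2..t} (\<lambda>x. E (of_real x))"
      by (rule continuous_on_compose2[OF contE[of UNIV]]) (auto intro!: continuous_intros)
    then have "compact S" unfolding S_def by (rule compact_continuous_image) simp
    have "K \<inter> S = {}"
    proof -
      have "K \<subseteq> \<Omega>" using sub img by (auto simp: K_def)
      moreover have "E (of_real x) \<notin> \<Omega>" if "x \<in> {t / 2..t}" for x
        using spiral_real_notin[of x] that by (simp add: E_def)
      ultimately show ?thesis by (auto simp: S_def)
    qed
    then obtain \<mu> where \<mu>: "\<mu> > 0" "\<And>x y. x \<in> K \<Longrightarrow> y \<in> S \<Longrightarrow> \<mu> \<le> dist x y"
      using separate_compact_closed[OF \<open>compact K\<close> compact_imp_closed[OF \<open>compact S\<close>]] by metis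
    have "uniformly_continuous_on B E" by (intro compact_uniformly_continuous contE B)
    then obtain \<delta> where \<delta>: "\<delta> > 0" "\<And>x y. x \<in> B \<Longrightarrow> y \<in> B \<Longrightarrow> dist y x < \<delta> \<Longrightarrow> dist (E y) (E x) < \<mu>"
      using \<mu>(1) unfolding uniformly_continuous_on_def by metis
    have "1 - \<eta> \<le> cmod (f \<sigma>)" if \<sigma>: "\<sigma> \<in> ?Q" "Im \<sigma> < \<delta>" for \<sigma>
    proof (rule ccontr)
      assume "\<not> ?thesis"
      then have "G (E \<sigma>) \<in> cball 0 (1 - \<eta>)" by (simp add: cf)
      then have "E \<sigma> \<in> K" using hG[OF EQ[OF \<sigma>(1)]] unfolding K_def by (metis image_eqI)
      moreover have "E (of_real (Re \<sigma>)) \<in> S" using \<sigma>(1) unfolding S_def by (intro imageI) auto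
      ultimately have "\<mu> \<le> dist (E \<sigma>) (E (of_real (Re \<sigma>)))" by (rule \<mu>(2))
      moreover have "dist (E \<sigma>) (E (of_real (Re \<sigma>))) < \<mu>"
      proof (rule \<delta>(2))
        show "of_real (Re \<sigma>) \<in> B" "\<sigma> \<in> B" using \<sigma>(1) b by (auto simp: B(2))
        have "\<sigma> - of_real (Re \<sigma>) = \<i> * of_real (Im \<sigma>)" by (simp add: complex_eq_iff)
        then have "dist \<sigma> (of_real (Re \<sigma>)) = \<bar>Im \<sigma>\<bar>" by (simp add: dist_norm norm_mult)
        then show "dist \<sigma> (of_real (Re \<sigma>)) < \<delta>" using \<sigma> by simp
      qed
      ultimately show False by simp
    qed
    then show ?thesis using \<delta>(1) by blast
  qed
  define x1 x2 where "x1 = 2 * t / 3" and "x2 = 5 * t / 6"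
  have x: "t / 2 < x1" "x1 < t" "t / 2 < x2" "x2 < t" "x1 < x2" using t_pos by (auto simp: x1_def x2_def)
  have f1: "cmod (f \<sigma>) < 1" if "\<sigma> \<in> ?Q" for \<sigma> using Gd[OF EQ[OF that]] by (simp add: cf)
  obtain C \<rho> where \<rho>: "\<rho> > 0"
    and C: "\<And>\<tau>. 0 < \<tau> \<Longrightarrow> \<tau> < \<rho> \<Longrightarrow> 1 - cmod (f (Complex x2 \<tau>)) \<le> C * (1 - cmod (f (Complex x1 \<tau>)))"
    using comparable_contact_along_edge[OF holf f1 m edge x(1,2) x(3,4) b] by blast
  define r where "r = min \<rho> b"
  have r: "r > 0" using \<rho> b by (simp add: r_def)
  \<comment> \<open>any sequence of heights in \<open>(0, r)\<close> that tends to \<open>0\<close>\<close>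
  define \<tau> where "\<tau> n = r / (real n + 2)" for n :: nat
  have \<tau>: "0 < \<tau> n" "\<tau> n < r" for n
    using r mult_strict_left_mono[of 1 "real n + 2" r] by (simp_all add: \<tau>_def divide_less_eq)
  have \<tau>0: "\<tau> \<longlonglongrightarrow> 0" unfolding \<tau>_def by real_asymp
  define z where "z n = G (E (Complex x1 (\<tau> n)))" for n
  have inQ: "Complex x1 (\<tau> n) \<in> ?Q" "Complex x2 (\<tau> n) \<in> ?Q" for n using x \<tau>[of n] by (auto simp: r_def)
  have zd: "z n \<in> unit_disc" for n unfolding z_def by (intro Gd EQ inQ)
  have "(\<lambda>n. cmod (z n)) \<longlonglongrightarrow> 1"
  proof (rule LIMSEQ_I)
    fix \<eta> :: real assume "\<eta> > 0"
    define \<eta>' where "\<eta>' = min \<eta> 1 / 2"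
    have \<eta>': "0 < \<eta>'" "\<eta>' < 1" "\<eta>' < \<eta>" using \<open>\<eta> > 0\<close> by (auto simp: \<eta>'_def)
    obtain \<delta> where \<delta>: "\<delta> > 0" "\<And>\<sigma>. \<sigma> \<in> ?Q \<Longrightarrow> Im \<sigma> < \<delta> \<Longrightarrow> 1 - \<eta>' \<le> cmod (f \<sigma>)"
      using edge[OF \<eta>'(1,2)] by blast
    have "\<forall>\<^sub>F n in sequentially. \<tau> n < \<delta>" using \<tau>0 \<delta>(1) by (rule order_tendstoD)
    then have "\<forall>\<^sub>F n in sequentially. norm (cmod (z n) - 1) < \<eta>"
    proof eventually_elim
      case (elim n)
      have "1 - \<eta>' \<le> cmod (z n)" using \<delta>(2)[OF inQ(1), of n] elim by (simp add: cf z_def)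
      then show ?case using zd[of n] \<eta>' by simp
    qed
    then show "\<exists>N. \<forall>n\<ge>N. norm (cmod (z n) - 1) < \<eta>" by (simp add: eventually_sequentially)
  qed
  moreover have "1 - cmod (inv_into unit_disc h (exp (- c * of_real (x2 - x1)) * h (z n))) \<le> C * (1 - cmod (z n))" for n
  proof -
    have "Complex x2 (e * \<tau> n) = Complex x1 (e * \<tau> n) + of_real (x2 - x1)" by (simp add: complex_eq_iff)
    then have "E (Complex x2 (\<tau> n)) = exp (- c * of_real (x2 - x1)) * h (z n)"
      using hG[OF EQ[OF inQ(1)], of n] by (simp only: E_def complex.sel spiral_add z_def)
    then have "inv_into unit_disc h (exp (- c * of_real (x2 - x1)) * h (z n)) = G (E (Complex x2 (\<tau> n)))"
      by (simp add: G_def)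
    moreover have "\<tau> n < \<rho>" using \<tau>[of n] by (simp add: r_def)
    ultimately show ?thesis using C[OF \<tau>(1)] by (simp add: cf z_def)
  qed
  ultimately show ?thesis using x zd by (intro exI[of _ "x2 - x1"]) auto
qed

end

section \<open>Spreading of the bound from one time to all times\<close>

lemma sup_norm_less_one_iff:
  assumes self: "\<phi> ` unit_disc \<subseteq> unit_disc"
  shows "sup_norm \<phi> < 1 \<longleftrightarrow> (\<exists>r<1. \<forall>z\<in>unit_disc. cmod (\<phi> z) \<le> r)"
proof
  have bdd: "bdd_above ((\<lambda>z. cmod (\<phi> z)) ` unit_disc)"
    using self by (intro bdd_aboveI[of _ 1]) (auto simp: image_subset_iff less_imp_le)
  assume "sup_norm \<phi> < 1"
  moreover have "cmod (\<phi> z) \<le> sup_norm \<phi>" if "z \<in> unit_disc" for z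
    unfolding sup_norm_def by (rule cSUP_upper[OF that bdd])
  ultimately show "\<exists>r<1. \<forall>z\<in>unit_disc. cmod (\<phi> z) \<le> r" by blast
next
  assume "\<exists>r<1. \<forall>z\<in>unit_disc. cmod (\<phi> z) \<le> r"
  then obtain r where "r < 1" and r: "\<And>z. z \<in> unit_disc \<Longrightarrow> cmod (\<phi> z) \<le> r" by blast
  have "sup_norm \<phi> \<le> r" unfolding sup_norm_def by (rule cSUP_least) (use r in auto)
  with \<open>r < 1\<close> show "sup_norm \<phi> < 1" by simp
qed

lemma weight_mono: "\<omega> = hardy_weight \<or> \<omega> = dirichlet_weight \<Longrightarrow> mono \<omega>"
  by (auto simp: mono_def hardy_weight_def dirichlet_weight_def)

text \<open>
  The reproducing kernels of both spaces have unbounded norms at the circle.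
\<close>

lemma weight_inverse_not_summable:
  assumes "\<omega> = hardy_weight \<or> \<omega> = dirichlet_weight"
  shows "\<not> summable (\<lambda>n. 1 / \<omega> n)"
proof
  assume sm: "summable (\<lambda>n. 1 / \<omega> n)"
  show False
  proof (cases "\<omega> = hardy_weight")
    case True
    with sm show False by (simp add: hardy_weight_def[abs_def] summable_const_iff)
  next
    case False
    with assms have "1 / \<omega> (Suc n) = inverse (real (Suc n))" for n
      by (simp add: dirichlet_weight_def inverse_eq_divide)
    with sm have "summable (\<lambda>n. inverse (real (Suc n)))"
      by (subst (asm) summable_Suc_iff[symmetric]) simp
    then show False using not_summable_harmonic[where 'a=real] summable_Suc_iff[of "\<lambda>n. inverse (real n)"] by simp
  qed
qed

lemma compact_subset_disc_radius:
  assumes "compact K" "K \<subseteq> unit_disc"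
  shows "\<exists>r<1. \<forall>z\<in>K. cmod z \<le> r"
proof (cases "K = {}")
  case False
  obtain z where "z \<in> K" "\<forall>y\<in>K. cmod y \<le> cmod z"
    using continuous_attains_sup[OF assms(1) False, of cmod] continuous_on_norm_id by blast
  then show ?thesis using assms(2) by (intro exI[of _ "cmod z"]) auto
qed (auto intro: exI[of _ 0])

text \<open>
  If the bound failed at \<open>t\<close>, the orbit of some point of the closure of \<open>\<Omega>\<close> would stay on the boundary until time \<open>t\<close>,
  and contact along the flow would contradict compactness. Otherwise the image of \<open>\<phi>\<^sub>t\<close> lies in the continuous image of
  the compact closure of \<open>\<Omega>\<close>.
\<close>

lemma semiflow_model_sup_norm_spreads:
  assumes \<omega>: "\<omega> = hardy_weight \<or> \<omega> = dirichlet_weight"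
    and flow: "semiflow \<phi>"
    and cpt: "immediately_compact \<omega> (\<lambda>t. composition_op (\<phi> t))"
    and model: "semiflow_model \<phi> \<alpha> c h \<Omega>"
    and lc: "locally connected (frontier \<Omega>)"
    and t0: "t0 > 0" "sup_norm (\<phi> t0) < 1" and t: "t > 0"
  shows "sup_norm (\<phi> t) < 1"
proof -
  let ?b = "disc_involution \<alpha>"
  have \<alpha>: "cmod \<alpha> < 1" and op: "open \<Omega>" and conn: "connected \<Omega>"
    and hol: "h holomorphic_on unit_disc" and bij: "bij_betw h unit_disc \<Omega>" and h0: "h 0 = 0"
    and star: "\<And>s w. 0 \<le> s \<Longrightarrow> w \<in> \<Omega> \<Longrightarrow> exp (- c * of_real s) * w \<in> \<Omega>"
    and conj: "\<And>s z. 0 \<le> s \<Longrightarrow> z \<in> unit_disc \<Longrightarrow>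
        ?b (\<phi> s (?b z)) = inv_into unit_disc h (exp (- c * of_real s) * h z)"
    using model by (auto simp: semiflow_model_def)
  have self: "\<phi> s ` unit_disc \<subseteq> unit_disc" if "0 \<le> s" for s using flow that by (auto simp: semiflow_def)
  have maps: "\<phi> s z \<in> unit_disc" if "0 \<le> s" "z \<in> unit_disc" for s z
    using self[OF that(1)] that(2) by blast
  have b_in: "?b z \<in> unit_disc" and bb: "?b (?b z) = z" if "z \<in> unit_disc" for z
    using disc_involution_in_disc[OF \<alpha>] disc_involution_involutive[OF \<alpha>] that by auto
  have inj: "inj_on h unit_disc" and img: "h ` unit_disc = \<Omega>" using bij by (auto simp: bij_betw_def)
  have conth: "continuous_on A h" if "A \<subseteq> unit_disc" for A
    using holomorphic_on_imp_continuous_on[OF hol] that by (rule continuous_on_subset)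
  have contb: "continuous_on A ?b" if "A \<subseteq> unit_disc" for A
    using holomorphic_on_imp_continuous_on[OF disc_involution_holomorphic[OF \<alpha>]] that by (rule continuous_on_subset)
  have psi: "h (?b (\<phi> s (?b z))) = exp (- c * of_real s) * h z" if "0 \<le> s" "z \<in> unit_disc" for s z
  proof -
    have "h z \<in> \<Omega>" using img that(2) by blast
    then have "exp (- c * of_real s) * h z \<in> h ` unit_disc" unfolding img by (rule star[OF that(1)])
    then show ?thesis unfolding conj[OF that] by (rule f_inv_into_f)
  qed
  have "0 \<in> \<Omega>" using img h0 by force
  \<comment> \<open>the hypothesis at \<open>t0\<close> makes \<open>exp (- c t0) closure \<Omega>\<close> a compact subset of \<open>\<Omega>\<close>\<close>
  obtain r0 where r0: "r0 < 1" "\<And>z. z \<in> unit_disc \<Longrightarrow> cmod (\<phi> t0 z) \<le> r0"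
    using t0 sup_norm_less_one_iff[OF self, of t0] by auto
  define K where "K = h ` ?b ` cball 0 r0"
  have sub: "cball 0 r0 \<subseteq> unit_disc" using r0(1) by auto
  have sub': "?b ` cball 0 r0 \<subseteq> unit_disc" using sub b_in by blast
  have K: "compact K" "K \<subseteq> \<Omega>"
    unfolding K_def using sub' img by (auto intro!: compact_continuous_image conth contb sub)
  have in_K: "exp (- c * of_real t0) * w \<in> K" if w: "w \<in> \<Omega>" for w
  proof -
    obtain z where z: "z \<in> unit_disc" "w = h z" using w img by blast
    have "\<phi> t0 (?b z) \<in> cball 0 r0" using r0(2)[OF b_in[OF z(1)]] by simp
    then show ?thesis unfolding K_def using psi[of t0 z] t0 z by (metis image_eqI less_imp_le)
  qed
  have cl_K: "exp (- c * of_real t0) * w \<in> K" if "w \<in> closure \<Omega>" for w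
  proof -
    have "(\<lambda>w. exp (- c * of_real t0) * w) ` closure \<Omega> \<subseteq> K"
      by (rule image_closure_subset) (use in_K compact_imp_closed[OF K(1)] in \<open>auto intro!: continuous_intros\<close>)
    then show ?thesis using that by blast
  qed
  have cpt_cl: "compact (closure \<Omega>)"
  proof -
    have "(\<lambda>w. exp (c * of_real t0) * w) ` K \<supseteq> closure \<Omega>"
    proof
      fix w assume "w \<in> closure \<Omega>"
      moreover have "w = exp (c * of_real t0) * (exp (- c * of_real t0) * w)"
        by (simp add: mult.assoc[symmetric] exp_add[symmetric])
      ultimately show "w \<in> (\<lambda>w. exp (c * of_real t0) * w) ` K" using cl_K by blast
    qed
    moreover have "bounded ((\<lambda>w. exp (c * of_real t0) * w) ` K)"
      by (intro compact_imp_bounded compact_continuous_image K continuous_intros)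
    ultimately have "bounded \<Omega>" by (meson bounded_subset closure_subset)
    then show ?thesis by (simp add: compact_closure)
  qed
  have c_nz: "c \<noteq> 0"
  proof
    assume "c = 0"
    then have "closure \<Omega> \<subseteq> \<Omega>" using cl_K K(2) by auto
    then have "closed \<Omega>" by (metis closure_subset closed_closure subset_antisym)
    then have "\<Omega> = UNIV" using op \<open>0 \<in> \<Omega>\<close> clopen[of \<Omega>] by auto
    then show False using cpt_cl by (simp add: not_compact_UNIV)
  qed
  have main: "exp (- c * of_real t) * w \<in> \<Omega>" if w: "w \<in> closure \<Omega>" for w
  proof (rule ccontr)
    assume out: "exp (- c * of_real t) * w \<notin> \<Omega>"
    then have "w \<noteq> 0" using \<open>0 \<in> \<Omega>\<close> by auto
    then interpret spiral_boundary_arc \<Omega> c w t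
      using op star c_nz t w out by unfold_locales auto
    obtain s C z where s: "s > 0" and z: "\<And>n. z n \<in> unit_disc" "(\<lambda>n. cmod (z n)) \<longlonglongrightarrow> 1"
      and C: "\<And>n. 1 - cmod (inv_into unit_disc h (exp (- c * of_real s) * h (z n))) \<le> C * (1 - cmod (z n))"
      using contact_along_flow[OF lc hol bij h0] by blast
    define u where "u n = ?b (z n)" for n
    define D where "D = 4 / (1 - cmod \<alpha>)"
    have D: "D > 0" using \<alpha> by (simp add: D_def)
    have u: "u n \<in> unit_disc" for n unfolding u_def by (rule b_in[OF z(1)])
    have bu: "?b (u n) = z n" for n unfolding u_def by (rule bb[OF z(1)])
    have u_z: "1 - cmod (u n) \<le> D * (1 - cmod (z n))" and z_u: "1 - cmod (z n) \<le> D * (1 - cmod (u n))" for n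
      using disc_involution_contact[OF \<alpha>, of "z n"] disc_involution_contact[OF \<alpha>, of "u n"] z(1)[of n] u[of n] bu[of n]
      by (simp_all add: u_def D_def)
    have "(\<lambda>n. cmod (u n)) \<longlonglongrightarrow> 1"
    proof (rule tendsto_sandwich)
      have "(\<lambda>n. 1 - D * (1 - cmod (z n))) \<longlonglongrightarrow> 1 - D * (1 - 1)" by (intro tendsto_intros z)
      then show "(\<lambda>n. 1 - D * (1 - cmod (z n))) \<longlonglongrightarrow> 1" by simp
      have "1 - D * (1 - cmod (z n)) \<le> cmod (u n)" for n using u_z[of n] by linarith
      then show "\<forall>\<^sub>F n in sequentially. 1 - D * (1 - cmod (z n)) \<le> cmod (u n)" by simp
      show "\<forall>\<^sub>F n in sequentially. cmod (u n) \<le> 1" using u by (simp add: less_imp_le)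
    qed simp
    moreover have "1 - cmod (\<phi> s (u n)) \<le> (D * (\<bar>C\<bar> * D)) * (1 - cmod (u n))" for n
    proof -
      let ?v = "\<phi> s (u n)"
      have v: "?v \<in> unit_disc" using s u[of n] by (intro maps) auto
      have "?b ?v = inv_into unit_disc h (exp (- c * of_real s) * h (z n))"
        using conj[of s "z n"] s z(1) by (simp add: u_def)
      then have "1 - cmod (?b ?v) \<le> C * (1 - cmod (z n))" using C[of n] by simp
      also have "\<dots> \<le> \<bar>C\<bar> * (D * (1 - cmod (u n)))"
        using z_u[of n] z(1)[of n] by (intro mult_mono) auto
      finally have "D * (1 - cmod (?b ?v)) \<le> D * (\<bar>C\<bar> * (D * (1 - cmod (u n))))"
        using D by (intro mult_left_mono) auto
      moreover have "1 - cmod ?v \<le> D * (1 - cmod (?b ?v))"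
        using disc_involution_contact[OF \<alpha>, of "?b ?v"] b_in[OF v] bb[OF v] by (simp add: D_def)
      ultimately show ?thesis by (simp add: mult.assoc)
    qed
    moreover have "compact_op \<omega> (composition_op (\<phi> s))" using cpt s by (simp add: immediately_compact_def)
    moreover have "\<phi> s z \<in> unit_disc" if "z \<in> unit_disc" for z using s that by (intro maps) auto
    moreover have "1 \<le> \<omega> n" for n using \<omega> hardy_weight_ge_1 dirichlet_weight_ge_1 by auto
    ultimately show False
      using compact_composition_op_no_linear_contact[of \<omega> "\<phi> s" u "D * (\<bar>C\<bar> * D)"] u
        weight_mono[OF \<omega>] weight_inverse_not_summable[OF \<omega>] by blast
  qed
  \<comment> \<open>so \<open>\<phi> t\<close> maps the disc into a compact subset of the disc\<close>
  obtain g where g: "g holomorphic_on \<Omega>" "\<And>z. z \<in> unit_disc \<Longrightarrow> g (h z) = z"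
    using holomorphic_has_inverse[OF hol open_ball inj] unfolding img by metis
  define L where "L = ?b ` g ` (\<lambda>w. exp (- c * of_real t) * w) ` closure \<Omega>"
  have sub1: "(\<lambda>w. exp (- c * of_real t) * w) ` closure \<Omega> \<subseteq> \<Omega>" using main by blast
  have sub2: "g ` \<Omega> \<subseteq> unit_disc" using g(2) unfolding img[symmetric] by auto
  have "compact L"
    unfolding L_def
    by (intro compact_continuous_image cpt_cl contb continuous_on_subset[OF holomorphic_on_imp_continuous_on[OF g(1)]] sub1 continuous_intros)
       (use sub1 sub2 in blast)
  moreover have "L \<subseteq> unit_disc" unfolding L_def using sub1 sub2 b_in by blast
  ultimately have "\<exists>r<1. \<forall>z\<in>L. cmod z \<le> r" by (rule compact_subset_disc_radius)
  then obtain r where r: "r < 1" "\<And>z. z \<in> L \<Longrightarrow> cmod z \<le> r" by blast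
  have "cmod (\<phi> t z) \<le> r" if z: "z \<in> unit_disc" for z
  proof (rule r(2))
    let ?x = "?b (\<phi> t z)"
    have \<phi>z: "\<phi> t z \<in> unit_disc" using t z by (intro maps) auto
    have "h ?x = exp (- c * of_real t) * h (?b z)" using psi[of t "?b z"] t b_in[OF z] bb[OF z] by simp
    then have x: "?x = g (exp (- c * of_real t) * h (?b z))" using g(2)[OF b_in[OF \<phi>z]] by simp
    have "h (?b z) \<in> \<Omega>" using img b_in[OF z] by blast
    then have "h (?b z) \<in> closure \<Omega>" by (rule subsetD[OF closure_subset])
    then have "?b (g (exp (- c * of_real t) * h (?b z))) \<in> L" unfolding L_def by (intro imageI)
    then have "?b ?x \<in> L" by (simp only: x)
    then show "\<phi> t z \<in> L" by (simp only: bb[OF \<phi>z])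
  qed
  then show ?thesis using r(1) sup_norm_less_one_iff[OF self, of t] t by auto
qed

theorem theorem3p10:
  fixes \<omega> :: "nat \<Rightarrow> real"
    and \<phi> :: "real \<Rightarrow> complex \<Rightarrow> complex"
    and \<alpha> c :: complex
    and h :: "complex \<Rightarrow> complex"
    and \<Omega> :: "complex set"
  assumes "\<omega> = hardy_weight \<or> \<omega> = dirichlet_weight"
    and "semiflow \<phi>"
    and "C0_semigroup \<omega> (\<lambda>t. composition_op (\<phi> t))"
    and "immediately_compact \<omega> (\<lambda>t. composition_op (\<phi> t))"
    and "semiflow_model \<phi> \<alpha> c h \<Omega>"
    and "locally connected (frontier \<Omega>)"
  shows "((\<exists>t0>0. sup_norm (\<phi> t0) < 1) \<longleftrightarrow> (\<forall>t>0. sup_norm (\<phi> t) < 1)) \<and>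
    ((\<exists>t0>0. sup_norm (\<phi> t0) < 1) \<longrightarrow>
       immediately_trace_class \<omega> (\<lambda>t. composition_op (\<phi> t)))"
proof -
  have spread: "\<forall>t>0. sup_norm (\<phi> t) < 1" if "\<exists>t0>0. sup_norm (\<phi> t0) < 1"
    using that semiflow_model_sup_norm_spreads[OF assms(1,2,4,5,6)] by blast
  have "trace_class_op \<omega> (composition_op (\<phi> t))" if t: "t > 0" "sup_norm (\<phi> t) < 1" for t
  proof -
    have self: "\<phi> t ` unit_disc \<subseteq> unit_disc" and hol: "\<phi> t holomorphic_on unit_disc"
      using assms(2) t by (auto simp: semiflow_def)
    obtain r where r: "r < 1" "\<And>z. z \<in> unit_disc \<Longrightarrow> cmod (\<phi> t z) \<le> r"
      using t sup_norm_less_one_iff[OF self] by blast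
    show ?thesis
    proof (rule composition_op_trace_class[OF assms(1) hol])
      show "bounded_op \<omega> (composition_op (\<phi> t))" using assms(3) t by (simp add: C0_semigroup_def)
      \<comment> \<open>the supremum may be \<open>0\<close>, but the estimate divides by the bound\<close>
      show "0 < max r (1 / 2)" "max r (1 / 2) < 1" using r by auto
      show "cmod (\<phi> t z) \<le> max r (1 / 2)" if "z \<in> unit_disc" for z using r(2)[OF that] by simp
      show "\<phi> t z \<in> unit_disc" if "z \<in> unit_disc" for z using self that by blast
    qed
  qed
  then have "immediately_trace_class \<omega> (\<lambda>t. composition_op (\<phi> t))" if "\<exists>t0>0. sup_norm (\<phi> t0) < 1"
    using spread[OF that] by (simp add: immediately_trace_class_def)
  moreover have "\<exists>t0>0. sup_norm (\<phi> t0) < 1" if "\<forall>t>0. sup_norm (\<phi> t) < 1"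
    using that by (intro exI[of _ 1]) simp
  ultimately show ?thesis using spread by blast
qed

end
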